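(* Let $\Omega$ be a bounded convex Reinhardt domain in $\mathbb{C}^2$ and $\phi\in C(\overline{\Omega})$. Then the Toeplitz operator $T_{\phi}$ is compact on $A^2(\Omega)$ if and only if $\widetilde{T_{\phi}}(z)\to 0$ as $z\to b\Omega$.
   Context: $b\Omega$ denotes the boundary of $\Omega$. A domain $\Omega\subseteq\mathbb{C}^n$ is Reinhardt if $(\xi_1z_1,\ldots,\xi_nz_n)\in\Omega$ whenever $z\in\Omega$ and $|\xi_1|=\cdots=|\xi_n|=1$. $A^2(\Omega)$ is the Bergman space of holomorphic functions on $\Omega$ that are square integrable with respect to Lebesgue measure $dV$; $P:L^2(\Omega)\to A^2(\Omega)$ is the orthogonal (Bergman) projection; $K$ is the Bergman kernel of $\Omega$. For bounded $\phi$, the Toeplitz operator is $T_\phi:A^2(\Omega)\to A^2(\Omega)$, $T_\phi f=P(\phi f)$. The normalized Bergman kernel is $k_z(w)=K(w,z)/\sqrt{K(z,z)}$ for $z,w\in\Omega$. The Berezin transform of a bounded linear operator $T$ on $A^2(\Omega)$ is $\widetilde{T}(z)=\langle Tk_z,k_z\rangle$, $z\in\Omega$. "$z\to b\Omega$" means that the distance from $z\in\Omega$ to $b\Omega$ tends to $0$. *)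

theory Defs
  imports "HOL-Analysis.Analysis"
begin

definition reinhardt_domain :: "(complex ^ 'n) set \<Rightarrow> bool" where
  "reinhardt_domain \<Omega> \<longleftrightarrow>
     open \<Omega> \<and> connected \<Omega> \<and> \<Omega> \<noteq> {} \<and>
     (\<forall>z\<in>\<Omega>. \<forall>\<xi> :: complex ^ 'n. (\<forall>i. cmod (\<xi> $ i) = 1) \<longrightarrow> (\<chi> i. \<xi> $ i * z $ i) \<in> \<Omega>)"

text \<open>Holomorphy in several variables: real differentiability with a complex linear derivative.\<close>

definition holomorphic_sev :: "(complex ^ 'n \<Rightarrow> complex) \<Rightarrow> (complex ^ 'n) set \<Rightarrow> bool" where
  "holomorphic_sev f \<Omega> \<longleftrightarrow>
     (\<forall>z\<in>\<Omega>. \<exists>f'. (f has_derivative f') (at z) \<and> (\<forall>c v. f' (c *s v) = c * f' v))"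

definition L2_inner ::
  "(complex ^ 'n) set \<Rightarrow> (complex ^ 'n \<Rightarrow> complex) \<Rightarrow> (complex ^ 'n \<Rightarrow> complex) \<Rightarrow> complex" where
  "L2_inner \<Omega> f g = integral\<^sup>L (lebesgue_on \<Omega>) (\<lambda>z. f z * cnj (g z))"

definition L2_norm :: "(complex ^ 'n) set \<Rightarrow> (complex ^ 'n \<Rightarrow> complex) \<Rightarrow> real" where
  "L2_norm \<Omega> f = sqrt (integral\<^sup>L (lebesgue_on \<Omega>) (\<lambda>z. (cmod (f z))\<^sup>2))"

text \<open>
  A function on \<open>\<Omega>\<close> is represented by its extension by zero, so that elements of the Bergman
  space are equal as soon as they agree on \<open>\<Omega>\<close>.
\<close>

definition bergman_space :: "(complex ^ 'n) set \<Rightarrow> (complex ^ 'n \<Rightarrow> complex) set" where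
  "bergman_space \<Omega> =
     {f. holomorphic_sev f \<Omega> \<and> integrable (lebesgue_on \<Omega>) (\<lambda>z. (cmod (f z))\<^sup>2) \<and>
         (\<forall>z. z \<notin> \<Omega> \<longrightarrow> f z = 0)}"

text \<open>
  The orthogonal projection of a square integrable \<open>f\<close> onto the Bergman space: the unique
  \<open>g\<close> in it with \<open>f - g\<close> orthogonal to it.
\<close>

definition bergman_proj ::
  "(complex ^ 'n) set \<Rightarrow> (complex ^ 'n \<Rightarrow> complex) \<Rightarrow> complex ^ 'n \<Rightarrow> complex" where
  "bergman_proj \<Omega> f =
     (THE g. g \<in> bergman_space \<Omega> \<and>
        (\<forall>h\<in>bergman_space \<Omega>. L2_inner \<Omega> (\<lambda>z. f z - g z) h = 0))"

text \<open>\<open>bergman_kernel \<Omega> w z\<close> is \<open>K(w,z)\<close>, where \<open>K(\<cdot>,z)\<close> represents evaluation at \<open>z \<in> \<Omega>\<close>.\<close>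

definition bergman_kernel :: "(complex ^ 'n) set \<Rightarrow> complex ^ 'n \<Rightarrow> complex ^ 'n \<Rightarrow> complex" where
  "bergman_kernel \<Omega> w z =
     (THE k. k \<in> bergman_space \<Omega> \<and> (\<forall>f\<in>bergman_space \<Omega>. L2_inner \<Omega> f k = f z)) w"

definition normalized_kernel ::
  "(complex ^ 'n) set \<Rightarrow> complex ^ 'n \<Rightarrow> complex ^ 'n \<Rightarrow> complex" where
  "normalized_kernel \<Omega> z w = bergman_kernel \<Omega> w z / csqrt (bergman_kernel \<Omega> z z)"

definition toeplitz ::
  "(complex ^ 'n) set \<Rightarrow> (complex ^ 'n \<Rightarrow> complex) \<Rightarrow>
   (complex ^ 'n \<Rightarrow> complex) \<Rightarrow> complex ^ 'n \<Rightarrow> complex" where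
  "toeplitz \<Omega> \<phi> f = bergman_proj \<Omega> (\<lambda>z. \<phi> z * f z)"

definition berezin ::
  "(complex ^ 'n) set \<Rightarrow> ((complex ^ 'n \<Rightarrow> complex) \<Rightarrow> complex ^ 'n \<Rightarrow> complex) \<Rightarrow>
   complex ^ 'n \<Rightarrow> complex" where
  "berezin \<Omega> T z = L2_inner \<Omega> (T (normalized_kernel \<Omega> z)) (normalized_kernel \<Omega> z)"

text \<open>
  A linear operator on the Bergman space is compact if it maps every bounded sequence to a
  sequence that has a norm convergent subsequence.
\<close>

definition compact_operator ::
  "(complex ^ 'n) set \<Rightarrow> ((complex ^ 'n \<Rightarrow> complex) \<Rightarrow> complex ^ 'n \<Rightarrow> complex) \<Rightarrow> bool" where
  "compact_operator \<Omega> T \<longleftrightarrow>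
     (\<forall>f\<in>bergman_space \<Omega>. T f \<in> bergman_space \<Omega>) \<and>
     (\<forall>f\<in>bergman_space \<Omega>. \<forall>g\<in>bergman_space \<Omega>. \<forall>a b.
        T (\<lambda>z. a * f z + b * g z) = (\<lambda>z. a * T f z + b * T g z)) \<and>
     (\<forall>f :: nat \<Rightarrow> complex ^ 'n \<Rightarrow> complex.
        (\<forall>n. f n \<in> bergman_space \<Omega>) \<longrightarrow> (\<exists>C. \<forall>n. L2_norm \<Omega> (f n) \<le> C) \<longrightarrow>
        (\<exists>r g. strict_mono r \<and> g \<in> bergman_space \<Omega> \<and>
           (\<lambda>n. L2_norm \<Omega> (\<lambda>z. T (f (r n)) z - g z)) \<longlonglongrightarrow> 0))"

text \<open>The filter for \<open>z \<rightarrow> b\<Omega>\<close>, that is \<open>z \<in> \<Omega>\<close> and the distance from \<open>z\<close> to the boundary tends to 0.\<close>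

definition to_boundary :: "(complex ^ 'n) set \<Rightarrow> (complex ^ 'n) filter" where
  "to_boundary \<Omega> =
     inf (filtercomap (\<lambda>z. infdist z (frontier \<Omega>)) (nhds 0)) (principal \<Omega>)"

lemma eventually_to_boundary:
  "eventually Q (to_boundary \<Omega>) \<longleftrightarrow>
     (\<exists>\<delta>>0. \<forall>z\<in>\<Omega>. infdist z (frontier \<Omega>) < \<delta> \<longrightarrow> Q z)"
proof -
  have "eventually Q (to_boundary \<Omega>) \<longleftrightarrow>
      (\<exists>R. eventually R (nhds 0) \<and> (\<forall>z. R (infdist z (frontier \<Omega>)) \<longrightarrow> z \<in> \<Omega> \<longrightarrow> Q z))"
    unfolding to_boundary_def eventually_inf_principal eventually_filtercomap ..
  also have "\<dots> \<longleftrightarrow> (\<exists>\<delta>>0. \<forall>z\<in>\<Omega>. infdist z (frontier \<Omega>) < \<delta> \<longrightarrow> Q z)" (is "?L \<longleftrightarrow> ?R")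
  proof
    assume ?L
    then obtain R \<delta> where "\<delta> > 0" "\<And>x. dist x 0 < \<delta> \<Longrightarrow> R x"
      "\<And>z. R (infdist z (frontier \<Omega>)) \<Longrightarrow> z \<in> \<Omega> \<Longrightarrow> Q z"
      unfolding eventually_nhds_metric by blast
    then show ?R by (intro exI[of _ \<delta>]) (auto simp: infdist_nonneg)
  next
    assume ?R
    then obtain \<delta> where d: "\<delta> > 0" "\<And>z. z \<in> \<Omega> \<Longrightarrow> infdist z (frontier \<Omega>) < \<delta> \<Longrightarrow> Q z"
      by blast
    then show ?L
      unfolding eventually_nhds_metric
      by (intro exI[of _ "\<lambda>x. x < \<delta>"]) (auto simp: dist_real_def)
  qed
  finally show ?thesis .
qed

end

theory Submission imports Defs "HOL-Complex_Analysis.Great_Picard"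
begin

text \<open>
  Compactness of the operator and the decay of its Berezin transform are both equivalent to the
  vanishing of the symbol on the boundary. Let \<open>k\<^sub>z\<close> be the normalized kernel and \<open>\<mu>\<^sub>z\<close> the
  probability measure with density \<open>\<bar>k\<^sub>z\<bar>\<^sup>2\<close>; the Berezin transform of the Toeplitz operator with
  symbol \<open>\<phi>\<close> is the integral of \<open>\<phi>\<close> against \<open>\<mu>\<^sub>z\<close>.

  For a compact operator it suffices that the inner products of a fixed \<open>g\<close> with \<open>k\<^sub>z\<close> tend to 0. If
  \<open>\<zeta>\<close> is an affine function with positive real part on the domain that vanishes at the boundary
  point, then multiplication of \<open>g\<close> by \<open>\<delta> / (\<zeta> + \<delta>)\<close> with \<open>\<delta> = \<bar>\<zeta> z\<bar>\<close> makes the norm small and keeps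
  half of the value at \<open>z\<close> (\<open>normalized_evaluation_tendsto_zero\<close>). Conversely, a symbol that vanishes
  on the boundary is small off a compact set, on which bounded sequences of the Bergman space have
  convergent subsequences (\<open>compact_toeplitz_if_vanishing_on_frontier\<close>).

  The main point is that decay of the Berezin transform forces \<open>\<phi> p = 0\<close> at every boundary point
  \<open>p\<close>. The measures \<open>\<mu>\<^sub>z\<close> reproduce holomorphic functions, so their weak limits for \<open>z \<rightarrow> p\<close> are
  representing measures of \<open>p\<close>. As the domain is convex and Reinhardt, it has a supporting functional
  at \<open>p\<close> that is compatible with the moduli of the coordinates. Either \<open>p\<close> can be peaked on the
  contact set, the only representing measure is the point mass, and the limit is \<open>\<phi> p\<close>
  (\<open>berezin_tendsto_at_peak_point\<close>). Or the contact set is a disc on which one coordinate is constant,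
  of modulus \<open>R\<close> say, and the other one runs through the closed disc of radius \<open>t\<close>. Then the domain
  contains the bidisc of radii \<open>R\<close> and \<open>t\<close>, whose Bergman kernel is explicit and dominates that of the
  domain on the diagonal. If \<open>z\<close> approaches a point near the centre of the boundary disc, the
  kernel function of the bidisc extends to the domain, where it has nearly the same norm, because
  its mass concentrates at the boundary disc. So it is nearly extremal, hence close to \<open>k\<^sub>z\<close>, and the
  limit of the Berezin transform of \<open>\<phi>\<close> is the Berezin transform on the disc of radius \<open>t\<close> of the
  restriction of \<open>\<phi>\<close> (\<open>berezin_zero_on_face\<close>). That one is injective (\<open>disc_berezin_injective\<close>).
\<close>

section \<open>Square integrable functions\<close>

definition L2_space :: "(complex ^ 'n) set \<Rightarrow> (complex ^ 'n \<Rightarrow> complex) set" where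
  "L2_space \<Omega> = {f \<in> borel_measurable (lebesgue_on \<Omega>).
                    integrable (lebesgue_on \<Omega>) (\<lambda>z. (cmod (f z))\<^sup>2)}"

lemma L2_spaceI:
  "f \<in> borel_measurable (lebesgue_on \<Omega>) \<Longrightarrow> integrable (lebesgue_on \<Omega>) (\<lambda>z. (cmod (f z))\<^sup>2)
    \<Longrightarrow> f \<in> L2_space \<Omega>"
  by (simp add: L2_space_def)

lemma L2_space_measurable: "f \<in> L2_space \<Omega> \<Longrightarrow> f \<in> borel_measurable (lebesgue_on \<Omega>)"
  and L2_space_integrable: "f \<in> L2_space \<Omega> \<Longrightarrow> integrable (lebesgue_on \<Omega>) (\<lambda>z. (cmod (f z))\<^sup>2)"
  by (simp_all add: L2_space_def)

lemma L2_inner_integrable: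
  assumes "f \<in> L2_space \<Omega>" "g \<in> L2_space \<Omega>"
  shows "integrable (lebesgue_on \<Omega>) (\<lambda>z. f z * cnj (g z))"
proof (rule Bochner_Integration.integrable_bound)
  show "integrable (lebesgue_on \<Omega>) (\<lambda>z. (cmod (f z))\<^sup>2 + (cmod (g z))\<^sup>2)"
    using assms by (auto simp: L2_space_def)
  have [measurable]: "f \<in> borel_measurable (lebesgue_on \<Omega>)" "g \<in> borel_measurable (lebesgue_on \<Omega>)"
    using assms by (auto simp: L2_space_def)
  show "(\<lambda>z. f z * cnj (g z)) \<in> borel_measurable (lebesgue_on \<Omega>)"
    using borel_measurable_continuous_on[of cnj g "lebesgue_on \<Omega>"]
    by (intro borel_measurable_times) (auto intro!: continuous_intros)
  have "x * y \<le> x\<^sup>2 + y\<^sup>2" if "x \<ge> 0" "y \<ge> 0" for x y :: real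
    using sum_squares_bound[of x y] mult_nonneg_nonneg[OF that] by simp
  then show "AE z in lebesgue_on \<Omega>. norm (f z * cnj (g z)) \<le> norm ((cmod (f z))\<^sup>2 + (cmod (g z))\<^sup>2)"
    by (auto simp: norm_mult)
qed

lemma L2_inner_self: "L2_inner \<Omega> f f = of_real ((L2_norm \<Omega> f)\<^sup>2)"
proof -
  have "L2_inner \<Omega> f f = (\<integral>z. of_real ((cmod (f z))\<^sup>2) \<partial>lebesgue_on \<Omega>)"
    by (simp only: L2_inner_def complex_norm_square)
  also have "\<dots> = of_real (\<integral>z. (cmod (f z))\<^sup>2 \<partial>lebesgue_on \<Omega>)"
    by (rule integral_complex_of_real)
  finally show ?thesis
    by (simp add: L2_norm_def)
qed

lemma L2_norm_nonneg: "L2_norm \<Omega> f \<ge> 0"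
  by (simp add: L2_norm_def)

lemma L2_norm_power2: "(L2_norm \<Omega> f)\<^sup>2 = integral\<^sup>L (lebesgue_on \<Omega>) (\<lambda>z. (cmod (f z))\<^sup>2)"
  by (simp add: L2_norm_def)

lemma L2_inner_cnj: "cnj (L2_inner \<Omega> f g) = L2_inner \<Omega> g f"
proof -
  have "(\<lambda>z. g z * cnj (f z)) = (\<lambda>z. cnj (f z * cnj (g z)))"
    by (simp add: fun_eq_iff mult.commute)
  then show ?thesis
    unfolding L2_inner_def by (simp only: Bochner_Integration.integral_cnj)
qed

lemma L2_space_lincomb:
  assumes "f \<in> L2_space \<Omega>" "g \<in> L2_space \<Omega>"
  shows "(\<lambda>z. a * f z + b * g z) \<in> L2_space \<Omega>"
proof (rule L2_spaceI)
  have [measurable]: "f \<in> borel_measurable (lebesgue_on \<Omega>)" "g \<in> borel_measurable (lebesgue_on \<Omega>)"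
    using assms by (auto simp: L2_space_def)
  show "(\<lambda>z. a * f z + b * g z) \<in> borel_measurable (lebesgue_on \<Omega>)" by measurable
  show "integrable (lebesgue_on \<Omega>) (\<lambda>z. (cmod (a * f z + b * g z))\<^sup>2)"
  proof (rule Bochner_Integration.integrable_bound)
    show "integrable (lebesgue_on \<Omega>)
            (\<lambda>z. 2 * (cmod a)\<^sup>2 * (cmod (f z))\<^sup>2 + 2 * (cmod b)\<^sup>2 * (cmod (g z))\<^sup>2)"
      using assms by (auto simp: L2_space_def)
    show "(\<lambda>z. (cmod (a * f z + b * g z))\<^sup>2) \<in> borel_measurable (lebesgue_on \<Omega>)" by measurable
    have "(cmod (u + v))\<^sup>2 \<le> 2 * (cmod u)\<^sup>2 + 2 * (cmod v)\<^sup>2" for u v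
    proof -
      have "(cmod (u + v))\<^sup>2 \<le> (cmod u + cmod v)\<^sup>2"
        by (simp add: norm_triangle_ineq power_mono)
      also have "\<dots> \<le> 2 * (cmod u)\<^sup>2 + 2 * (cmod v)\<^sup>2"
        using sum_squares_bound[of "cmod u" "cmod v"] by (simp add: power2_sum)
      finally show ?thesis .
    qed
    from this[of "a * f z" "b * g z" for z]
    show "AE z in lebesgue_on \<Omega>. norm ((cmod (a * f z + b * g z))\<^sup>2) \<le>
            norm (2 * (cmod a)\<^sup>2 * (cmod (f z))\<^sup>2 + 2 * (cmod b)\<^sup>2 * (cmod (g z))\<^sup>2)"
      by (auto simp: norm_mult power_mult_distrib mult.assoc)
  qed
qed

lemma L2_space_diff: "f \<in> L2_space \<Omega> \<Longrightarrow> g \<in> L2_space \<Omega> \<Longrightarrow> (\<lambda>z. f z - g z) \<in> L2_space \<Omega>"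
  using L2_space_lincomb[where a=1 and b="-1"] by force

lemma L2_space_cmult: "f \<in> L2_space \<Omega> \<Longrightarrow> (\<lambda>z. a * f z) \<in> L2_space \<Omega>"
  using L2_space_lincomb[where b=0] by force

lemma L2_inner_lincomb_left:
  assumes "f \<in> L2_space \<Omega>" "g \<in> L2_space \<Omega>" "h \<in> L2_space \<Omega>"
  shows "L2_inner \<Omega> (\<lambda>z. a * f z + b * g z) h = a * L2_inner \<Omega> f h + b * L2_inner \<Omega> g h"
proof -
  have "(\<lambda>z. (a * f z + b * g z) * cnj (h z)) = (\<lambda>z. a * (f z * cnj (h z)) + b * (g z * cnj (h z)))"
    by (auto simp: algebra_simps)
  then show ?thesis
    using L2_inner_integrable[OF assms(1,3)] L2_inner_integrable[OF assms(2,3)]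
    by (simp add: L2_inner_def)
qed

lemma L2_inner_lincomb_right:
  assumes "f \<in> L2_space \<Omega>" "g \<in> L2_space \<Omega>" "h \<in> L2_space \<Omega>"
  shows "L2_inner \<Omega> h (\<lambda>z. a * f z + b * g z) = cnj a * L2_inner \<Omega> h f + cnj b * L2_inner \<Omega> h g"
  using arg_cong[OF L2_inner_lincomb_left[OF assms, of a b], of cnj] by (simp add: L2_inner_cnj)

lemma L2_inner_diff_left:
  "f \<in> L2_space \<Omega> \<Longrightarrow> g \<in> L2_space \<Omega> \<Longrightarrow> h \<in> L2_space \<Omega> \<Longrightarrow>
    L2_inner \<Omega> (\<lambda>z. f z - g z) h = L2_inner \<Omega> f h - L2_inner \<Omega> g h"
  using L2_inner_lincomb_left[of f \<Omega> g h 1 "-1"] by simp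

lemma L2_inner_diff_right:
  "f \<in> L2_space \<Omega> \<Longrightarrow> g \<in> L2_space \<Omega> \<Longrightarrow> h \<in> L2_space \<Omega> \<Longrightarrow>
    L2_inner \<Omega> h (\<lambda>z. f z - g z) = L2_inner \<Omega> h f - L2_inner \<Omega> h g"
  using L2_inner_lincomb_right[of f \<Omega> g h 1 "-1"] by simp

lemma L2_norm_lincomb_power2:
  assumes "f \<in> L2_space \<Omega>" "g \<in> L2_space \<Omega>"
  shows "(L2_norm \<Omega> (\<lambda>z. f z + b * g z))\<^sup>2 =
    (L2_norm \<Omega> f)\<^sup>2 + (cmod b)\<^sup>2 * (L2_norm \<Omega> g)\<^sup>2 + 2 * Re (cnj b * L2_inner \<Omega> f g)"
proof -
  have s: "(\<lambda>z. f z + b * g z) \<in> L2_space \<Omega>" using L2_space_lincomb[OF assms, of 1 b] by simp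
  have "L2_inner \<Omega> (\<lambda>z. f z + b * g z) (\<lambda>z. f z + b * g z) =
      L2_inner \<Omega> f f + cnj b * L2_inner \<Omega> f g + (b * L2_inner \<Omega> g f + b * cnj b * L2_inner \<Omega> g g)"
    using L2_inner_lincomb_left[OF assms s, of 1 b] L2_inner_lincomb_right[OF assms assms(1), of 1 b]
      L2_inner_lincomb_right[OF assms assms(2), of 1 b] by (simp add: algebra_simps)
  then have "of_real ((L2_norm \<Omega> (\<lambda>z. f z + b * g z))\<^sup>2) =
      of_real ((L2_norm \<Omega> f)\<^sup>2) + cnj b * L2_inner \<Omega> f g
        + (cnj (cnj b * L2_inner \<Omega> f g) + of_real ((cmod b)\<^sup>2) * of_real ((L2_norm \<Omega> g)\<^sup>2))"
    by (simp add: L2_inner_self L2_inner_cnj complex_norm_square[of b] del: of_real_power)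
  from arg_cong[OF this, of Re] show ?thesis by simp
qed

lemma L2_norm_diff_power2:
  assumes "f \<in> L2_space \<Omega>" "g \<in> L2_space \<Omega>"
  shows "(L2_norm \<Omega> (\<lambda>z. f z - g z))\<^sup>2 =
    (L2_norm \<Omega> f)\<^sup>2 + (L2_norm \<Omega> g)\<^sup>2 - 2 * Re (L2_inner \<Omega> f g)"
  using L2_norm_lincomb_power2[OF assms, of "-1"] by simp

lemma L2_norm_cmult: "L2_norm \<Omega> (\<lambda>z. a * f z) = cmod a * L2_norm \<Omega> f"
  by (simp add: L2_norm_def norm_mult power_mult_distrib real_sqrt_mult)

lemma L2_Cauchy_Schwarz:
  assumes "f \<in> L2_space \<Omega>" "g \<in> L2_space \<Omega>"
  shows "cmod (L2_inner \<Omega> f g) \<le> L2_norm \<Omega> f * L2_norm \<Omega> g"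
proof -
  define c where "c = L2_inner \<Omega> f g"
  have main: "2 * t * (cmod c)\<^sup>2 \<le> (L2_norm \<Omega> f)\<^sup>2 + t\<^sup>2 * (cmod c)\<^sup>2 * (L2_norm \<Omega> g)\<^sup>2" for t :: real
  proof -
    have "0 \<le> (L2_norm \<Omega> (\<lambda>z. f z + (- of_real t * c) * g z))\<^sup>2" by simp
    also have "\<dots> = (L2_norm \<Omega> f)\<^sup>2 + (cmod (- of_real t * c))\<^sup>2 * (L2_norm \<Omega> g)\<^sup>2
        + 2 * Re (cnj (- of_real t * c) * c)"
      unfolding c_def by (rule L2_norm_lincomb_power2[OF assms])
    also have "cnj (- of_real t * c) * c = of_real (- t * (cmod c)\<^sup>2)"
      using complex_norm_square[of c] by (simp add: mult.commute mult.left_commute)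
    finally show ?thesis by (simp add: norm_mult power_mult_distrib)
  qed
  show ?thesis
  proof (cases "c = 0")
    case True
    then show ?thesis by (simp add: c_def[symmetric] L2_norm_nonneg)
  next
    case False
    have "L2_norm \<Omega> g \<noteq> 0"
    proof
      assume g: "L2_norm \<Omega> g = 0"
      have "2 * (((L2_norm \<Omega> f)\<^sup>2 + 1) / (2 * (cmod c)\<^sup>2)) * (cmod c)\<^sup>2 \<le> (L2_norm \<Omega> f)\<^sup>2"
        using main[of "((L2_norm \<Omega> f)\<^sup>2 + 1) / (2 * (cmod c)\<^sup>2)"] g by simp
      then show False using False by simp
    qed
    then have g: "(L2_norm \<Omega> g)\<^sup>2 > 0" by simp
    have "2 * (1 / (L2_norm \<Omega> g)\<^sup>2) * (cmod c)\<^sup>2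
        \<le> (L2_norm \<Omega> f)\<^sup>2 + (1 / (L2_norm \<Omega> g)\<^sup>2)\<^sup>2 * (cmod c)\<^sup>2 * (L2_norm \<Omega> g)\<^sup>2"
      by (rule main)
    also have "(1 / (L2_norm \<Omega> g)\<^sup>2)\<^sup>2 * (cmod c)\<^sup>2 * (L2_norm \<Omega> g)\<^sup>2
        = (cmod c)\<^sup>2 / (L2_norm \<Omega> g)\<^sup>2"
      using g by (simp add: power2_eq_square)
    finally have "(cmod c)\<^sup>2 / (L2_norm \<Omega> g)\<^sup>2 \<le> (L2_norm \<Omega> f)\<^sup>2" by simp
    then have "(cmod c)\<^sup>2 \<le> (L2_norm \<Omega> f)\<^sup>2 * (L2_norm \<Omega> g)\<^sup>2"
      using g by (simp add: pos_divide_le_eq)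
    then have "(cmod c)\<^sup>2 \<le> (L2_norm \<Omega> f * L2_norm \<Omega> g)\<^sup>2" by (simp add: power_mult_distrib)
    then show ?thesis
      unfolding c_def by (rule power2_le_imp_le) (simp add: L2_norm_nonneg)
  qed
qed

lemma L2_norm_triangle:
  assumes "f \<in> L2_space \<Omega>" "g \<in> L2_space \<Omega>"
  shows "L2_norm \<Omega> (\<lambda>z. f z + g z) \<le> L2_norm \<Omega> f + L2_norm \<Omega> g"
proof (rule power2_le_imp_le)
  have "Re (L2_inner \<Omega> f g) \<le> L2_norm \<Omega> f * L2_norm \<Omega> g"
    using L2_Cauchy_Schwarz[OF assms] complex_Re_le_cmod order_trans by blast
  then show "(L2_norm \<Omega> (\<lambda>z. f z + g z))\<^sup>2 \<le> (L2_norm \<Omega> f + L2_norm \<Omega> g)\<^sup>2"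
    using L2_norm_lincomb_power2[OF assms, of 1] by (simp add: power2_sum)
qed (simp add: L2_norm_nonneg)

lemma L2_norm_minus_commute: "L2_norm \<Omega> (\<lambda>z. f z - g z) = L2_norm \<Omega> (\<lambda>z. g z - f z)"
  by (simp add: L2_norm_def norm_minus_commute)

lemma L2_space_bounded_mult:
  assumes "f \<in> L2_space \<Omega>" "u \<in> borel_measurable (lebesgue_on \<Omega>)" "\<And>z. z \<in> \<Omega> \<Longrightarrow> cmod (u z) \<le> B"
    and "\<Omega> \<in> sets lebesgue"
  shows "(\<lambda>z. u z * f z) \<in> L2_space \<Omega>"
    and "0 \<le> B \<Longrightarrow> L2_norm \<Omega> (\<lambda>z. u z * f z) \<le> B * L2_norm \<Omega> f"
proof -
  have [measurable]: "f \<in> borel_measurable (lebesgue_on \<Omega>)" "u \<in> borel_measurable (lebesgue_on \<Omega>)"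
    using assms by (auto simp: L2_space_def)
  have sp: "space (lebesgue_on \<Omega>) = \<Omega>" by (simp add: space_restrict_space)
  have bd: "(cmod (u z * f z))\<^sup>2 \<le> B\<^sup>2 * (cmod (f z))\<^sup>2" if "z \<in> \<Omega>" for z
    unfolding norm_mult power_mult_distrib
    using assms(3)[OF that] by (intro mult_right_mono power_mono) auto
  have i: "integrable (lebesgue_on \<Omega>) (\<lambda>z. B\<^sup>2 * (cmod (f z))\<^sup>2)"
    using assms by (auto simp: L2_space_def)
  have i2: "integrable (lebesgue_on \<Omega>) (\<lambda>z. (cmod (u z * f z))\<^sup>2)"
    by (rule Bochner_Integration.integrable_bound[OF i]) (auto intro!: AE_I2 simp: sp bd)
  then show *: "(\<lambda>z. u z * f z) \<in> L2_space \<Omega>"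
    by (intro L2_spaceI) auto
  assume B: "0 \<le> B"
  have "(L2_norm \<Omega> (\<lambda>z. u z * f z))\<^sup>2 \<le> (\<integral>z. B\<^sup>2 * (cmod (f z))\<^sup>2 \<partial>lebesgue_on \<Omega>)"
    unfolding L2_norm_power2 by (rule integral_mono[OF i2 i]) (auto simp: sp bd)
  also have "\<dots> = (B * L2_norm \<Omega> f)\<^sup>2" by (simp add: L2_norm_power2 power_mult_distrib)
  finally show "L2_norm \<Omega> (\<lambda>z. u z * f z) \<le> B * L2_norm \<Omega> f"
    using B L2_norm_nonneg by (meson mult_nonneg_nonneg power2_le_imp_le)
qed

section \<open>Holomorphic functions of several variables\<close>

lemma holomorphic_sev_has_derivative:
  assumes "holomorphic_sev f \<Omega>" "z \<in> \<Omega>"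
  shows "(f has_derivative frechet_derivative f (at z)) (at z)"
    and "frechet_derivative f (at z) (c *s v) = c * frechet_derivative f (at z) v"
proof -
  obtain f' where f': "(f has_derivative f') (at z)" "\<And>c v. f' (c *s v) = c * f' v"
    using assms by (auto simp: holomorphic_sev_def)
  then have "frechet_derivative f (at z) = f'"
    by (metis frechet_derivative_at)
  with f' show "(f has_derivative frechet_derivative f (at z)) (at z)"
    "frechet_derivative f (at z) (c *s v) = c * frechet_derivative f (at z) v" by simp_all
qed

lemma holomorphic_sev_imp_continuous_on: "holomorphic_sev f \<Omega> \<Longrightarrow> continuous_on \<Omega> f"
  by (meson continuous_at_imp_continuous_on has_derivative_continuous holomorphic_sev_has_derivative(1))

lemma holomorphic_sev_const: "holomorphic_sev (\<lambda>z. c) \<Omega>"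
  unfolding holomorphic_sev_def by (intro ballI exI[of _ "\<lambda>_. 0"]) auto

lemma holomorphic_sev_coord: "holomorphic_sev (\<lambda>z. z $ i) \<Omega>"
  unfolding holomorphic_sev_def
  by (intro ballI exI[of _ "\<lambda>z. z $ i"])
     (auto intro: bounded_linear_imp_has_derivative bounded_linear_vec_nth)

lemma holomorphic_sev_add:
  assumes "holomorphic_sev f \<Omega>" "holomorphic_sev g \<Omega>"
  shows "holomorphic_sev (\<lambda>z. f z + g z) \<Omega>"
  unfolding holomorphic_sev_def
proof
  fix z assume z: "z \<in> \<Omega>"
  obtain f' g' where "(f has_derivative f') (at z)" "\<And>c v. f' (c *s v) = c * f' v"
    "(g has_derivative g') (at z)" "\<And>c v. g' (c *s v) = c * g' v"
    using assms z by (metis holomorphic_sev_def)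
  then show "\<exists>F'. ((\<lambda>z. f z + g z) has_derivative F') (at z) \<and> (\<forall>c v. F' (c *s v) = c * F' v)"
    by (intro exI[of _ "\<lambda>v. f' v + g' v"]) (auto intro: has_derivative_add simp: algebra_simps)
qed

lemma holomorphic_sev_mult:
  assumes "holomorphic_sev f \<Omega>" "holomorphic_sev g \<Omega>"
  shows "holomorphic_sev (\<lambda>z. f z * g z) \<Omega>"
  unfolding holomorphic_sev_def
proof
  fix z assume z: "z \<in> \<Omega>"
  obtain f' g' where "(f has_derivative f') (at z)" "\<And>c v. f' (c *s v) = c * f' v"
    "(g has_derivative g') (at z)" "\<And>c v. g' (c *s v) = c * g' v"
    using assms z by (metis holomorphic_sev_def)
  then show "\<exists>F'. ((\<lambda>z. f z * g z) has_derivative F') (at z) \<and> (\<forall>c v. F' (c *s v) = c * F' v)"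
    by (intro exI[of _ "\<lambda>v. f z * g' v + f' v * g z"]) (auto intro: has_derivative_mult simp: algebra_simps)
qed

lemma holomorphic_sev_compose:
  assumes "holomorphic_sev f \<Omega>" "\<And>z. z \<in> \<Omega> \<Longrightarrow> \<exists>h'. (h has_field_derivative h') (at (f z))"
  shows "holomorphic_sev (\<lambda>z. h (f z)) \<Omega>"
  unfolding holomorphic_sev_def
proof
  fix z assume z: "z \<in> \<Omega>"
  obtain f' where f': "(f has_derivative f') (at z)" "\<And>c v. f' (c *s v) = c * f' v"
    using assms(1) z by (metis holomorphic_sev_def)
  obtain h' where h': "(h has_field_derivative h') (at (f z))" using assms(2) z by blast
  have "((\<lambda>z. h (f z)) has_derivative (\<lambda>v. h' * f' v)) (at z)"
    using has_derivative_compose[OF f'(1) h'[unfolded has_field_derivative_def]] by simp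
  then show "\<exists>F'. ((\<lambda>z. h (f z)) has_derivative F') (at z) \<and> (\<forall>c v. F' (c *s v) = c * F' v)"
    by (intro exI[of _ "\<lambda>v. h' * f' v"]) (auto simp: f'(2))
qed

lemma holomorphic_sev_transform:
  assumes "holomorphic_sev f \<Omega>" "open \<Omega>" "\<And>z. z \<in> \<Omega> \<Longrightarrow> f z = g z"
  shows "holomorphic_sev g \<Omega>"
  unfolding holomorphic_sev_def
proof
  fix z assume z: "z \<in> \<Omega>"
  obtain f' where "(f has_derivative f') (at z)" "\<And>c v. f' (c *s v) = c * f' v"
    using assms(1) z by (metis holomorphic_sev_def)
  moreover have "(g has_derivative f') (at z)"
    by (rule has_derivative_transform_within_open[OF calculation(1) assms(2) z]) (use assms(3) in auto)
  ultimately show "\<exists>F'. (g has_derivative F') (at z) \<and> (\<forall>c v. F' (c *s v) = c * F' v)"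
    by blast
qed

lemma holomorphic_sev_subset: "holomorphic_sev f \<Omega> \<Longrightarrow> \<Omega>' \<subseteq> \<Omega> \<Longrightarrow> holomorphic_sev f \<Omega>'"
  by (auto simp: holomorphic_sev_def)

lemma bounded_linear_smult_left: "bounded_linear (\<lambda>\<zeta>::complex. \<zeta> *s (v :: complex ^ 'n))"
  by (intro linear_conv_bounded_linear[THEN iffD1] linearI)
     (auto simp: vec_eq_iff algebra_simps)

lemma norm_smult_complex: "norm (c *s (v :: complex ^ 'n)) = cmod c * norm v"
  by (simp add: norm_vec_def L2_set_def norm_mult power_mult_distrib sum_distrib_left[symmetric] real_sqrt_mult)

lemma holomorphic_on_line:
  assumes "holomorphic_sev f \<Omega>" "\<And>\<zeta>. \<zeta> \<in> S \<Longrightarrow> z + \<zeta> *s v \<in> \<Omega>"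
  shows "(\<lambda>\<zeta>. f (z + \<zeta> *s v)) holomorphic_on S"
proof (rule holomorphic_onI)
  fix \<zeta> assume "\<zeta> \<in> S"
  then have *: "z + \<zeta> *s v \<in> \<Omega>" by (rule assms(2))
  let ?D = "frechet_derivative f (at (z + \<zeta> *s v))"
  have l: "((\<lambda>\<zeta>. z + \<zeta> *s v) has_derivative (\<lambda>h. h *s v)) (at \<zeta> within S)"
    using has_derivative_add[OF has_derivative_const bounded_linear_imp_has_derivative[OF bounded_linear_smult_left]]
    by simp
  have "((\<lambda>\<zeta>. f (z + \<zeta> *s v)) has_derivative (\<lambda>h. ?D (h *s v))) (at \<zeta> within S)"
    using has_derivative_compose[OF l holomorphic_sev_has_derivative(1)[OF assms(1) *]] .
  moreover have "(\<lambda>h. ?D (h *s v)) = (*) (?D v)"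
    using holomorphic_sev_has_derivative(2)[OF assms(1) *] by (auto simp: mult.commute)
  ultimately show "(\<lambda>\<zeta>. f (z + \<zeta> *s v)) field_differentiable at \<zeta> within S"
    unfolding field_differentiable_def has_field_derivative_def by auto
qed

text \<open>
  The one-variable Cauchy estimate on the complex line through \<open>z\<close> in the direction \<open>v\<close>, where the
  ball of radius \<open>r\<close> becomes a disc of radius \<open>r / norm v\<close>.
\<close>

lemma Cauchy_estimate_sev:
  fixes f :: "complex ^ 'n \<Rightarrow> complex"
  assumes hol: "holomorphic_sev f \<Omega>" and sub: "cball z r \<subseteq> \<Omega>" and r: "r > 0"
    and bd: "\<And>w. w \<in> cball z r \<Longrightarrow> cmod (f w) \<le> B"
  shows "cmod (frechet_derivative f (at z) v) \<le> B / r * norm v"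
proof (cases "v = 0")
  case True
  have "z \<in> \<Omega>" using sub r by auto
  then have "frechet_derivative f (at z) 0 = 0"
    using linear_0[OF has_derivative_linear[OF holomorphic_sev_has_derivative(1)[OF hol]]] by simp
  with True show ?thesis by simp
next
  case False
  let ?\<rho> = "r / norm v"
  have \<rho>: "?\<rho> > 0" using False r by simp
  have zin: "z \<in> \<Omega>" using sub r by auto
  have in_ball: "z + \<zeta> *s v \<in> cball z r" if "\<zeta> \<in> cball 0 ?\<rho>" for \<zeta>
    using that False by (simp add: dist_norm norm_smult_complex field_simps)
  have holg: "(\<lambda>\<zeta>. f (z + \<zeta> *s v)) holomorphic_on cball 0 ?\<rho>"
    by (rule holomorphic_on_line[OF hol]) (use in_ball sub in blast)
  have "cmod ((deriv ^^ 1) (\<lambda>\<zeta>. f (z + \<zeta> *s v)) 0) \<le> fact 1 * B / ?\<rho> ^ 1"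
  proof (rule Cauchy_inequality)
    show "(\<lambda>\<zeta>. f (z + \<zeta> *s v)) holomorphic_on ball 0 ?\<rho>"
      by (rule holomorphic_on_subset[OF holg]) auto
    show "continuous_on (cball 0 ?\<rho>) (\<lambda>\<zeta>. f (z + \<zeta> *s v))"
      by (rule holomorphic_on_imp_continuous_on[OF holg])
    show "cmod (f (z + x *s v)) \<le> B" if "cmod (0 - x) = ?\<rho>" for x
      by (rule bd[OF in_ball]) (use that in simp)
  qed (use \<rho> in auto)
  moreover have "deriv (\<lambda>\<zeta>. f (z + \<zeta> *s v)) 0 = frechet_derivative f (at z) v"
  proof -
    have l: "((\<lambda>\<zeta>. z + \<zeta> *s v) has_derivative (\<lambda>h. h *s v)) (at 0)"
      using has_derivative_add[OF has_derivative_const bounded_linear_imp_has_derivative[OF bounded_linear_smult_left]]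
      by simp
    have "((\<lambda>\<zeta>. f (z + \<zeta> *s v)) has_derivative (\<lambda>h. frechet_derivative f (at z) (h *s v))) (at 0)"
      using has_derivative_compose[OF l, of f "frechet_derivative f (at z)"]
        holomorphic_sev_has_derivative(1)[OF hol zin] by simp
    moreover have "(\<lambda>h. frechet_derivative f (at z) (h *s v)) = (*) (frechet_derivative f (at z) v)"
      using holomorphic_sev_has_derivative(2)[OF hol zin] by (auto simp: mult.commute)
    ultimately show ?thesis
      by (intro DERIV_imp_deriv) (simp add: has_field_derivative_def)
  qed
  ultimately show ?thesis by (simp add: field_simps)
qed

lemma holomorphic_sev_Lipschitz:
  fixes f :: "complex ^ 'n \<Rightarrow> complex"
  assumes hol: "holomorphic_sev f \<Omega>" and sub: "ball z (2 * r) \<subseteq> \<Omega>" and r: "r > 0"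
    and bd: "\<And>w. w \<in> ball z (2 * r) \<Longrightarrow> cmod (f w) \<le> B"
    and xy: "x \<in> ball z r" "y \<in> ball z r"
  shows "cmod (f x - f y) \<le> 2 * B / r * norm (x - y)"
proof (rule differentiable_bound[OF convex_ball[of z r] _ _ xy])
  fix u assume u: "u \<in> ball z r"
  have sub': "cball u (r / 2) \<subseteq> ball z (2 * r)"
  proof
    fix w assume "w \<in> cball u (r / 2)"
    then have "dist z w \<le> dist z u + r / 2" using dist_triangle[of z w u] by simp
    then show "w \<in> ball z (2 * r)" using u r by simp
  qed
  have "u \<in> \<Omega>" using sub u r by (auto simp: subset_iff)
  then show "(f has_derivative frechet_derivative f (at u)) (at u within ball z r)"
    using holomorphic_sev_has_derivative(1)[OF hol] has_derivative_at_withinI by blast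
  show "onorm (frechet_derivative f (at u)) \<le> 2 * B / r"
  proof (rule onorm_le)
    fix v
    have "cmod (frechet_derivative f (at u) v) \<le> B / (r / 2) * norm v"
      by (rule Cauchy_estimate_sev[OF hol]) (use sub sub' r bd in auto)
    then show "cmod (frechet_derivative f (at u) v) \<le> 2 * B / r * norm v" by (simp add: field_simps)
  qed
qed

text \<open>
  By the Cauchy estimates the derivatives converge locally uniformly as well, so the limit is
  differentiable, and its derivative is a limit of complex linear maps.
\<close>

lemma holomorphic_sev_uniform_limit:
  fixes f :: "nat \<Rightarrow> complex ^ 'n \<Rightarrow> complex"
  assumes hol: "\<And>n. holomorphic_sev (f n) \<Omega>"
    and unif: "\<And>z. z \<in> \<Omega> \<Longrightarrow> \<exists>r>0. ball z r \<subseteq> \<Omega> \<and> uniformly_Cauchy_on (ball z r) f"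
    and lim: "\<And>z. z \<in> \<Omega> \<Longrightarrow> (\<lambda>n. f n z) \<longlonglongrightarrow> g z"
  shows "holomorphic_sev g \<Omega>"
  unfolding holomorphic_sev_def
proof
  fix z assume z: "z \<in> \<Omega>"
  then obtain r where r: "r > 0" "ball z r \<subseteq> \<Omega>" "uniformly_Cauchy_on (ball z r) f" using unif by blast
  define S where "S = ball z (r / 2)"
  have inS: "x \<in> \<Omega>" "cball x (r / 4) \<subseteq> ball z r" if "x \<in> S" for x
  proof -
    show *: "cball x (r / 4) \<subseteq> ball z r"
    proof
      fix w assume "w \<in> cball x (r / 4)"
      then have "dist z w \<le> dist z x + r / 4" using dist_triangle[of z w x] by simp
      then show "w \<in> ball z r" using that r by (simp add: S_def)
    qed
    show "x \<in> \<Omega>" using * r by (meson centre_in_cball divide_nonneg_pos less_imp_le subsetD zero_less_numeral)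
  qed
  have der: "(f n has_derivative frechet_derivative (f n) (at x)) (at x within S)" if "x \<in> S" for n x
    using holomorphic_sev_has_derivative(1)[OF hol inS(1)[OF that]] has_derivative_at_withinI by blast
  have bound: "\<exists>N. \<forall>m\<ge>N. \<forall>n\<ge>N. \<forall>x\<in>S. \<forall>h.
      cmod (frechet_derivative (f m) (at x) h - frechet_derivative (f n) (at x) h) \<le> e * norm h"
    if e: "e > 0" for e
  proof -
    have "e * (r / 4) > 0" using e r by simp
    then obtain N where N: "\<And>m n w. m \<ge> N \<Longrightarrow> n \<ge> N \<Longrightarrow> w \<in> ball z r \<Longrightarrow> dist (f m w) (f n w) < e * (r / 4)"
      using r(3) unfolding uniformly_Cauchy_on_def by blast
    show ?thesis
    proof (intro exI[of _ N] allI impI ballI)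
      fix m n x h assume mn: "m \<ge> N" "n \<ge> N" and x: "x \<in> S"
      have hd: "holomorphic_sev (\<lambda>w. f m w - f n w) \<Omega>"
        using holomorphic_sev_add[OF hol[of m] holomorphic_sev_mult[OF holomorphic_sev_const[of "-1"] hol[of n]]]
        by simp
      have "cmod (frechet_derivative (\<lambda>w. f m w - f n w) (at x) h) \<le> (e * (r / 4)) / (r / 4) * norm h"
      proof (rule Cauchy_estimate_sev[OF hd])
        show "cball x (r / 4) \<subseteq> \<Omega>" using inS(2)[OF x] r by blast
        show "cmod (f m w - f n w) \<le> e * (r / 4)" if "w \<in> cball x (r / 4)" for w
          using N[OF mn, of w] inS(2)[OF x] that by (auto simp: dist_norm subset_iff)
      qed (use r in auto)
      moreover have "frechet_derivative (\<lambda>w. f m w - f n w) (at x) =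
          (\<lambda>h. frechet_derivative (f m) (at x) h - frechet_derivative (f n) (at x) h)"
        by (rule frechet_derivative_at[symmetric])
           (intro has_derivative_diff holomorphic_sev_has_derivative(1)[OF hol inS(1)[OF x]])
      ultimately show "cmod (frechet_derivative (f m) (at x) h - frechet_derivative (f n) (at x) h) \<le> e * norm h"
        using r by simp
    qed
  qed
  have conv: "convergent (\<lambda>n. frechet_derivative (f n) (at x) h)" if x: "x \<in> S" for x h
  proof (rule Cauchy_convergent, unfold Cauchy_def, intro allI impI)
    fix e :: real assume e: "e > 0"
    define e' where "e' = e / (2 * (norm h + 1))"
    have e': "e' > 0" unfolding e'_def using e by (simp add: add_nonneg_pos)
    have less: "e' * norm h < e"
      unfolding e'_def using e by (simp add: field_simps add_nonneg_pos add_pos_nonneg)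
    obtain N where N: "\<And>m n x h. m \<ge> N \<Longrightarrow> n \<ge> N \<Longrightarrow> x \<in> S \<Longrightarrow>
        cmod (frechet_derivative (f m) (at x) h - frechet_derivative (f n) (at x) h) \<le> e' * norm h"
      using bound[OF e'] by blast
    show "\<exists>M. \<forall>m\<ge>M. \<forall>n\<ge>M. dist (frechet_derivative (f m) (at x) h) (frechet_derivative (f n) (at x) h) < e"
      unfolding dist_norm using le_less_trans[OF N less] x by blast
  qed
  define D where "D x h = lim (\<lambda>n. frechet_derivative (f n) (at x) h)" for x h
  have D: "(\<lambda>n. frechet_derivative (f n) (at x) h) \<longlonglongrightarrow> D x h" if "x \<in> S" for x h
    using conv[OF that] unfolding D_def by (simp add: convergent_LIMSEQ_iff)
  have Cauchy: "\<forall>\<^sub>F n in sequentially. \<forall>x\<in>S. \<forall>h. cmod (frechet_derivative (f n) (at x) h - D x h) \<le> e * norm h"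
    if e: "e > 0" for e
  proof -
    obtain N where N: "\<And>m n x h. m \<ge> N \<Longrightarrow> n \<ge> N \<Longrightarrow> x \<in> S \<Longrightarrow>
        cmod (frechet_derivative (f m) (at x) h - frechet_derivative (f n) (at x) h) \<le> e * norm h"
      using bound[OF e] by blast
    have "cmod (frechet_derivative (f n) (at x) h - D x h) \<le> e * norm h" if n: "n \<ge> N" and x: "x \<in> S" for n x h
    proof (rule tendsto_upperbound)
      show "(\<lambda>m. cmod (frechet_derivative (f n) (at x) h - frechet_derivative (f m) (at x) h)) \<longlonglongrightarrow>
          cmod (frechet_derivative (f n) (at x) h - D x h)"
        by (intro tendsto_intros D x)
      show "\<forall>\<^sub>F m in sequentially. cmod (frechet_derivative (f n) (at x) h - frechet_derivative (f m) (at x) h) \<le> e * norm h"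
        using N[OF n _ x] by (auto simp: eventually_sequentially)
    qed simp
    then show ?thesis by (auto simp: eventually_sequentially)
  qed
  have zS: "z \<in> S" using r by (simp add: S_def)
  have "\<exists>G. \<forall>x\<in>S. (\<lambda>n. f n x) \<longlonglongrightarrow> G x \<and> (G has_derivative D x) (at x within S)"
    by (rule has_derivative_sequence[of S f "\<lambda>n x. frechet_derivative (f n) (at x)" D z "g z"])
       (use der Cauchy zS lim[OF z] in \<open>auto simp: S_def\<close>)
  then obtain G where G: "\<And>x. x \<in> S \<Longrightarrow> (\<lambda>n. f n x) \<longlonglongrightarrow> G x"
    "\<And>x. x \<in> S \<Longrightarrow> (G has_derivative D x) (at x within S)" by blast
  have Gg: "G x = g x" if "x \<in> S" for x
    using G(1)[OF that] lim[OF inS(1)[OF that]] LIMSEQ_unique by blast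
  have "(G has_derivative D z) (at z)"
    using G(2)[OF zS] zS at_within_open[of z S] by (simp add: S_def)
  then have "(g has_derivative D z) (at z)"
    by (rule has_derivative_transform_within_open[of _ _ _ _ S]) (use zS Gg in \<open>auto simp: S_def\<close>)
  moreover have "D z (c *s v) = c * D z v" for c v
  proof -
    have "(\<lambda>n. frechet_derivative (f n) (at z) (c *s v)) \<longlonglongrightarrow> c * D z v"
      using holomorphic_sev_has_derivative(2)[OF hol z] tendsto_mult_left[OF D[OF zS]] by simp
    then show ?thesis using D[OF zS] LIMSEQ_unique by blast
  qed
  ultimately show "\<exists>f'. (g has_derivative f') (at z) \<and> (\<forall>c v. f' (c *s v) = c * f' v)" by blast
qed

section \<open>Integrals over discs in the plane\<close>

lemma continuous_on_compact_bound:
  assumes "continuous_on S f" "compact S"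
  obtains B where "B \<ge> 0" "\<And>x. x \<in> S \<Longrightarrow> norm (f x) \<le> B"
proof -
  have "bounded (f ` S)" using assms by (intro compact_imp_bounded compact_continuous_image)
  then obtain B where "\<forall>x\<in>S. norm (f x) \<le> B" unfolding bounded_iff by blast
  then show ?thesis using that[of "\<bar>B\<bar>"] by force
qed

lemma lborel_complex_eq_distr: "(lborel :: complex measure) = distr lborel borel (\<lambda>x :: real ^ 2. Complex (x $ 1) (x $ 2))"
proof (rule lborel_eqI)
  let ?V = "\<lambda>x :: real ^ 2. Complex (x $ 1) (x $ 2)"
  have [measurable]: "?V \<in> borel_measurable borel"
    by (intro borel_measurable_continuous_onI) (auto simp: Complex_eq intro!: continuous_intros)
  fix l u :: complex assume *: "\<And>b. b \<in> Basis \<Longrightarrow> l \<bullet> b \<le> u \<bullet> b"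
  have le: "Re l \<le> Re u" "Im l \<le> Im u" using *[of 1] *[of \<i>] by (auto simp: Basis_complex_def)
  let ?l = "vector [Re l, Im l] :: real ^ 2" and ?u = "vector [Re u, Im u] :: real ^ 2"
  have vim: "?V -` box l u = box ?l ?u"
    by (auto simp: box_def Basis_complex_def Basis_vec_def forall_2 inner_axis)
  have "emeasure (distr lborel borel ?V) (box l u) = emeasure lborel (box ?l ?u)"
    by (subst emeasure_distr) (auto simp: vim)
  also have "\<dots> = ennreal (\<Prod>b\<in>Basis. (?u - ?l) \<bullet> b)"
    using le by (intro emeasure_lborel_box) (auto simp: Basis_vec_def UNIV_2 inner_axis)
  also have "(\<Prod>b\<in>Basis. (?u - ?l) \<bullet> b) = (\<Prod>b\<in>Basis. (u - l) \<bullet> b)"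
  proof -
    have B: "(Basis :: (real ^ 2) set) = {axis 1 1, axis 2 1}"
      by (auto simp: Basis_vec_def UNIV_2)
    moreover have "axis 1 1 \<noteq> (axis 2 1 :: real ^ 2)" by (simp add: axis_eq_axis)
    ultimately show ?thesis by (simp add: B Basis_complex_def inner_axis inner_diff_left)
  qed
  finally show "emeasure (distr lborel borel ?V) (box l u) = ennreal (\<Prod>b\<in>Basis. (u - l) \<bullet> b)" .
qed simp

text \<open>
  In real coordinates a rotation is an orthogonal transformation, which preserves the measure of
  boxes, and boxes determine Lebesgue measure.
\<close>

lemma lborel_complex_rotate:
  assumes c: "cmod c = 1"
  shows "distr lborel borel (\<lambda>w. c * w) = (lborel :: complex measure)"
proof (rule lborel_eqI[symmetric])
  let ?V = "\<lambda>x :: real ^ 2. Complex (x $ 1) (x $ 2)"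
  let ?W = "\<lambda>w :: complex. vector [Re w, Im w] :: real ^ 2"
  let ?R = "\<lambda>x. ?W (cnj c * ?V x)"
  have VW: "?V (?W w) = w" and WV: "?W (?V x) = x" for w x by (auto simp: vec_eq_iff forall_2)
  have norm: "norm (?W w) = cmod w" for w
    by (simp add: norm_vec_def L2_set_def sum_2 cmod_def)
  have [measurable]: "?V \<in> borel_measurable borel"
    by (intro borel_measurable_continuous_onI) (auto simp: Complex_eq intro!: continuous_intros)
  have ci: "cnj c * (c * w) = w" "c * (cnj c * w) = w" for w
  proof -
    have "c * cnj c = 1" "cnj c * c = 1"
      using complex_norm_square[of c] c by (simp_all add: mult.commute)
    then show "cnj c * (c * w) = w" "c * (cnj c * w) = w"
      by (simp_all add: mult.assoc[symmetric])
  qed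
  have R: "orthogonal_transformation ?R"
    unfolding orthogonal_transformation
  proof
    show "linear ?R"
      by (intro linearI) (auto simp: vec_eq_iff forall_2 algebra_simps)
    show "\<forall>v. norm (?R v) = norm v"
    proof
      fix v
      have "norm (?R v) = cmod (?V v)" by (simp only: norm norm_mult complex_mod_cnj c mult_1)
      also have "\<dots> = norm v" using norm[of "?V v"] WV[of v] by simp
      finally show "norm (?R v) = norm v" .
    qed
  qed
  have em: "emeasure lborel A = emeasure lborel (?V -` A)" if "A \<in> sets borel" for A :: "complex set"
    using that by (subst lborel_complex_eq_distr) (simp add: emeasure_distr)
  fix l u :: complex assume *: "\<And>b. b \<in> Basis \<Longrightarrow> l \<bullet> b \<le> u \<bullet> b"
  let ?A = "?V -` box l u"
  have Ab: "?A \<in> sets borel" using measurable_sets_borel[of ?V borel "box l u"] by simp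
  have fin: "emeasure lborel ?A < \<infinity>"
    using em[of "box l u"] emeasure_bounded_finite[of "box l u"] by simp
  have Alm: "?A \<in> lmeasurable"
    using Ab fin by (simp add: fmeasurable_def)
  have pre: "?V -` ((\<lambda>w. c * w) -` box l u) = ?R ` ?A"
  proof
    show "?R ` ?A \<subseteq> ?V -` ((\<lambda>w. c * w) -` box l u)"
      by (intro subsetI) (elim imageE, simp only: VW ci vimage_eq)
    show "?V -` ((\<lambda>w. c * w) -` box l u) \<subseteq> ?R ` ?A"
    proof
      fix x assume x: "x \<in> ?V -` ((\<lambda>w. c * w) -` box l u)"
      have "x = ?R (?W (c * ?V x))" by (simp only: VW ci WV)
      moreover have "?W (c * ?V x) \<in> ?A" using x by (simp only: VW vimage_eq)
      ultimately show "x \<in> ?R ` ?A" by blast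
    qed
  qed
  have Bb: "(\<lambda>w. c * w) -` box l u \<in> sets borel"
    using measurable_sets_borel[of "\<lambda>w. c * w" borel "box l u"] by simp
  have RAb: "?R ` ?A \<in> sets borel"
    unfolding pre[symmetric] using measurable_sets_borel[of ?V borel, OF _ Bb] by simp
  have "emeasure (distr lborel borel (\<lambda>w. c * w)) (box l u) = emeasure lborel ((\<lambda>w. c * w) -` box l u)"
    by (subst emeasure_distr) auto
  also have "\<dots> = emeasure lborel (?R ` ?A)"
    using em[OF Bb] pre by simp
  also have "\<dots> = emeasure lebesgue (?R ` ?A)"
    using RAb by simp
  also have "\<dots> = ennreal (measure lebesgue (?R ` ?A))"
    by (rule emeasure_eq_measure2) (rule measurable_orthogonal_image[OF R Alm])
  also have "\<dots> = ennreal (measure lebesgue ?A)"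
    by (simp only: measure_orthogonal_image[OF R Alm])
  also have "\<dots> = emeasure lebesgue ?A"
    by (rule emeasure_eq_measure2[symmetric]) (rule Alm)
  also have "\<dots> = emeasure lborel (box l u)"
    using Ab em[of "box l u"] by simp
  also have "\<dots> = ennreal (\<Prod>b\<in>Basis. (u - l) \<bullet> b)"
    by (rule emeasure_lborel_box[OF *])
  finally show "emeasure (distr lborel borel (\<lambda>w. c * w)) (box l u) = ennreal (\<Prod>b\<in>Basis. (u - l) \<bullet> b)" .
qed simp

abbreviation disc_measure :: "real \<Rightarrow> complex measure" where
  "disc_measure r \<equiv> restrict_space lborel (ball 0 r)"

lemma finite_disc_measure: "finite_measure (disc_measure r)"
  using emeasure_bounded_finite[of "ball (0::complex) r"]
  by (intro finite_measureI) (auto simp: emeasure_restrict_space space_restrict_space)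

lemma integrable_disc_measure:
  fixes f :: "complex \<Rightarrow> 'b :: {banach, second_countable_topology}"
  assumes "f \<in> borel_measurable (disc_measure r)" "\<And>w. w \<in> ball 0 r \<Longrightarrow> norm (f w) \<le> B"
  shows "integrable (disc_measure r) f"
  by (rule finite_measure.integrable_const_bound[OF finite_disc_measure, where B = B])
     (use assms in \<open>auto simp: space_restrict_space AE_restrict_space_iff\<close>)

lemma measurable_disc_measureI: "continuous_on (ball 0 r) f \<Longrightarrow> f \<in> borel_measurable (disc_measure r)"
  for f :: "complex \<Rightarrow> 'b :: topological_space"
  using borel_measurable_continuous_on_restrict[of "ball 0 r" f]
  by (simp cong: measurable_cong_sets sets_restrict_space_cong)

lemma integral_disc_rotate:
  fixes f :: "complex \<Rightarrow> complex"
  assumes c: "cmod c = 1" and f: "f \<in> borel_measurable borel"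
  shows "(\<integral>w. f (c * w) \<partial>disc_measure r) = (\<integral>w. f w \<partial>disc_measure r)"
proof -
  have "(\<integral>w. f w \<partial>disc_measure r) = (\<integral>w. indicator (ball 0 r) w *\<^sub>R f w \<partial>distr lborel borel (\<lambda>w. c * w))"
    unfolding lborel_complex_rotate[OF c] by (subst integral_restrict_space) auto
  also have "\<dots> = (\<integral>w. indicator (ball 0 r) (c * w) *\<^sub>R f (c * w) \<partial>lborel)"
    using f by (subst integral_distr) (auto intro!: borel_measurable_scaleR borel_measurable_indicator)
  also have "\<dots> = (\<integral>w. indicator (ball 0 r) w *\<^sub>R f (c * w) \<partial>lborel)"
    using c by (intro Bochner_Integration.integral_cong) (auto simp: indicator_def norm_mult)
  also have "\<dots> = (\<integral>w. f (c * w) \<partial>disc_measure r)"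
    by (subst integral_restrict_space) auto
  finally show ?thesis by simp
qed

lemma integral_disc_monomial_orthogonal:
  assumes "j \<noteq> k"
  shows "(\<integral>w. w ^ j * cnj w ^ k \<partial>disc_measure r) = 0"
proof -
  \<comment> \<open>The rotation for which the monomial changes its sign.\<close>
  define c where "c = cis (pi / (real j - real k))"
  have c: "cmod c = 1" by (simp add: c_def)
  let ?I = "\<integral>w. w ^ j * cnj w ^ k \<partial>disc_measure r"
  have "?I = (\<integral>w. (c * w) ^ j * cnj (c * w) ^ k \<partial>disc_measure r)"
    by (rule integral_disc_rotate[OF c, symmetric])
       (intro borel_measurable_continuous_onI continuous_intros)
  also have "\<dots> = (\<integral>w. (c ^ j * cnj c ^ k) * (w ^ j * cnj w ^ k) \<partial>disc_measure r)"
    by (simp add: power_mult_distrib mult_ac)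
  also have "\<dots> = c ^ j * cnj c ^ k * ?I" by (rule integral_mult_right_zero)
  also have "c ^ j * cnj c ^ k = cis (real j * (pi / (real j - real k)) - real k * (pi / (real j - real k)))"
    by (simp add: c_def Complex.DeMoivre cis_mult cis_cnj)
  also have "real j * (pi / (real j - real k)) - real k * (pi / (real j - real k)) = pi"
    using assms by (simp add: diff_divide_distrib[symmetric] left_diff_distrib[symmetric])
  finally show ?thesis by simp
qed

text \<open>
  The integrand is the integral of \<open>j * x ^ (j - 1)\<close> over \<open>0 \<le> x \<le> \<bar>w\<bar>\<^sup>2\<close>. Exchanging the integrals
  leaves the areas of annuli.
\<close>

lemma nn_integral_disc_power:
  assumes r: "r > 0"
  shows "(\<integral>\<^sup>+w. ennreal ((cmod w) ^ (2 * j)) * indicator (ball 0 r) w \<partial>lborel) = ennreal (pi * r ^ (2 * j + 2) / (j + 1))"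
proof (cases "j = 0")
  case True
  then show ?thesis
    using r by (simp add: emeasure_ball unit_ball_vol_2 power2_eq_square ennreal_mult'')
next
  case False
  have ball: "emeasure lborel (ball (0::complex) s) = ennreal (pi * s\<^sup>2)" if "s \<ge> 0" for s
    using that by (simp add: emeasure_ball unit_ball_vol_2)
  define F :: "real \<Rightarrow> real" where
    "F x = pi * r\<^sup>2 * x ^ j - pi * real j / real (j + 1) * x ^ (j + 1)" for x
  let ?d = "\<lambda>x::real. real j * x ^ (j - 1)"
  have pw: "ennreal ((cmod w) ^ (2 * j)) = (\<integral>\<^sup>+x. ennreal (?d x) * indicator {0..(cmod w)\<^sup>2} x \<partial>lborel)" for w
  proof -
    have "(\<integral>\<^sup>+x. ennreal (?d x) * indicator {0..(cmod w)\<^sup>2} x \<partial>lborel) = ennreal (((cmod w)\<^sup>2) ^ j - 0 ^ j)"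
      by (rule nn_integral_FTC_Icc[where F="\<lambda>x. x ^ j"]) (auto intro!: derivative_eq_intros)
    then show ?thesis using False by (simp add: power_mult zero_power)
  qed
  let ?A = "\<lambda>x. {w \<in> ball 0 r. 0 \<le> x \<and> x \<le> (cmod w)\<^sup>2}"
  have "(\<integral>\<^sup>+w. ennreal ((cmod w) ^ (2 * j)) * indicator (ball 0 r) w \<partial>lborel) =
      (\<integral>\<^sup>+w. \<integral>\<^sup>+x. ennreal (?d x) * indicator (?A x) w \<partial>lborel \<partial>lborel)"
    unfolding pw
    by (intro nn_integral_cong, subst nn_integral_multc[symmetric])
       (auto intro!: nn_integral_cong simp: indicator_def)
  also have "\<dots> = (\<integral>\<^sup>+x. \<integral>\<^sup>+w. ennreal (?d x) * indicator (?A x) w \<partial>lborel \<partial>lborel)"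
    by (rule lborel_pair.Fubini') (simp add: split_beta indicator_def)
  also have "\<dots> = (\<integral>\<^sup>+x. ennreal (?d x * (pi * (r\<^sup>2 - x))) * indicator {0..r\<^sup>2} x \<partial>lborel)"
  proof (rule nn_integral_cong)
    fix x :: real
    show "(\<integral>\<^sup>+w. ennreal (?d x) * indicator (?A x) w \<partial>lborel) = ennreal (?d x * (pi * (r\<^sup>2 - x))) * indicator {0..r\<^sup>2} x"
    proof (cases "0 \<le> x \<and> x \<le> r\<^sup>2")
      case True
      have le: "sqrt x \<le> r" using True r by (intro real_le_lsqrt) auto
      have iff: "x \<le> (cmod w)\<^sup>2 \<longleftrightarrow> sqrt x \<le> cmod w" for w
      proof
        assume "x \<le> (cmod w)\<^sup>2" then show "sqrt x \<le> cmod w" by (intro real_le_lsqrt) auto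
      next
        assume "sqrt x \<le> cmod w"
        then have "(sqrt x)\<^sup>2 \<le> (cmod w)\<^sup>2" by (rule power_mono) (use True in auto)
        then show "x \<le> (cmod w)\<^sup>2" using True by simp
      qed
      have A: "?A x = ball 0 r - ball 0 (sqrt x)"
      proof (rule set_eqI)
        fix w show "w \<in> ?A x \<longleftrightarrow> w \<in> ball 0 r - ball 0 (sqrt x)"
          using iff[of w] True by (simp only: mem_Collect_eq Diff_iff mem_ball dist_0_norm not_less simp_thms)
      qed
      have "emeasure lborel (?A x) = emeasure lborel (ball (0::complex) r) - emeasure lborel (ball (0::complex) (sqrt x))"
        unfolding A using True le by (intro emeasure_Diff) (auto simp: ball ball_subset_ball_iff)
      also have "\<dots> = ennreal (pi * (r\<^sup>2 - x))"
        using True r by (simp add: ball ennreal_minus algebra_simps)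
      finally have "emeasure lborel (?A x) = ennreal (pi * (r\<^sup>2 - x))" .
      moreover have "?A x \<in> sets lborel" unfolding A by simp
      ultimately show ?thesis using True by (simp add: nn_integral_cmult ennreal_mult')
    next
      case False
      have "(cmod w)\<^sup>2 \<le> r\<^sup>2" if "w \<in> ball 0 r" for w using that r by (intro power_mono) auto
      then have Ae: "?A x = {}" using False by fastforce
      then have "(\<integral>\<^sup>+w. ennreal (?d x) * indicator (?A x) w \<partial>lborel) = 0" by (simp only: Ae) simp
      then show ?thesis using False by (simp add: indicator_def)
    qed
  qed
  also have "\<dots> = ennreal (F (r\<^sup>2) - F 0)"
  proof (rule nn_integral_FTC_Icc)
    fix x :: real assume x: "x \<in> {0..r\<^sup>2}"
    show "0 \<le> ?d x * (pi * (r\<^sup>2 - x))" using x by simp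
    have "(F has_real_derivative pi * r\<^sup>2 * (real j * x ^ (j - Suc 0)) -
        pi * real j / real (j + 1) * (real (j + 1) * x ^ (j + 1 - Suc 0))) (at x)"
      unfolding F_def by (intro DERIV_diff DERIV_cmult DERIV_pow)
    moreover have "x ^ j = x * x ^ (j - 1)" using False by (simp add: power_eq_if)
    moreover have "pi * real j / real (j + 1) * (real (j + 1) * x ^ (j + 1 - Suc 0)) = pi * real j * x ^ j" by simp
    ultimately show "(F has_real_derivative ?d x * (pi * (r\<^sup>2 - x))) (at x)"
      by (simp only: One_nat_def) (simp add: algebra_simps)
  qed auto
  also have "F (r\<^sup>2) - F 0 = pi * r ^ (2 * j + 2) / (j + 1)"
  proof -
    have "(r\<^sup>2) ^ (j + 1) = r ^ (2 * j + 2)"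
      unfolding power_mult[symmetric] by simp
    moreover have "r\<^sup>2 * (r\<^sup>2) ^ j = (r\<^sup>2) ^ (j + 1)" by simp
    ultimately have "F (r\<^sup>2) = pi * r ^ (2 * j + 2) - pi * real j / real (j + 1) * r ^ (2 * j + 2)"
      by (simp only: F_def mult.assoc)
    also have "\<dots> = pi * r ^ (2 * j + 2) / (j + 1)" by (simp add: field_simps)
    finally show ?thesis using False by (simp add: F_def)
  qed
  finally show ?thesis .
qed

lemma integral_disc_monomial:
  assumes r: "r > 0"
  shows "(\<integral>w. w ^ j * cnj w ^ j \<partial>disc_measure r) = of_real (pi * r ^ (2 * j + 2) / (j + 1))"
proof -
  have "w ^ j * cnj w ^ j = of_real ((cmod w) ^ (2 * j))" for w
    by (simp add: power_mult_distrib[symmetric] power_mult complex_norm_square[symmetric])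
  then have "(\<integral>w. w ^ j * cnj w ^ j \<partial>disc_measure r) = of_real (\<integral>w. (cmod w) ^ (2 * j) \<partial>disc_measure r)"
    by (simp only: integral_complex_of_real)
  also have "(\<integral>w. (cmod w) ^ (2 * j) \<partial>disc_measure r) = enn2real (\<integral>\<^sup>+w. ennreal ((cmod w) ^ (2 * j)) \<partial>disc_measure r)"
    by (rule integral_eq_nn_integral) (auto intro!: measurable_disc_measureI continuous_intros)
  also have "\<dots> = pi * r ^ (2 * j + 2) / (j + 1)"
    using r by (subst nn_integral_restrict_space) (auto simp only: nn_integral_disc_power intro!: enn2real_ennreal, auto)
  finally show ?thesis .
qed

text \<open>
  The Bergman kernel of the disc of radius \<open>r\<close> about 0, in closed form.
\<close>

definition disc_kernel :: "real \<Rightarrow> complex \<Rightarrow> complex \<Rightarrow> complex" where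
  "disc_kernel r w z = of_real (r\<^sup>2) / (of_real pi * (of_real (r\<^sup>2) - w * cnj z)\<^sup>2)"

definition disc_kernel_diag :: "real \<Rightarrow> complex \<Rightarrow> real" where
  "disc_kernel_diag r z = r\<^sup>2 / (pi * (r\<^sup>2 - (cmod z)\<^sup>2)\<^sup>2)"

lemma disc_kernel_self: "disc_kernel r z z = of_real (disc_kernel_diag r z)"
  by (simp add: disc_kernel_def disc_kernel_diag_def complex_norm_square[symmetric] mult.commute[of z]
      flip: of_real_power of_real_diff of_real_mult)

lemma disc_kernel_diag_pos:
  assumes "cmod z < r"
  shows "disc_kernel_diag r z > 0"
proof -
  have "(cmod z)\<^sup>2 < r\<^sup>2" using assms by (intro power_strict_mono) auto
  moreover have "r > 0" using assms le_less_trans norm_ge_zero by blast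
  ultimately show ?thesis
    by (auto simp: disc_kernel_diag_def intro!: divide_pos_pos mult_pos_pos)
qed

lemma disc_kernel_denominator_nonzero:
  assumes "cmod w * cmod z < r\<^sup>2"
  shows "of_real (r\<^sup>2) - w * cnj z \<noteq> 0"
proof
  assume "of_real (r\<^sup>2) - w * cnj z = 0"
  then have "cmod (of_real (r\<^sup>2)) = cmod (w * cnj z)" by simp
  then show False using assms by (simp add: norm_mult norm_power)
qed

lemma integral_disc_poly:
  assumes r: "r > 0"
  shows "(\<integral>w. (cmod (\<Sum>j<n. b j * w ^ j))\<^sup>2 \<partial>disc_measure r) = (\<Sum>j<n. (cmod (b j))\<^sup>2 * (pi * r ^ (2 * j + 2) / (j + 1)))"
proof -
  have int: "integrable (disc_measure r) (\<lambda>w. b j * cnj (b k) * (w ^ j * cnj w ^ k))" for j k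
  proof (rule integrable_disc_measure)
    show "(\<lambda>w. b j * cnj (b k) * (w ^ j * cnj w ^ k)) \<in> borel_measurable (disc_measure r)"
      by (intro measurable_disc_measureI continuous_intros)
    show "norm (b j * cnj (b k) * (w ^ j * cnj w ^ k)) \<le> cmod (b j) * cmod (b k) * (r ^ j * r ^ k)"
      if "w \<in> ball 0 r" for w
      using that r by (auto simp: norm_mult norm_power intro!: mult_mono power_mono)
  qed
  have "complex_of_real (\<integral>w. (cmod (\<Sum>j<n. b j * w ^ j))\<^sup>2 \<partial>disc_measure r)
      = (\<integral>w. of_real ((cmod (\<Sum>j<n. b j * w ^ j))\<^sup>2) \<partial>disc_measure r)"
    by (rule integral_complex_of_real[symmetric])
  also have "\<dots> = (\<integral>w. (\<Sum>j<n. \<Sum>k<n. b j * cnj (b k) * (w ^ j * cnj w ^ k)) \<partial>disc_measure r)"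
    by (intro Bochner_Integration.integral_cong refl, subst complex_norm_square)
       (simp add: sum_product mult_ac)
  also have "\<dots> = (\<Sum>j<n. \<Sum>k<n. b j * cnj (b k) * (\<integral>w. w ^ j * cnj w ^ k \<partial>disc_measure r))"
    using int by (simp add: Bochner_Integration.integral_sum)
  also have "\<dots> = (\<Sum>j<n. \<Sum>k<n. if k = j then b j * cnj (b j) * of_real (pi * r ^ (2 * j + 2) / (j + 1)) else 0)"
    by (intro sum.cong refl) (simp add: integral_disc_monomial_orthogonal integral_disc_monomial[OF r])
  also have "\<dots> = (\<Sum>j<n. b j * cnj (b j) * of_real (pi * r ^ (2 * j + 2) / (j + 1)))"
    by (simp add: sum.delta)
  also have "\<dots> = of_real (\<Sum>j<n. (cmod (b j))\<^sup>2 * (pi * r ^ (2 * j + 2) / (j + 1)))"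
    unfolding of_real_sum of_real_mult complex_norm_square ..
  finally show ?thesis by (simp only: of_real_eq_iff)
qed

text \<open>
  The norms of the monomials on the disc appear as denominators, as in the expansion of a
  reproducing kernel by an orthonormal basis.
\<close>

lemma disc_kernel_diag_sums:
  assumes "cmod z < r"
  shows "(\<lambda>j. (cmod z) ^ (2 * j) / (pi * r ^ (2 * j + 2) / (j + 1))) sums disc_kernel_diag r z"
proof -
  have r: "r > 0" using assms le_less_trans norm_ge_zero by blast
  define x where "x = (cmod z)\<^sup>2 / r\<^sup>2"
  have x: "norm x < 1" using assms r by (simp add: x_def power_strict_mono)
  have "(\<lambda>j. 1 / (pi * r\<^sup>2) * (of_nat (Suc j) * x ^ j)) sums (1 / (pi * r\<^sup>2) * (1 / (1 - x)\<^sup>2))"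
    by (intro sums_mult geometric_deriv_sums x)
  moreover have "1 / (pi * r\<^sup>2) * (of_nat (Suc j) * x ^ j) = (cmod z) ^ (2 * j) / (pi * r ^ (2 * j + 2) / (j + 1))" for j
  proof -
    have "x ^ j = (cmod z) ^ (2 * j) / r ^ (2 * j)" by (simp add: x_def power_divide flip: power_mult)
    moreover have "r ^ (2 * j + 2) = r ^ (2 * j) * r\<^sup>2" by (rule power_add)
    ultimately show ?thesis by (simp only: of_nat_Suc) (simp add: mult_ac)
  qed
  moreover have "1 / (pi * r\<^sup>2) * (1 / (1 - x)\<^sup>2) = disc_kernel_diag r z"
  proof -
    have "1 - x = (r\<^sup>2 - (cmod z)\<^sup>2) / r\<^sup>2" using r by (simp add: x_def diff_divide_distrib)
    then have "1 / (1 - x)\<^sup>2 = r\<^sup>2 * r\<^sup>2 / (r\<^sup>2 - (cmod z)\<^sup>2)\<^sup>2"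
      by (simp add: power_divide power2_eq_square[of "r\<^sup>2"])
    then show ?thesis
      using r by (simp add: disc_kernel_diag_def power4_eq_xxxx power2_eq_square[of r])
  qed
  ultimately show ?thesis by simp
qed

text \<open>
  The monomials are orthogonal on the disc, so this is the Cauchy-Schwarz inequality for the
  coefficients, weighted by the norms of the monomials.
\<close>

lemma Bergman_inequality_poly:
  assumes a: "cmod a < r"
  shows "(cmod (\<Sum>j<n. b j * a ^ j))\<^sup>2 \<le> disc_kernel_diag r a * (\<integral>w. (cmod (\<Sum>j<n. b j * w ^ j))\<^sup>2 \<partial>disc_measure r)"
proof -
  have r: "r > 0" using a le_less_trans norm_ge_zero by blast
  define c where "c j = pi * r ^ (2 * j + 2) / real (j + 1)" for j
  have c: "c j > 0" for j using r by (simp add: c_def)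
  have "(cmod (\<Sum>j<n. b j * a ^ j))\<^sup>2 \<le> (\<Sum>j<n. cmod (b j) * sqrt (c j) * ((cmod a) ^ j / sqrt (c j)))\<^sup>2"
  proof (rule power_mono)
    have "cmod (\<Sum>j<n. b j * a ^ j) \<le> (\<Sum>j<n. cmod (b j * a ^ j))" by (rule norm_sum)
    also have "\<dots> = (\<Sum>j<n. cmod (b j) * sqrt (c j) * ((cmod a) ^ j / sqrt (c j)))"
      using c less_imp_neq[OF c] by (intro sum.cong refl) (simp add: norm_mult norm_power)
    finally show "cmod (\<Sum>j<n. b j * a ^ j) \<le> \<dots>" .
  qed simp
  also have "\<dots> \<le> (\<Sum>j<n. (cmod (b j) * sqrt (c j))\<^sup>2) * (\<Sum>j<n. ((cmod a) ^ j / sqrt (c j))\<^sup>2)"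
    by (rule Cauchy_Schwarz_ineq_sum)
  also have "(\<Sum>j<n. (cmod (b j) * sqrt (c j))\<^sup>2) = (\<integral>w. (cmod (\<Sum>j<n. b j * w ^ j))\<^sup>2 \<partial>disc_measure r)"
    unfolding integral_disc_poly[OF r] using c by (simp add: power_mult_distrib c_def less_imp_le)
  also have "(\<Sum>j<n. ((cmod a) ^ j / sqrt (c j))\<^sup>2) = (\<Sum>j<n. (cmod a) ^ (2 * j) / c j)"
    using c by (simp add: power_divide less_imp_le power_mult[symmetric] mult.commute)
  also have "(\<integral>w. (cmod (\<Sum>j<n. b j * w ^ j))\<^sup>2 \<partial>disc_measure r) * (\<Sum>j<n. (cmod a) ^ (2 * j) / c j) \<le>
      (\<integral>w. (cmod (\<Sum>j<n. b j * w ^ j))\<^sup>2 \<partial>disc_measure r) * disc_kernel_diag r a"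
    using disc_kernel_diag_sums[OF a] r unfolding c_def
    by (intro mult_left_mono sum_le_suminf[THEN order_trans]) (auto simp: sums_iff)
  finally show ?thesis by (simp only: mult.commute)
qed

lemma integral_disc_power_series:
  assumes sm: "summable (\<lambda>j. cmod (b j) * r ^ j)" and r: "r > 0"
    and g: "\<And>w. w \<in> ball 0 r \<Longrightarrow> (\<lambda>j. b j * w ^ j) sums g w"
    and cont: "continuous_on (ball 0 r) g"
  shows "(\<lambda>n. \<integral>w. (cmod (\<Sum>j<n. b j * w ^ j))\<^sup>2 \<partial>disc_measure r) \<longlonglongrightarrow> (\<integral>w. (cmod (g w))\<^sup>2 \<partial>disc_measure r)"
proof (rule integral_dominated_convergence)
  let ?S = "\<Sum>j. cmod (b j) * r ^ j"
  show "integrable (disc_measure r) (\<lambda>w. ?S\<^sup>2)"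
    by (rule integrable_disc_measure[where B="?S\<^sup>2"]) auto
  show "(\<lambda>w. (cmod (g w))\<^sup>2) \<in> borel_measurable (disc_measure r)"
    by (intro measurable_disc_measureI continuous_intros cont)
  show "(\<lambda>w. (cmod (\<Sum>j<n. b j * w ^ j))\<^sup>2) \<in> borel_measurable (disc_measure r)" for n
    by (intro measurable_disc_measureI continuous_intros)
  show "AE w in disc_measure r. (\<lambda>n. (cmod (\<Sum>j<n. b j * w ^ j))\<^sup>2) \<longlonglongrightarrow> (cmod (g w))\<^sup>2"
    using g by (intro AE_I2 tendsto_intros) (auto simp: space_restrict_space sums_def)
  show "AE w in disc_measure r. norm ((cmod (\<Sum>j<n. b j * w ^ j))\<^sup>2) \<le> ?S\<^sup>2" for n
  proof (rule AE_I2)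
    fix w assume "w \<in> space (disc_measure r)"
    then have w: "cmod w \<le> r" by (simp add: space_restrict_space)
    have "cmod (\<Sum>j<n. b j * w ^ j) \<le> (\<Sum>j<n. cmod (b j) * r ^ j)"
      using w by (intro order_trans[OF norm_sum] sum_mono) (auto simp: norm_mult norm_power intro!: mult_left_mono power_mono)
    also have "\<dots> \<le> ?S" using r by (intro sum_le_suminf sm) auto
    finally show "norm ((cmod (\<Sum>j<n. b j * w ^ j))\<^sup>2) \<le> ?S\<^sup>2" by (simp add: power_mono)
  qed
qed

lemma continuous_on_disc_kernel:
  assumes "\<And>w. w \<in> S \<Longrightarrow> cmod w * cmod z < r\<^sup>2"
  shows "continuous_on S (\<lambda>w. disc_kernel r w z)"
proof (cases "r = 0")
  case True then show ?thesis by (simp add: disc_kernel_def)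
next
  case False then show ?thesis
  unfolding disc_kernel_def using disc_kernel_denominator_nonzero[OF assms]
  by (intro continuous_intros) (auto simp: )
qed

text \<open>
  The partial sums of the expansion of the kernel are polynomials, whose norms are sums of
  squares of coefficients.
\<close>

lemma integral_disc_kernel:
  assumes z: "cmod z < r"
  shows "(\<integral>w. (cmod (disc_kernel r w z))\<^sup>2 \<partial>disc_measure r) = disc_kernel_diag r z"
proof -
  have r: "r > 0" using z le_less_trans norm_ge_zero by blast
  define b where "b j = of_real (1 / (pi * r\<^sup>2)) * (of_nat (Suc j) * (cnj z / of_real (r\<^sup>2)) ^ j)" for j
  have cb: "cmod (b j) = 1 / (pi * r\<^sup>2) * (of_nat (Suc j) * (cmod z / r\<^sup>2) ^ j)" for j
    unfolding b_def norm_mult norm_of_nat norm_power norm_divide norm_of_real by (simp add: norm_power)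
  have small: "cmod w * cmod z < r\<^sup>2" if "cmod w < r" for w
    using mult_strict_mono[OF that z r] by (simp add: power2_eq_square)
  have series: "(\<lambda>j. b j * w ^ j) sums disc_kernel r w z" if "cmod w < r" for w
  proof -
    have "norm (w * cnj z / of_real (r\<^sup>2)) < 1"
      using small[OF that] r by (simp add: norm_divide norm_mult norm_power)
    then have "(\<lambda>j. of_real (1 / (pi * r\<^sup>2)) * (of_nat (Suc j) * (w * cnj z / of_real (r\<^sup>2)) ^ j)) sums
        (of_real (1 / (pi * r\<^sup>2)) * (1 / (1 - w * cnj z / of_real (r\<^sup>2))\<^sup>2))"
      by (intro sums_mult geometric_deriv_sums)
    moreover have "of_real (1 / (pi * r\<^sup>2)) * (of_nat (Suc j) * (w * cnj z / of_real (r\<^sup>2)) ^ j) = b j * w ^ j" for j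
      by (simp add: b_def power_mult_distrib power_divide mult_ac)
    moreover have "of_real (1 / (pi * r\<^sup>2)) * (1 / (1 - w * cnj z / of_real (r\<^sup>2))\<^sup>2) = disc_kernel r w z"
    proof -
      have "1 - w * cnj z / of_real (r\<^sup>2) = (of_real (r\<^sup>2) - w * cnj z) / of_real (r\<^sup>2)"
        using r by (simp add: diff_divide_distrib)
      then have "1 / (1 - w * cnj z / of_real (r\<^sup>2))\<^sup>2 = of_real (r\<^sup>2) * of_real (r\<^sup>2) / (of_real (r\<^sup>2) - w * cnj z)\<^sup>2"
        by (simp add: power_divide power2_eq_square[of "(of_real r :: complex)\<^sup>2"])
      then show ?thesis
        using r by (simp add: disc_kernel_def power4_eq_xxxx power2_eq_square[of "complex_of_real r"])
    qed
    ultimately show ?thesis by simp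
  qed
  have "(\<lambda>n. \<integral>w. (cmod (\<Sum>j<n. b j * w ^ j))\<^sup>2 \<partial>disc_measure r) \<longlonglongrightarrow> (\<integral>w. (cmod (disc_kernel r w z))\<^sup>2 \<partial>disc_measure r)"
  proof (rule integral_disc_power_series[OF _ r])
    have "norm (cmod z / r) < 1" using z r by simp
    then have "summable (\<lambda>j. 1 / (pi * r\<^sup>2) * (of_nat (Suc j) * (cmod z / r) ^ j))"
      by (intro summable_mult sums_summable[OF geometric_deriv_sums])
    moreover have "cmod (b j) * r ^ j = 1 / (pi * r\<^sup>2) * (of_nat (Suc j) * (cmod z / r) ^ j)" for j
      unfolding cb using r by (simp add: power_divide power2_eq_square power_mult_distrib)
    ultimately show "summable (\<lambda>j. cmod (b j) * r ^ j)" by simp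
    show "continuous_on (ball 0 r) (\<lambda>w. disc_kernel r w z)"
      by (rule continuous_on_disc_kernel) (use small in auto)
  qed (use series in auto)
  moreover have "(\<lambda>n. \<integral>w. (cmod (\<Sum>j<n. b j * w ^ j))\<^sup>2 \<partial>disc_measure r) \<longlonglongrightarrow> disc_kernel_diag r z"
  proof -
    have "(cmod (b j))\<^sup>2 * (pi * r ^ (2 * j + 2) / (j + 1)) = (cmod z) ^ (2 * j) / (pi * r ^ (2 * j + 2) / (j + 1))" for j
    proof -
      let ?P = "pi * r ^ (2 * j + 2)" and ?N = "real (j + 1)"
      have P: "?P > 0" using r by simp
      have "r ^ (2 * j + 2) = r\<^sup>2 * (r\<^sup>2) ^ j" by (simp add: power_mult power2_eq_square)
      then have "cmod (b j) = (cmod z) ^ j * (?N / ?P)"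
        unfolding cb by (simp add: power_divide mult_ac)
      then have "(cmod (b j))\<^sup>2 * (?P / ?N) = (cmod z) ^ (2 * j) * ((?N / ?P) * ((?N / ?P) * (?P / ?N)))"
        by (simp only: power_mult_distrib power2_eq_square[of "?N / ?P"] power_mult[symmetric] mult.commute[of j 2] mult.assoc)
      also have "(?N / ?P) * (?P / ?N) = 1" using r by simp
      finally show ?thesis by (simp only: mult_1_right times_divide_eq_right divide_divide_eq_right)
    qed
    then show ?thesis
      unfolding integral_disc_poly[OF r] using disc_kernel_diag_sums[OF z] by (simp add: sums_def)
  qed
  ultimately show ?thesis by (rule LIMSEQ_unique)
qed

text \<open>
  On a smaller disc the Taylor polynomials converge boundedly.
\<close>

lemma Bergman_inequality_disc_aux:
  assumes hol: "g holomorphic_on ball 0 R" and a: "cmod a < s" and s: "s < R"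
  shows "(cmod (g a))\<^sup>2 \<le> disc_kernel_diag s a * (\<integral>w. (cmod (g w))\<^sup>2 \<partial>disc_measure s)"
proof (rule LIMSEQ_le)
  have s0: "s > 0" using a le_less_trans norm_ge_zero by blast
  define b where "b j = (deriv ^^ j) g 0 / fact j" for j
  have g: "(\<lambda>j. b j * w ^ j) sums g w" if "cmod w < R" for w
    using holomorphic_power_series[OF hol, of w] that by (simp add: b_def)
  have sm: "summable (\<lambda>j. cmod (b j) * s ^ j)"
  proof -
    obtain m where m: "s < m" "m < R" using dense[OF s] by blast
    have "summable (\<lambda>j. norm (b j * (of_real s) ^ j))"
      by (rule powser_insidea[of b "of_real m"]) (use g[of "of_real m"] m s0 in \<open>auto simp: sums_iff\<close>)
    then show ?thesis using s0 by (simp add: norm_mult norm_power)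
  qed
  show "(\<lambda>n. (cmod (\<Sum>j<n. b j * a ^ j))\<^sup>2) \<longlonglongrightarrow> (cmod (g a))\<^sup>2"
    using g[of a] a s by (intro tendsto_intros) (simp add: sums_def)
  show "(\<lambda>n. disc_kernel_diag s a * (\<integral>w. (cmod (\<Sum>j<n. b j * w ^ j))\<^sup>2 \<partial>disc_measure s)) \<longlonglongrightarrow>
      disc_kernel_diag s a * (\<integral>w. (cmod (g w))\<^sup>2 \<partial>disc_measure s)"
    using s by (intro tendsto_mult_left integral_disc_power_series sm s0 g)
      (auto intro!: holomorphic_on_imp_continuous_on holomorphic_on_subset[OF hol])
  show "\<exists>N. \<forall>n\<ge>N. (cmod (\<Sum>j<n. b j * a ^ j))\<^sup>2 \<le> disc_kernel_diag s a * (\<integral>w. (cmod (\<Sum>j<n. b j * w ^ j))\<^sup>2 \<partial>disc_measure s)"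
    using Bergman_inequality_poly[OF a] by blast
qed

text \<open>
  A nonnegative integral makes sense for every holomorphic function, so that Tonelli's theorem can
  turn this into an estimate on bidiscs, whose slices may fail to be square integrable.
\<close>

lemma Bergman_inequality_disc:
  assumes hol: "g holomorphic_on ball c R" and a: "a \<in> ball c R"
  shows "ennreal ((cmod (g a))\<^sup>2) \<le> ennreal (disc_kernel_diag R (a - c)) * (\<integral>\<^sup>+w. ennreal ((cmod (g w))\<^sup>2) * indicator (ball c R) w \<partial>lborel)"
proof -
  define h where "h w = g (c + w)" for w
  have holh: "h holomorphic_on ball 0 R"
    unfolding h_def by (rule holomorphic_on_compose_gen[OF _ hol, unfolded o_def])
      (auto intro!: holomorphic_intros simp: dist_norm)
  have conth: "continuous_on (ball 0 R) h" by (rule holomorphic_on_imp_continuous_on[OF holh])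
  have aR: "cmod (a - c) < R" using a by (simp add: dist_norm norm_minus_commute)
  define N where "N = (\<integral>\<^sup>+w. ennreal ((cmod (h w))\<^sup>2) \<partial>disc_measure R)"
  have N: "N = (\<integral>\<^sup>+w. ennreal ((cmod (g w))\<^sup>2) * indicator (ball c R) w \<partial>lborel)"
  proof -
    have m: "(\<lambda>w. ennreal ((cmod (g w))\<^sup>2) * indicator (ball c R) w) \<in> borel_measurable borel"
    proof -
      have "continuous_on (ball c R) (\<lambda>w. (cmod (g w))\<^sup>2)"
        by (intro continuous_intros holomorphic_on_imp_continuous_on[OF hol])
      then have "(\<lambda>w. ennreal (indicator (ball c R) w *\<^sub>R (cmod (g w))\<^sup>2)) \<in> borel_measurable borel"
        by (intro measurable_compose[OF _ measurable_ennreal] borel_measurable_continuous_on_indicator) auto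
      then show ?thesis by (rule measurable_cong[THEN iffD1, rotated]) (auto simp: indicator_def)
    qed
    have "(\<integral>\<^sup>+w. ennreal ((cmod (g w))\<^sup>2) * indicator (ball c R) w \<partial>lborel)
        = (\<integral>\<^sup>+w. ennreal ((cmod (g w))\<^sup>2) * indicator (ball c R) w \<partial>distr lborel borel ((+) c))"
      by (simp add: lborel_distr_plus)
    also have "\<dots> = (\<integral>\<^sup>+w. ennreal ((cmod (g (c + w)))\<^sup>2) * indicator (ball c R) (c + w) \<partial>lborel)"
      using m by (subst nn_integral_distr) auto
    also have "\<dots> = N"
      unfolding N_def h_def by (subst nn_integral_restrict_space) (auto intro!: nn_integral_cong simp: indicator_def dist_norm)
    finally show ?thesis ..
  qed
  have "ennreal ((cmod (h (a - c)))\<^sup>2) \<le> ennreal (disc_kernel_diag R (a - c)) * N"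
  proof (cases "N = \<infinity>")
    case True
    then show ?thesis using disc_kernel_diag_pos[OF aR] by (simp add: ennreal_mult_top)
  next
    case False
    have bound: "(cmod (h (a - c)))\<^sup>2 \<le> disc_kernel_diag s (a - c) * enn2real N" if s: "cmod (a - c) < s" "s < R" for s
    proof -
      have "(cmod (h (a - c)))\<^sup>2 \<le> disc_kernel_diag s (a - c) * (\<integral>w. (cmod (h w))\<^sup>2 \<partial>disc_measure s)"
        by (rule Bergman_inequality_disc_aux[OF holh s])
      also have "(\<integral>w. (cmod (h w))\<^sup>2 \<partial>disc_measure s) = enn2real (\<integral>\<^sup>+w. ennreal ((cmod (h w))\<^sup>2) \<partial>disc_measure s)"
        using s by (intro integral_eq_nn_integral measurable_disc_measureI)
          (auto intro!: continuous_intros continuous_on_subset[OF conth])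
      also have "\<dots> \<le> enn2real N"
        unfolding N_def
      proof (rule enn2real_mono)
        show "(\<integral>\<^sup>+w. ennreal ((cmod (h w))\<^sup>2) \<partial>disc_measure s) \<le> (\<integral>\<^sup>+w. ennreal ((cmod (h w))\<^sup>2) \<partial>disc_measure R)"
          using s by (subst (1 2) nn_integral_restrict_space) (auto intro!: nn_integral_mono simp: indicator_def)
        show "(\<integral>\<^sup>+w. ennreal ((cmod (h w))\<^sup>2) \<partial>disc_measure R) < top"
          using False by (simp add: N_def less_top[symmetric])
      qed
      finally show ?thesis
        using disc_kernel_diag_pos[OF s(1)] by (simp add: mult_left_mono)
    qed
    have "(cmod (h (a - c)))\<^sup>2 \<le> disc_kernel_diag R (a - c) * enn2real N"
    proof (rule tendsto_lowerbound)
      have "R\<^sup>2 - (cmod (a - c))\<^sup>2 \<noteq> 0"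
        using power_strict_mono[OF aR norm_ge_zero, of 2] by simp
      then show "((\<lambda>s. disc_kernel_diag s (a - c) * enn2real N) \<longlongrightarrow> disc_kernel_diag R (a - c) * enn2real N) (at_left R)"
        unfolding disc_kernel_diag_def by (intro tendsto_intros) auto
      show "\<forall>\<^sub>F s in at_left R. (cmod (h (a - c)))\<^sup>2 \<le> disc_kernel_diag s (a - c) * enn2real N"
        using eventually_at_left_real[OF aR] by eventually_elim (use bound in auto)
    qed simp
    then have "ennreal ((cmod (h (a - c)))\<^sup>2) \<le> ennreal (disc_kernel_diag R (a - c) * enn2real N)"
      by (rule ennreal_leI)
    also have "\<dots> = ennreal (disc_kernel_diag R (a - c)) * N"
      using False disc_kernel_diag_pos[OF aR] by (simp add: ennreal_mult' less_top)
    finally show ?thesis .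
  qed
  then show ?thesis using N by (simp add: h_def)
qed

section \<open>Injectivity of the Berezin transform of a disc\<close>

text \<open>
  Polynomials in \<open>w\<close> and \<open>cnj w\<close>, generated by multiplication with one factor at a time, so that
  the vanishing of all moments of a function carries over to them by induction.
\<close>

inductive conj_poly :: "(complex \<Rightarrow> complex) \<Rightarrow> bool" where
  one: "conj_poly (\<lambda>w. 1)"
| add: "conj_poly p \<Longrightarrow> conj_poly q \<Longrightarrow> conj_poly (\<lambda>w. p w + q w)"
| cmult: "conj_poly p \<Longrightarrow> conj_poly (\<lambda>w. c * p w)"
| times_id: "conj_poly p \<Longrightarrow> conj_poly (\<lambda>w. w * p w)"
| times_cnj: "conj_poly p \<Longrightarrow> conj_poly (\<lambda>w. cnj w * p w)"

lemma continuous_on_conj_poly: "conj_poly p \<Longrightarrow> continuous_on S p"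
  by (induction rule: conj_poly.induct) (auto intro!: continuous_intros)

lemma conj_poly_mult_real_polynomial_function:
  fixes g :: "complex \<Rightarrow> real"
  assumes "real_polynomial_function g" "conj_poly h"
  shows "conj_poly (\<lambda>w. of_real (g w) * h w)"
  using assms
proof (induction g arbitrary: h rule: real_polynomial_function.induct)
  case (linear g)
  interpret bounded_linear g by fact
  have g: "g w = Re w * g 1 + Im w * g \<i>" for w
  proof -
    have "g w = g (Re w *\<^sub>R 1 + Im w *\<^sub>R \<i>)" by (rule arg_cong[of _ _ g]) (simp add: complex_eq_iff)
    also have "\<dots> = Re w * g 1 + Im w * g \<i>" by (simp only: add scaleR real_scaleR_def)
    finally show ?thesis .
  qed
  define A B where "A = Complex (g 1 / 2) (- g \<i> / 2)" and "B = Complex (g 1 / 2) (g \<i> / 2)"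
  have "of_real (g w) = A * w + B * cnj w" for w
    unfolding g[of w] by (simp add: complex_eq_iff A_def B_def algebra_simps)
  then have "(\<lambda>w. of_real (g w) * h w) = (\<lambda>w. A * (w * h w) + B * (cnj w * h w))"
    by (simp only: distrib_right mult.assoc)
  then show ?case using linear.prems by (simp add: conj_poly.intros)
next
  case (const c)
  then show ?case by (simp add: conj_poly.cmult)
next
  case (add f g)
  then show ?case using conj_poly.add by (simp add: distrib_right)
next
  case (mult f g)
  then show ?case using mult.IH(1)[OF mult.IH(2)[OF mult.prems]] by (simp add: mult.assoc)
qed

lemma integrable_disc_bounded_mult:
  fixes u p :: "complex \<Rightarrow> complex"
  assumes "continuous_on (ball 0 t) u" "\<And>w. w \<in> ball 0 t \<Longrightarrow> cmod (u w) \<le> U" "continuous_on (cball 0 t) p"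
  shows "integrable (disc_measure t) (\<lambda>w. u w * p w)"
proof -
  obtain B where B: "\<And>w. w \<in> cball 0 t \<Longrightarrow> cmod (p w) \<le> B"
    using continuous_on_compact_bound[OF assms(3) compact_cball] by metis
  show ?thesis
  proof (rule integrable_disc_measure)
    show "(\<lambda>w. u w * p w) \<in> borel_measurable (disc_measure t)"
      by (intro measurable_disc_measureI continuous_intros assms(1) continuous_on_subset[OF assms(3)]) auto
    show "norm (u w * p w) \<le> U * B" if "w \<in> ball 0 t" for w
    proof -
      have "cmod (u w) \<le> U" "cmod (p w) \<le> B" using assms(2) B that by auto
      then show ?thesis unfolding norm_mult using norm_ge_zero order_trans by (intro mult_mono) blast+
    qed
  qed
qed

text \<open>
  By the Stone-Weierstrass theorem \<open>cnj u\<close> is a uniform limit of polynomials in \<open>w\<close> and \<open>cnj w\<close>, and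
  \<open>u\<close> integrates to 0 against each of them. So its square integral vanishes.
\<close>

lemma conj_moments_zero_imp_zero:
  fixes u :: "complex \<Rightarrow> complex"
  assumes t: "t > 0" and u: "continuous_on (cball 0 t) u"
    and mom: "\<And>k l. (\<integral>w. u w * (w ^ k * cnj w ^ l) \<partial>disc_measure t) = 0"
    and w: "w \<in> ball 0 t"
  shows "u w = 0"
proof -
  let ?M = "disc_measure t"
  have ub: "continuous_on (ball 0 t) u" using u by (rule continuous_on_subset) auto
  obtain U where U0: "U \<ge> 0" and U: "\<And>w. w \<in> cball 0 t \<Longrightarrow> cmod (u w) \<le> U"
    using continuous_on_compact_bound[OF u compact_cball] by metis
  have int: "integrable ?M (\<lambda>w. u w * p w)" if "continuous_on (cball 0 t) p" for p
    using integrable_disc_bounded_mult[OF ub _ that, of U] U by auto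
  have intm: "integrable ?M (\<lambda>w. u w * ((w ^ k * cnj w ^ l) * p w))" if "conj_poly p" for p k l
    by (rule int)
       (intro continuous_on_mult continuous_on_power continuous_on_cnj continuous_on_id continuous_on_conj_poly that)
  have zero: "(\<integral>w. u w * ((w ^ k * cnj w ^ l) * p w) \<partial>?M) = 0" if "conj_poly p" for p k l
    using that
  proof (induction arbitrary: k l rule: conj_poly.induct)
    case (add p q)
    have "(\<lambda>w. u w * ((w ^ k * cnj w ^ l) * (p w + q w))) =
        (\<lambda>w. u w * ((w ^ k * cnj w ^ l) * p w) + u w * ((w ^ k * cnj w ^ l) * q w))"
      by (simp add: algebra_simps)
    then show ?case
      using add Bochner_Integration.integral_add[OF intm[OF add.hyps(1)] intm[OF add.hyps(2)]] by simp
  next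
    case (cmult p c)
    have "(\<lambda>w. u w * ((w ^ k * cnj w ^ l) * (c * p w))) = (\<lambda>w. c * (u w * ((w ^ k * cnj w ^ l) * p w)))"
      by (simp add: algebra_simps)
    then show ?case using cmult by simp
  next
    case (times_id p)
    show ?case using times_id.IH[of "Suc k" l] by (simp add: mult_ac)
  next
    case (times_cnj p)
    show ?case using times_cnj.IH[of k "Suc l"] by (simp add: mult_ac)
  qed (use mom in simp)
  have sq: "(\<integral>w. (cmod (u w))\<^sup>2 \<partial>?M) = 0"
  proof (rule ccontr)
    define A where "A = measure ?M (space ?M)"
    assume ne: "(\<integral>w. (cmod (u w))\<^sup>2 \<partial>?M) \<noteq> 0"
    define I where "I = (\<integral>w. (cmod (u w))\<^sup>2 \<partial>?M)"
    have "I \<ge> 0" unfolding I_def by (rule Bochner_Integration.integral_nonneg) simp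
    moreover have "I \<noteq> 0" using ne unfolding I_def .
    ultimately have I: "I > 0" by simp
    \<comment> \<open>An approximation error for which the error term stays below \<open>I\<close>.\<close>
    define e where "e = I / (2 * U * A + 1) / 2"
    have A0: "A \<ge> 0" by (simp add: A_def)
    have den: "2 * U * A + 1 > 0" using U0 A0 by (simp add: add_nonneg_pos)
    have e: "e > 0" using I den by (simp add: e_def)
    obtain g1 where g1: "real_polynomial_function g1" "\<And>w. w \<in> cball 0 t \<Longrightarrow> \<bar>Re (cnj (u w)) - g1 w\<bar> < e"
      using Stone_Weierstrass_real_polynomial_function[OF compact_cball _ e, of 0 t "\<lambda>w. Re (cnj (u w))"]
        continuous_on_Re[OF continuous_on_cnj[OF u]] by metis
    obtain g2 where g2: "real_polynomial_function g2" "\<And>w. w \<in> cball 0 t \<Longrightarrow> \<bar>Im (cnj (u w)) - g2 w\<bar> < e"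
      using Stone_Weierstrass_real_polynomial_function[OF compact_cball _ e, of 0 t "\<lambda>w. Im (cnj (u w))"]
        continuous_on_Im[OF continuous_on_cnj[OF u]] by metis
    define p where "p w = of_real (g1 w) + \<i> * of_real (g2 w)" for w
    have "conj_poly (\<lambda>w. of_real (g1 w) * 1)" "conj_poly (\<lambda>w. of_real (g2 w) * 1)"
      by (intro conj_poly_mult_real_polynomial_function g1 g2 conj_poly.one)+
    then have p: "conj_poly p"
      unfolding p_def by (intro conj_poly.add conj_poly.cmult) simp_all
    have close: "cmod (cnj (u w) - p w) \<le> 2 * e" if "w \<in> cball 0 t" for w
      using cmod_le[of "cnj (u w) - p w"] g1(2)[OF that] g2(2)[OF that] by (simp add: p_def)
    have "of_real I = (\<integral>w. u w * cnj (u w) \<partial>?M)"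
      unfolding I_def integral_complex_of_real[symmetric] complex_norm_square ..
    also have "\<dots> = (\<integral>w. u w * cnj (u w) \<partial>?M) - (\<integral>w. u w * p w \<partial>?M)"
      using zero[OF p, of 0 0] by simp
    also have "\<dots> = (\<integral>w. u w * cnj (u w) - u w * p w \<partial>?M)"
      by (rule Bochner_Integration.integral_diff[symmetric])
         (intro int continuous_on_cnj u continuous_on_conj_poly p)+
    finally have "I = cmod (\<integral>w. u w * cnj (u w) - u w * p w \<partial>?M)"
      using I by (metis abs_of_pos norm_of_real)
    also have "\<dots> \<le> (\<integral>w. cmod (u w * cnj (u w) - u w * p w) \<partial>?M)" by (rule integral_norm_bound)
    also have "\<dots> \<le> (\<integral>w. U * (2 * e) \<partial>?M)"
    proof (rule integral_mono)
      show "integrable ?M (\<lambda>w. cmod (u w * cnj (u w) - u w * p w))"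
        by (intro integrable_norm Bochner_Integration.integrable_diff int continuous_on_cnj u continuous_on_conj_poly p)
      show "integrable ?M (\<lambda>w. U * (2 * e))" by (rule finite_measure.integrable_const[OF finite_disc_measure])
      fix w assume "w \<in> space ?M"
      then have w: "w \<in> cball 0 t" by (simp add: space_restrict_space)
      have "cmod (u w * cnj (u w) - u w * p w) = cmod (u w) * cmod (cnj (u w) - p w)"
        by (simp add: norm_mult[symmetric] right_diff_distrib)
      also have "\<dots> \<le> U * (2 * e)" using U[OF w] close[OF w] U0 by (intro mult_mono) auto
      finally show "cmod (u w * cnj (u w) - u w * p w) \<le> U * (2 * e)" .
    qed
    also have "\<dots> = e * (2 * U * A)" by (simp add: A_def)
    also have "\<dots> \<le> e * (2 * U * A + 1)" using e by (intro mult_left_mono) auto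
    also have "\<dots> = I / 2"
    proof -
      have "I / D / 2 * D = I / 2" if "D > 0" for D using that by simp
      from this[OF den] show ?thesis by (simp only: e_def)
    qed
    finally show False using I by simp
  qed
  have "AE w in ?M. (cmod (u w))\<^sup>2 = 0"
  proof (subst integral_nonneg_eq_0_iff_AE[symmetric])
    show "integrable ?M (\<lambda>w. (cmod (u w))\<^sup>2)"
      by (rule integrable_disc_measure[where B="U\<^sup>2"])
         (use U in \<open>auto intro!: measurable_disc_measureI continuous_intros ub power_mono\<close>)
  qed (use sq in auto)
  then have AE: "AE w in lborel. w \<in> ball 0 t \<longrightarrow> u w = 0"
    by (simp add: AE_restrict_space_iff)
  have op: "open {w \<in> ball 0 t. u w \<noteq> 0}"
  proof -
    have "open (ball 0 t \<inter> u -` (- {0}))" by (rule continuous_open_preimage[OF ub]) auto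
    moreover have "ball 0 t \<inter> u -` (- {0}) = {w \<in> ball 0 t. u w \<noteq> 0}" by auto
    ultimately show ?thesis by simp
  qed
  have "{w \<in> space lborel. \<not> (w \<in> ball 0 t \<longrightarrow> u w = 0)} = {w \<in> ball 0 t. u w \<noteq> 0}" by auto
  then have "{w \<in> ball 0 t. u w \<noteq> 0} \<in> null_sets lborel"
    using AE_iff_null[of lborel "\<lambda>w. w \<in> ball 0 t \<longrightarrow> u w = 0"] AE op by (simp only: sets_lborel borel_open)
  then have "negligible {w \<in> ball 0 t. u w \<noteq> 0}"
    by (simp add: negligible_iff_null_sets null_sets_completionI)
  then have "{w \<in> ball 0 t. u w \<noteq> 0} = {}" using open_not_negligible[OF op] by blast
  then show ?thesis using w by blast
qed

lemma infinite_unit_circle: "infinite {z :: complex. cmod z = 1}"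
proof
  assume "finite {z :: complex. cmod z = 1}"
  moreover have "cis ` {0<..<pi} \<subseteq> {z. cmod z = 1}" by auto
  ultimately have "finite (cis ` {0<..<pi})" using finite_subset by blast
  moreover have "inj_on cis {0<..<pi}"
  proof (rule inj_onI)
    fix x y assume xy: "x \<in> {0<..<pi}" "y \<in> {0<..<pi}" "cis x = cis y"
    then have "cos x = cos y" by (metis cis.sel(1))
    then show "x = y" using xy cos_inj_pi[of x y] by auto
  qed
  ultimately have "finite {0<..<pi}" using finite_imageD by blast
  then show False using pi_gt_zero by (simp add: infinite_Ioo)
qed

text \<open>
  The zeros on the positive half line accumulate at 0.
\<close>

lemma power_series_zero_coefficients:
  fixes a :: "nat \<Rightarrow> complex"
  assumes \<rho>: "\<rho> > 0" and z: "\<And>s. 0 \<le> s \<Longrightarrow> s < \<rho> \<Longrightarrow> (\<lambda>n. a n * of_real s ^ n) sums 0"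
  shows "a n = 0"
proof (rule ccontr)
  assume n: "a n \<noteq> 0"
  have a0: "a 0 = 0" using sums_unique2[OF powser_sums_zero[of a] ] z[of 0] \<rho> by simp
  then have "n > 0" using n by (cases n) auto
  define f where "f x = (\<Sum>n. a n * x ^ n)" for x
  have "(\<lambda>n. a n * (x - 0) ^ n) sums f x" if x: "norm (x - 0) < \<rho>" for x
  proof -
    obtain s where s: "cmod x < s" "s < \<rho>" using dense[of "cmod x" \<rho>] x by auto
    have "summable (\<lambda>n. a n * x ^ n)"
      by (rule powser_inside[of a "of_real s"])
         (use z[of s] s order_trans[OF norm_ge_zero less_imp_le[OF s(1)]] in \<open>auto simp: sums_iff\<close>)
    then show ?thesis by (simp add: f_def summable_sums)
  qed
  moreover have "f 0 = 0" using a0 by (simp add: f_def)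
  ultimately obtain s where s: "s > 0" "\<And>z. z \<in> cball 0 s - {0} \<Longrightarrow> f z \<noteq> 0"
    using powser_0_nonzero[OF \<rho>, of 0 a f n] n \<open>n > 0\<close> by metis
  let ?x = "min s (\<rho> / 2)"
  have "0 \<le> ?x" "?x < \<rho>" using s \<rho> by (auto simp: min_def)
  then have "f (of_real ?x) = 0" using z[of ?x] by (simp add: f_def sums_iff)
  moreover have "of_real ?x \<in> cball 0 s - {0 :: complex}" using s \<rho> by (auto simp: min_def)
  ultimately show False using s(2) by blast
qed

text \<open>
  The squared modulus of the kernel is a power series in \<open>\<beta>\<close> and \<open>cnj \<beta>\<close> whose coefficients are
  monomials in \<open>w\<close> and \<open>cnj w\<close>. Along each ray the parts of degree \<open>n\<close> vanish, and varying the
  ray separates the moments of \<open>u\<close> within a part.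
\<close>

lemma disc_berezin_injective:
  fixes u :: "complex \<Rightarrow> complex"
  assumes t: "t > 0" and u: "continuous_on (cball 0 t) u" and \<rho>: "\<rho> > 0"
    and zero: "\<And>\<beta>. cmod \<beta> < \<rho> \<Longrightarrow> (\<integral>w. u w * of_real ((cmod (disc_kernel t w \<beta>))\<^sup>2) \<partial>disc_measure t) = 0"
    and w: "w \<in> ball 0 t"
  shows "u w = 0"
proof (rule conj_moments_zero_imp_zero[OF t u])
  show "w \<in> ball 0 t" by (rule w)
  let ?M = "disc_measure t"
  have ub: "continuous_on (ball 0 t) u" using u by (rule continuous_on_subset) auto
  obtain U where U0: "U \<ge> 0" and U: "\<And>w. w \<in> cball 0 t \<Longrightarrow> cmod (u w) \<le> U"
    using continuous_on_compact_bound[OF u compact_cball] by metis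
  have int: "integrable ?M (\<lambda>w. u w * p w)" if "continuous_on (cball 0 t) p" for p
    using integrable_disc_bounded_mult[OF ub _ that, of U] U by auto
  define mom where "mom k l = (\<integral>w. u w * (w ^ k * cnj w ^ l) \<partial>?M)" for k l
  define c where "c \<omega> n w = (\<Sum>l\<le>n. (of_nat (Suc l) * (cnj w * \<omega> / of_real (t\<^sup>2)) ^ l) *
      (of_nat (Suc (n - l)) * (w * cnj \<omega> / of_real (t\<^sup>2)) ^ (n - l)))" for \<omega> n w
  have c_cont: "continuous_on S (c \<omega> n)" for S \<omega> n
    unfolding c_def by (intro continuous_intros) (use t in auto)
  define D where "D n = (\<Sum>l\<le>n. real (Suc l) * real (Suc (n - l)))" for n
  have c_bound: "cmod (c \<omega> n w) \<le> D n * (1 / t) ^ n" if w: "cmod w \<le> t" and \<omega>: "cmod \<omega> = 1" for \<omega> n w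
  proof -
    have x: "cmod (cnj w * \<omega> / of_real (t\<^sup>2)) \<le> 1 / t" "cmod (w * cnj \<omega> / of_real (t\<^sup>2)) \<le> 1 / t"
      using w \<omega> t by (simp_all add: norm_divide norm_mult norm_power power2_eq_square divide_simps)
    have "cmod (c \<omega> n w) \<le> (\<Sum>l\<le>n. (real (Suc l) * (1 / t) ^ l) * (real (Suc (n - l)) * (1 / t) ^ (n - l)))"
      unfolding c_def
      by (rule order_trans[OF norm_sum], rule sum_mono, unfold norm_mult norm_power norm_of_nat,
          intro mult_mono power_mono x) (use t in auto)
    also have "\<dots> = D n * (1 / t) ^ n"
      unfolding D_def sum_distrib_right
    proof (rule sum.cong[OF refl])
      fix l assume "l \<in> {..n}"
      then have "(1 / t) ^ n = (1 / t) ^ l * (1 / t) ^ (n - l)" by (simp add: power_add[symmetric])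
      then show "real (Suc l) * (1 / t) ^ l * (real (Suc (n - l)) * (1 / t) ^ (n - l)) =
          real (Suc l) * real (Suc (n - l)) * (1 / t) ^ n" by (simp only: mult_ac)
    qed
    finally show ?thesis .
  qed
  have D_summable: "summable (\<lambda>n. D n * x ^ n)" if x: "0 \<le> x" "x < 1" for x :: real
  proof -
    have s: "summable (\<lambda>k. norm (of_nat (Suc k) * x ^ k))"
      using geometric_deriv_sums[of x] x by (simp add: sums_iff abs_mult del: of_nat_Suc)
    have "summable (\<lambda>n. \<Sum>l\<le>n. (of_nat (Suc l) * x ^ l) * (of_nat (Suc (n - l)) * x ^ (n - l)))"
      by (rule summable_Cauchy_product[OF s s])
    moreover have "(\<Sum>l\<le>n. (of_nat (Suc l) * x ^ l) * (of_nat (Suc (n - l)) * x ^ (n - l))) = D n * x ^ n" for n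
      unfolding D_def sum_distrib_right
    proof (rule sum.cong[OF refl])
      fix l assume "l \<in> {..n}"
      then have "x ^ n = x ^ l * x ^ (n - l)" by (simp add: power_add[symmetric])
      then show "of_nat (Suc l) * x ^ l * (of_nat (Suc (n - l)) * x ^ (n - l)) =
          real (Suc l) * real (Suc (n - l)) * x ^ n" by (simp only: mult_ac)
    qed
    ultimately show ?thesis by simp
  qed
  have D0: "D n \<ge> 0" for n unfolding D_def by (intro sum_nonneg) auto
  have series: "(\<lambda>n. (\<integral>w. u w * c \<omega> n w \<partial>?M) * of_real s ^ n) sums 0"
    if s: "0 \<le> s" "s < min \<rho> t" and \<omega>: "cmod \<omega> = 1" for s \<omega>
  proof -
    let ?\<beta> = "of_real s * \<omega>"
    have st: "s / t < 1" "s / t \<ge> 0" using s t by auto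
    have expand: "(\<lambda>n. c \<omega> n w * of_real s ^ n) sums
        (of_real (pi\<^sup>2 * t ^ 4) * of_real ((cmod (disc_kernel t w ?\<beta>))\<^sup>2))" if w: "cmod w < t" for w
    proof -
      define A where "A = of_real s * (cnj w * \<omega> / of_real (t\<^sup>2))"
      define B where "B = of_real s * (w * cnj \<omega> / of_real (t\<^sup>2))"
      have "s * cmod w < t * t" using s w by (intro mult_strict_mono') auto
      then have nA: "norm A < 1" and nB: "norm B < 1"
        unfolding A_def B_def using s \<omega> t by (simp_all add: norm_mult norm_divide norm_power power2_eq_square)
      have sm: "summable (\<lambda>k. norm (of_nat (Suc k) * x ^ k))" if "norm x < 1" for x :: complex
        using geometric_deriv_sums[of "norm x"] that by (simp add: sums_iff norm_mult norm_power del: of_nat_Suc)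
      have "(\<lambda>n. \<Sum>l\<le>n. (of_nat (Suc l) * A ^ l) * (of_nat (Suc (n - l)) * B ^ (n - l))) sums
          (1 / (1 - A)\<^sup>2 * (1 / (1 - B)\<^sup>2))"
        using Cauchy_product_sums[OF sm[OF nA] sm[OF nB]] sums_unique[OF geometric_deriv_sums[OF nA]]
          sums_unique[OF geometric_deriv_sums[OF nB]] by simp
      moreover have "(\<Sum>l\<le>n. (of_nat (Suc l) * A ^ l) * (of_nat (Suc (n - l)) * B ^ (n - l))) = c \<omega> n w * of_real s ^ n" for n
        unfolding c_def sum_distrib_right
      proof (rule sum.cong[OF refl])
        fix l assume "l \<in> {..n}"
        then have "(of_real s :: complex) ^ n = of_real s ^ l * of_real s ^ (n - l)" by (simp add: power_add[symmetric])
        then show "of_nat (Suc l) * A ^ l * (of_nat (Suc (n - l)) * B ^ (n - l)) =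
            of_nat (Suc l) * (cnj w * \<omega> / of_real (t\<^sup>2)) ^ l * (of_nat (Suc (n - l)) * (w * cnj \<omega> / of_real (t\<^sup>2)) ^ (n - l)) * of_real s ^ n"
          unfolding A_def B_def power_mult_distrib by (simp only: mult_ac)
      qed
      moreover have "1 / (1 - A)\<^sup>2 * (1 / (1 - B)\<^sup>2) = of_real (pi\<^sup>2 * t ^ 4) * of_real ((cmod (disc_kernel t w ?\<beta>))\<^sup>2)"
      proof -
        have K: "of_real (pi * t\<^sup>2) * disc_kernel t w ?\<beta> = 1 / (1 - B)\<^sup>2"
        proof -
          have "of_real (t\<^sup>2) - w * cnj ?\<beta> = of_real (t\<^sup>2) * (1 - B)"
            using t by (simp add: B_def right_diff_distrib mult_ac)
          then show ?thesis
            unfolding disc_kernel_def using t by (simp add: power_mult_distrib power2_eq_square)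
        qed
        have "1 / (1 - A)\<^sup>2 = cnj (1 / (1 - B)\<^sup>2)" by (simp add: A_def B_def)
        then have "1 / (1 - A)\<^sup>2 * (1 / (1 - B)\<^sup>2) = (of_real (pi * t\<^sup>2) * disc_kernel t w ?\<beta>) * cnj (of_real (pi * t\<^sup>2) * disc_kernel t w ?\<beta>)"
          unfolding K by simp
        also have "\<dots> = of_real ((pi * t\<^sup>2)\<^sup>2) * (disc_kernel t w ?\<beta> * cnj (disc_kernel t w ?\<beta>))"
          by (simp add: power2_eq_square mult_ac)
        also have "(pi * t\<^sup>2)\<^sup>2 = pi\<^sup>2 * t ^ 4" by (simp add: power_mult_distrib)
        finally show ?thesis by (simp only: complex_norm_square)
      qed
      ultimately show ?thesis by simp
    qed
    let ?f = "\<lambda>n w. u w * (c \<omega> n w * of_real s ^ n)"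
    have fint: "integrable ?M (?f n)" for n by (intro int continuous_intros c_cont)
    have fb: "norm (?f n w) \<le> U * (D n * (s / t) ^ n)" if "cmod w < t" for n w
    proof -
      have "norm (?f n w) = cmod (u w) * (cmod (c \<omega> n w) * s ^ n)" using s by (simp add: norm_mult norm_power)
      also have "\<dots> \<le> U * ((D n * (1 / t) ^ n) * s ^ n)"
        using U[of w] that c_bound[OF _ \<omega>, of w n] U0 s D0[of n] t by (intro mult_mono) auto
      also have "\<dots> = U * (D n * (s / t) ^ n)" by (simp add: power_divide)
      finally show ?thesis .
    qed
    have fsm: "summable (\<lambda>n. U * (D n * (s / t) ^ n))"
      by (intro summable_mult D_summable) (use st in auto)
    have "(\<lambda>n. \<integral>w. ?f n w \<partial>?M) sums (\<integral>w. (\<Sum>n. ?f n w) \<partial>?M)"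
    proof (rule sums_integral[OF fint])
      show "AE w in ?M. summable (\<lambda>n. norm (?f n w))"
        by (rule AE_I2, rule summable_comparison_test'[OF fsm, of 0]) (use fb in \<open>auto simp: space_restrict_space\<close>)
      show "summable (\<lambda>n. \<integral>w. norm (?f n w) \<partial>?M)"
      proof (rule summable_comparison_test'[of _ 0])
        show "summable (\<lambda>n. measure ?M (space ?M) * (U * (D n * (s / t) ^ n)))" by (rule summable_mult[OF fsm])
        fix n
        have "(\<integral>w. norm (?f n w) \<partial>?M) \<le> (\<integral>w. U * (D n * (s / t) ^ n) \<partial>?M)"
          by (rule integral_mono[OF integrable_norm[OF fint] finite_measure.integrable_const[OF finite_disc_measure]])
             (use fb in \<open>auto simp: space_restrict_space\<close>)
        then show "norm (\<integral>w. norm (?f n w) \<partial>?M) \<le> measure ?M (space ?M) * (U * (D n * (s / t) ^ n))"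
          by (simp add: mult_ac)
      qed
    qed
    also have "(\<integral>w. (\<Sum>n. ?f n w) \<partial>?M) =
        (\<integral>w. of_real (pi\<^sup>2 * t ^ 4) * (u w * of_real ((cmod (disc_kernel t w ?\<beta>))\<^sup>2)) \<partial>?M)"
    proof (rule Bochner_Integration.integral_cong[OF refl])
      fix w assume "w \<in> space ?M"
      then have "cmod w < t" by (simp add: space_restrict_space)
      from sums_mult[OF expand[OF this], of "u w"]
      show "(\<Sum>n. ?f n w) = of_real (pi\<^sup>2 * t ^ 4) * (u w * of_real ((cmod (disc_kernel t w ?\<beta>))\<^sup>2))"
        by (simp add: sums_iff mult_ac)
    qed
    also have "\<dots> = 0"
      using zero[of ?\<beta>] s \<omega> by (subst integral_mult_right_zero) (simp add: norm_mult)
    finally show ?thesis by (simp add: mult.assoc[symmetric])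
  qed
  have mom0: "mom (n - l) l = 0" if "l \<le> n" for n l
  proof -
    have coef: "(\<integral>w. u w * c \<omega> n w \<partial>?M) = 0" if "cmod \<omega> = 1" for \<omega>
      by (rule power_series_zero_coefficients[of "min \<rho> t"]) (use series[OF _ _ that] \<rho> t in auto)
    define d where "d l = of_nat (Suc l) * of_nat (Suc (n - l)) / of_real (t\<^sup>2) ^ n * mom (n - l) l" for l
    have "(\<Sum>l\<le>n. d l * \<zeta> ^ l) = 0" if \<zeta>: "cmod \<zeta> = 1" for \<zeta>
    proof -
      \<comment> \<open>On the circle the part of degree \<open>n\<close>, multiplied by \<open>\<omega> ^ n\<close>, is a polynomial in \<open>\<omega> * \<omega>\<close>.\<close>
      define \<omega> where "\<omega> = csqrt \<zeta>"
      have \<omega>2: "\<omega> * \<omega> = \<zeta>" using power2_csqrt[of \<zeta>] by (simp add: \<omega>_def power2_eq_square)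
      have \<omega>1: "cmod \<omega> = 1" using \<zeta> by (simp add: \<omega>_def norm_csqrt)
      then have \<omega>c: "cnj \<omega> * \<omega> = 1" using complex_norm_square[of \<omega>] by (simp add: mult.commute)
      have "0 = (\<integral>w. u w * c \<omega> n w \<partial>?M) * \<omega> ^ n" using coef[OF \<omega>1] by simp
      also have "(\<integral>w. u w * c \<omega> n w \<partial>?M) =
          (\<integral>w. (\<Sum>l\<le>n. (of_nat (Suc l) * of_nat (Suc (n - l)) / of_real (t\<^sup>2) ^ n * (\<omega> ^ l * cnj \<omega> ^ (n - l))) *
            (u w * (w ^ (n - l) * cnj w ^ l))) \<partial>?M)"
        unfolding c_def sum_distrib_left
      proof (intro Bochner_Integration.integral_cong refl sum.cong)
        fix w l assume "l \<in> {..n}"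
        then have "(of_real (t\<^sup>2) :: complex) ^ n = of_real (t\<^sup>2) ^ l * of_real (t\<^sup>2) ^ (n - l)"
          by (simp add: power_add[symmetric])
        then show "u w * (of_nat (Suc l) * (cnj w * \<omega> / of_real (t\<^sup>2)) ^ l * (of_nat (Suc (n - l)) * (w * cnj \<omega> / of_real (t\<^sup>2)) ^ (n - l))) =
           (of_nat (Suc l) * of_nat (Suc (n - l)) / of_real (t\<^sup>2) ^ n * (\<omega> ^ l * cnj \<omega> ^ (n - l))) *
            (u w * (w ^ (n - l) * cnj w ^ l))"
          by (simp add: power_divide power_mult_distrib mult_ac del: of_real_power of_nat_Suc)
      qed
      also have "\<dots> = (\<Sum>l\<le>n. (of_nat (Suc l) * of_nat (Suc (n - l)) / of_real (t\<^sup>2) ^ n * (\<omega> ^ l * cnj \<omega> ^ (n - l))) * mom (n - l) l)"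
        unfolding mom_def by (subst Bochner_Integration.integral_sum) (auto intro!: int continuous_intros)
      also have "\<dots> * \<omega> ^ n = (\<Sum>l\<le>n. d l * \<zeta> ^ l)"
        unfolding sum_distrib_right
      proof (rule sum.cong[OF refl])
        fix l assume "l \<in> {..n}"
        then have "\<omega> ^ n = \<omega> ^ l * \<omega> ^ (n - l)" by (simp add: power_add[symmetric])
        then have "(\<omega> ^ l * cnj \<omega> ^ (n - l)) * \<omega> ^ n = (\<omega> * \<omega>) ^ l * (cnj \<omega> * \<omega>) ^ (n - l)"
          by (simp only: power_mult_distrib mult_ac)
        then have e: "(\<omega> ^ l * cnj \<omega> ^ (n - l)) * \<omega> ^ n = \<zeta> ^ l" by (simp add: \<omega>2 \<omega>c)
        show "of_nat (Suc l) * of_nat (Suc (n - l)) / of_real (t\<^sup>2) ^ n * (\<omega> ^ l * cnj \<omega> ^ (n - l)) * mom (n - l) l * \<omega> ^ n = d l * \<zeta> ^ l"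
          unfolding d_def e[symmetric] by (simp only: mult_ac)
      qed
      finally show ?thesis ..
    qed
    then have "{\<zeta>. cmod \<zeta> = 1} \<subseteq> {\<zeta>. (\<Sum>l\<le>n. d l * \<zeta> ^ l) = 0}" by blast
    then have "infinite {\<zeta>. (\<Sum>l\<le>n. d l * \<zeta> ^ l) = 0}" using infinite_unit_circle finite_subset by blast
    then have "d l = 0" using that polyfun_finite_roots[of d n] by blast
    then show ?thesis using t by (simp add: d_def del: of_nat_Suc)
  qed
  show "(\<integral>w. u w * (w ^ k * cnj w ^ l) \<partial>?M) = 0" for k l
    using mom0[of l "k + l"] by (simp add: mom_def)
qed

section \<open>Bidiscs\<close>

text \<open>The index \<open>i\<close> is a parameter, so that both coordinates can play either role.\<close>

definition pair_vec :: "2 \<Rightarrow> complex \<Rightarrow> complex \<Rightarrow> complex ^ 2" where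
  "pair_vec i a b = (\<chi> k. if k = i then a else b)"

lemma pair_vec_nth [simp]:
  "pair_vec i a b $ i = a" "j \<noteq> i \<Longrightarrow> pair_vec i a b $ j = b" "i \<noteq> j \<Longrightarrow> pair_vec i a b $ j = b"
  by (auto simp: pair_vec_def)

lemma eq_2_cases: "i \<noteq> j \<Longrightarrow> k = i \<or> k = j" for i j k :: 2
  using exhaust_2[of i] exhaust_2[of j] exhaust_2[of k] by auto

lemma pair_vec_eta: "i \<noteq> j \<Longrightarrow> pair_vec i (w $ i) (w $ j) = w"
  by (auto simp: pair_vec_def vec_eq_iff dest: eq_2_cases)

lemma continuous_on_pair_vec [continuous_intros]:
  "continuous_on S f \<Longrightarrow> continuous_on S g \<Longrightarrow> continuous_on S (\<lambda>x. pair_vec i (f x) (g x))"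
  unfolding pair_vec_def
proof (intro continuous_on_vec_lambda)
  fix k assume "continuous_on S f" "continuous_on S g"
  then show "continuous_on S (\<lambda>x. if k = i then f x else g x)" by (cases "k = i") simp_all
qed

lemma pair_vec_measurable: "(\<lambda>(a, b). pair_vec i a b) \<in> borel_measurable borel"
  by (intro borel_measurable_continuous_onI) (auto simp: split_beta intro!: continuous_intros)

lemma lborel_pair_vec:
  "(lborel :: (complex ^ 2) measure) = distr (lborel \<Otimes>\<^sub>M lborel) borel (\<lambda>(a, b). pair_vec i a b)"
proof (rule lborel_eqI)
  let ?f = "\<lambda>(a, b). pair_vec i a b"
  fix l u :: "complex ^ 2" assume *: "\<And>b. b \<in> Basis \<Longrightarrow> l \<bullet> b \<le> u \<bullet> b"
  have B: "(Basis :: (complex ^ 2) set) = {axis 1 1, axis 1 \<i>, axis 2 1, axis 2 \<i>}"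
    by (auto simp: Basis_vec_def UNIV_2 Basis_complex_def)
  have le: "Re (l $ k) \<le> Re (u $ k)" "Im (l $ k) \<le> Im (u $ k)" for k
    using *[of "axis k 1"] *[of "axis k \<i>"] exhaust_2[of k] by (auto simp: B inner_axis)
  obtain j where j: "i \<noteq> j" using that[of "i + 1"] by simp
  have vim: "?f -` box l u = box (l $ i) (u $ i) \<times> box (l $ j) (u $ j)"
  proof -
    have "pair_vec i a b \<in> box l u \<longleftrightarrow> (\<forall>k. pair_vec i a b $ k \<in> box (l $ k) (u $ k))" for a b
      by (auto simp: mem_box B Basis_complex_def inner_axis forall_2)
    moreover have "(\<forall>k. Q k) \<longleftrightarrow> Q i \<and> Q j" for Q :: "2 \<Rightarrow> bool"
      using eq_2_cases[OF j] by metis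
    ultimately have "pair_vec i a b \<in> box l u \<longleftrightarrow> a \<in> box (l $ i) (u $ i) \<and> b \<in> box (l $ j) (u $ j)" for a b
      using j by (simp del: mem_box)
    then show ?thesis by auto
  qed
  have meas: "?f \<in> measurable (lborel \<Otimes>\<^sub>M lborel) borel"
    using pair_vec_measurable by (simp add: lborel_prod)
  have "emeasure (distr (lborel \<Otimes>\<^sub>M lborel) borel ?f) (box l u)
      = emeasure (lborel \<Otimes>\<^sub>M lborel) (box (l $ i) (u $ i) \<times> box (l $ j) (u $ j))"
    by (subst emeasure_distr[OF meas]) (auto simp: vim space_pair_measure)
  also have "\<dots> = emeasure lborel (box (l $ i) (u $ i)) * emeasure lborel (box (l $ j) (u $ j))"
    by (rule lborel.emeasure_pair_measure_Times) auto
  also have "\<dots> = ennreal ((\<Prod>b\<in>Basis. (u $ i - l $ i) \<bullet> b) * (\<Prod>b\<in>Basis. (u $ j - l $ j) \<bullet> b))"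
    using le by (subst (1 2) emeasure_lborel_box)
      (auto simp: Basis_complex_def intro!: ennreal_mult[symmetric] mult_nonneg_nonneg)
  also have "(\<Prod>b\<in>Basis. (u $ i - l $ i) \<bullet> b) * (\<Prod>b\<in>Basis. (u $ j - l $ j) \<bullet> b)
      = (\<Prod>b\<in>Basis. (u - l) \<bullet> b)"
    using j exhaust_2[of i] exhaust_2[of j]
    by (auto simp: B Basis_complex_def inner_axis axis_eq_axis)
  finally show "emeasure (distr (lborel \<Otimes>\<^sub>M lborel) borel ?f) (box l u) = ennreal (\<Prod>b\<in>Basis. (u - l) \<bullet> b)" .
qed simp

lemma nn_integral_pair_vec:
  assumes "f \<in> borel_measurable borel"
  shows "(\<integral>\<^sup>+w. f w \<partial>lborel) = (\<integral>\<^sup>+a. \<integral>\<^sup>+b. f (pair_vec i a b) \<partial>lborel \<partial>lborel)"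
proof -
  have m: "(\<lambda>(a, b). pair_vec i a b) \<in> measurable (lborel \<Otimes>\<^sub>M lborel) borel"
    using pair_vec_measurable by (simp add: lborel_prod)
  have "(\<integral>\<^sup>+w. f w \<partial>lborel) = (\<integral>\<^sup>+x. f (case x of (a, b) \<Rightarrow> pair_vec i a b) \<partial>(lborel \<Otimes>\<^sub>M lborel))"
    using assms by (subst lborel_pair_vec[of i]) (simp add: nn_integral_distr[OF m])
  also have "\<dots> = (\<integral>\<^sup>+a. \<integral>\<^sup>+b. f (pair_vec i a b) \<partial>lborel \<partial>lborel)"
    using measurable_compose[OF m assms] by (subst lborel.nn_integral_fst[symmetric]) auto
  finally show ?thesis .
qed

lemma integral_pair_vec:
  fixes f :: "complex ^ 2 \<Rightarrow> complex"
  assumes "integrable lborel f"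
  shows "(\<integral>w. f w \<partial>lborel) = (\<integral>a. \<integral>b. f (pair_vec i a b) \<partial>lborel \<partial>lborel)"
    and "(\<lambda>a. \<integral>b. f (pair_vec i a b) \<partial>lborel) \<in> borel_measurable lborel"
proof -
  have m: "(\<lambda>(a, b). pair_vec i a b) \<in> measurable (lborel \<Otimes>\<^sub>M lborel) borel"
    using pair_vec_measurable by (simp add: lborel_prod)
  have f: "f \<in> borel_measurable borel" using borel_measurable_integrable[OF assms] by simp
  have "integrable (distr (lborel \<Otimes>\<^sub>M lborel) borel (\<lambda>(a, b). pair_vec i a b)) f"
    using assms lborel_pair_vec[of i] by simp
  then have int: "integrable (lborel \<Otimes>\<^sub>M lborel) (\<lambda>x. f (case x of (a, b) \<Rightarrow> pair_vec i a b))"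
    using integrable_distr_eq[OF m f] by simp
  have "(\<integral>w. f w \<partial>lborel) = (\<integral>x. f (case x of (a, b) \<Rightarrow> pair_vec i a b) \<partial>(lborel \<Otimes>\<^sub>M lborel))"
    by (subst lborel_pair_vec[of i]) (simp add: integral_distr[OF m] f)
  also have "\<dots> = (\<integral>a. \<integral>b. f (pair_vec i a b) \<partial>lborel \<partial>lborel)"
    using lborel_pair.integral_fst'[OF int] by simp
  finally show "(\<integral>w. f w \<partial>lborel) = (\<integral>a. \<integral>b. f (pair_vec i a b) \<partial>lborel \<partial>lborel)" .
  show "(\<lambda>a. \<integral>b. f (pair_vec i a b) \<partial>lborel) \<in> borel_measurable lborel"
    using lborel.borel_measurable_lebesgue_integral[of "\<lambda>a b. f (pair_vec i a b)" lborel]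
      measurable_compose[OF m f] by (simp add: split_beta)
qed

lemma holomorphic_slice:
  assumes hol: "holomorphic_sev f \<Omega>" and "\<And>\<zeta>. \<zeta> \<in> S \<Longrightarrow> pair_vec i a \<zeta> \<in> \<Omega>"
  shows "(\<lambda>\<zeta>. f (pair_vec i a \<zeta>)) holomorphic_on S"
proof -
  have eq: "pair_vec i a \<zeta> = pair_vec i a 0 + \<zeta> *s pair_vec i 0 1" for \<zeta>
    by (simp add: vec_eq_iff pair_vec_def)
  have "(\<lambda>\<zeta>. f (pair_vec i a 0 + \<zeta> *s pair_vec i 0 1)) holomorphic_on S"
    by (rule holomorphic_on_line[OF hol]) (simp only: eq[symmetric] assms(2))
  then show ?thesis by (simp only: eq[symmetric])
qed

lemma pair_vec_swap: "i \<noteq> j \<Longrightarrow> pair_vec i a b = pair_vec j b a"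
  by (auto simp: pair_vec_def vec_eq_iff dest: eq_2_cases)

lemma nn_integral_lebesgue_on_open:
  fixes f :: "complex ^ 'n \<Rightarrow> real"
  assumes op: "open \<Omega>" and cont: "continuous_on \<Omega> f"
  shows "(\<lambda>z. ennreal (f z) * indicator \<Omega> z) \<in> borel_measurable borel"
    and "(\<integral>\<^sup>+z. ennreal (f z) \<partial>lebesgue_on \<Omega>) = (\<integral>\<^sup>+z. ennreal (f z) * indicator \<Omega> z \<partial>lborel)"
proof -
  have "(\<lambda>z. ennreal (indicator \<Omega> z *\<^sub>R f z)) \<in> borel_measurable borel"
    using op cont by (intro measurable_compose[OF _ measurable_ennreal] borel_measurable_continuous_on_indicator) auto
  then show m: "(\<lambda>z. ennreal (f z) * indicator \<Omega> z) \<in> borel_measurable borel"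
    by (rule measurable_cong[THEN iffD1, rotated]) (auto simp: indicator_def)
  have "(\<integral>\<^sup>+z. ennreal (f z) \<partial>lebesgue_on \<Omega>) = (\<integral>\<^sup>+z. ennreal (f z) * indicator \<Omega> z \<partial>lebesgue)"
    using op by (subst nn_integral_restrict_space) auto
  also have "\<dots> = (\<integral>\<^sup>+z. ennreal (f z) * indicator \<Omega> z \<partial>lborel)"
    using m by (subst nn_integral_completion) auto
  finally show "(\<integral>\<^sup>+z. ennreal (f z) \<partial>lebesgue_on \<Omega>) = (\<integral>\<^sup>+z. ennreal (f z) * indicator \<Omega> z \<partial>lborel)" .
qed

text \<open>
  The inequality for discs, applied in one coordinate after the other.
\<close>

lemma Bergman_inequality_bidisc:
  fixes f :: "complex ^ 2 \<Rightarrow> complex"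
  assumes ij: "i \<noteq> j" and hol: "holomorphic_sev f \<Omega>" and op: "open \<Omega>"
    and sub: "\<And>w. w $ i \<in> ball (c $ i) r \<Longrightarrow> w $ j \<in> ball (c $ j) s \<Longrightarrow> w \<in> \<Omega>"
    and z: "z $ i \<in> ball (c $ i) r" "z $ j \<in> ball (c $ j) s"
    and int: "integrable (lebesgue_on \<Omega>) (\<lambda>z. (cmod (f z))\<^sup>2)"
  shows "(cmod (f z))\<^sup>2 \<le> disc_kernel_diag r (z $ i - c $ i) * disc_kernel_diag s (z $ j - c $ j) * (L2_norm \<Omega> f)\<^sup>2"
proof -
  let ?F = "\<lambda>w. ennreal ((cmod (f w))\<^sup>2) * indicator \<Omega> w"
  let ?Dr = "disc_kernel_diag r (z $ i - c $ i)" and ?Ds = "disc_kernel_diag s (z $ j - c $ j)"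
  have cont: "continuous_on \<Omega> (\<lambda>w. (cmod (f w))\<^sup>2)"
    by (intro continuous_intros holomorphic_sev_imp_continuous_on[OF hol])
  have Fm: "?F \<in> borel_measurable borel" by (rule nn_integral_lebesgue_on_open(1)[OF op cont])
  have D: "?Dr \<ge> 0" "?Ds \<ge> 0" by (auto simp: disc_kernel_diag_def)
  have G: "(\<lambda>a. \<integral>\<^sup>+b. ?F (pair_vec i a b) \<partial>lborel) \<in> borel_measurable lborel"
  proof -
    have "(\<lambda>x. ?F (case x of (a, b) \<Rightarrow> pair_vec i a b)) \<in> borel_measurable (lborel \<Otimes>\<^sub>M lborel)"
      using pair_vec_measurable by (intro measurable_compose[OF _ Fm]) (simp add: lborel_prod)
    then show ?thesis
      using lborel.borel_measurable_nn_integral[of "\<lambda>a b. ?F (pair_vec i a b)" lborel] by (simp add: split_beta)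
  qed
  have inner: "ennreal ((cmod (f (pair_vec i a (z $ j))))\<^sup>2) \<le> ennreal ?Ds * (\<integral>\<^sup>+b. ?F (pair_vec i a b) \<partial>lborel)"
    if a: "a \<in> ball (c $ i) r" for a
  proof -
    have in\<Omega>: "pair_vec i a b \<in> \<Omega>" if "b \<in> ball (c $ j) s" for b
      using sub[of "pair_vec i a b"] a that ij by simp
    have "(\<lambda>b. f (pair_vec i a b)) holomorphic_on ball (c $ j) s"
      by (rule holomorphic_slice[OF hol]) (rule in\<Omega>)
    then have "ennreal ((cmod (f (pair_vec i a (z $ j))))\<^sup>2) \<le>
        ennreal ?Ds * (\<integral>\<^sup>+b. ennreal ((cmod (f (pair_vec i a b)))\<^sup>2) * indicator (ball (c $ j) s) b \<partial>lborel)"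
      by (rule Bergman_inequality_disc[OF _ z(2)])
    also have "\<dots> \<le> ennreal ?Ds * (\<integral>\<^sup>+b. ?F (pair_vec i a b) \<partial>lborel)"
      by (intro mult_left_mono nn_integral_mono) (auto simp: indicator_def in\<Omega>)
    finally show ?thesis .
  qed
  have "(\<lambda>a. f (pair_vec j (z $ j) a)) holomorphic_on ball (c $ i) r"
    by (rule holomorphic_slice[OF hol]) (use sub z ij in auto)
  then have "(\<lambda>a. f (pair_vec i a (z $ j))) holomorphic_on ball (c $ i) r"
    by (simp add: pair_vec_swap[OF ij])
  then have "ennreal ((cmod (f (pair_vec i (z $ i) (z $ j))))\<^sup>2) \<le>
      ennreal ?Dr * (\<integral>\<^sup>+a. ennreal ((cmod (f (pair_vec i a (z $ j))))\<^sup>2) * indicator (ball (c $ i) r) a \<partial>lborel)"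
    by (rule Bergman_inequality_disc[OF _ z(1)])
  also have "\<dots> \<le> ennreal ?Dr * (\<integral>\<^sup>+a. ennreal ?Ds * (\<integral>\<^sup>+b. ?F (pair_vec i a b) \<partial>lborel) \<partial>lborel)"
    using inner by (intro mult_left_mono nn_integral_mono) (auto simp: indicator_def)
  also have "\<dots> = ennreal ?Dr * (ennreal ?Ds * (\<integral>\<^sup>+w. ?F w \<partial>lborel))"
    unfolding nn_integral_cmult[OF G] nn_integral_pair_vec[OF Fm, of i] ..
  also have "(\<integral>\<^sup>+w. ?F w \<partial>lborel) = ennreal ((L2_norm \<Omega> f)\<^sup>2)"
    unfolding nn_integral_lebesgue_on_open(2)[OF op cont, symmetric] L2_norm_power2
    by (rule nn_integral_eq_integral[OF int]) auto
  also have "ennreal ?Dr * (ennreal ?Ds * ennreal ((L2_norm \<Omega> f)\<^sup>2)) = ennreal (?Dr * ?Ds * (L2_norm \<Omega> f)\<^sup>2)"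
    using D by (simp add: ennreal_mult' mult.assoc)
  finally show ?thesis
    using D by (simp add: pair_vec_eta[OF ij])
qed

section \<open>The Bergman space as a Hilbert space\<close>

text \<open>
  Fatou's lemma.
\<close>

lemma L2_space_limit:
  assumes h: "\<And>m. h m \<in> L2_space \<Omega>" and \<Omega>: "\<Omega> \<in> sets lebesgue"
    and lim: "\<And>z. z \<in> \<Omega> \<Longrightarrow> (\<lambda>m. h m z) \<longlonglongrightarrow> g z"
    and bd: "\<And>m. L2_norm \<Omega> (h m) \<le> C"
  shows "g \<in> L2_space \<Omega>" "L2_norm \<Omega> g \<le> C"
proof -
  let ?M = "lebesgue_on \<Omega>"
  have sp: "space ?M = \<Omega>" by (simp add: space_restrict_space)
  have hm[measurable]: "h m \<in> borel_measurable ?M" for m using h by (simp add: L2_space_def)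
  have gm[measurable]: "g \<in> borel_measurable ?M"
    by (rule borel_measurable_LIMSEQ_metric[OF hm]) (use lim sp in auto)
  have C: "C \<ge> 0" using bd[of 0] L2_norm_nonneg order_trans by blast
  have "(\<integral>\<^sup>+z. ennreal ((cmod (g z))\<^sup>2) \<partial>?M) = (\<integral>\<^sup>+z. liminf (\<lambda>m. ennreal ((cmod (h m z))\<^sup>2)) \<partial>?M)"
  proof (rule nn_integral_cong)
    fix z assume "z \<in> space ?M"
    then have "(\<lambda>m. ennreal ((cmod (h m z))\<^sup>2)) \<longlonglongrightarrow> ennreal ((cmod (g z))\<^sup>2)"
      using lim sp by (intro tendsto_ennrealI tendsto_intros) auto
    then show "ennreal ((cmod (g z))\<^sup>2) = liminf (\<lambda>m. ennreal ((cmod (h m z))\<^sup>2))"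
      using lim_imp_Liminf[OF sequentially_bot] by metis
  qed
  also have "\<dots> \<le> liminf (\<lambda>m. \<integral>\<^sup>+z. ennreal ((cmod (h m z))\<^sup>2) \<partial>?M)"
    by (rule nn_integral_liminf) measurable
  also have "\<dots> \<le> liminf (\<lambda>m. ennreal (C\<^sup>2))"
  proof (rule Liminf_mono, rule always_eventually, rule allI)
    fix m
    have "(\<integral>\<^sup>+z. ennreal ((cmod (h m z))\<^sup>2) \<partial>?M) = ennreal ((L2_norm \<Omega> (h m))\<^sup>2)"
      unfolding L2_norm_power2 by (rule nn_integral_eq_integral[OF L2_space_integrable[OF h]]) auto
    also have "\<dots> \<le> ennreal (C\<^sup>2)" using bd L2_norm_nonneg by (intro ennreal_leI power_mono) auto
    finally show "(\<integral>\<^sup>+z. ennreal ((cmod (h m z))\<^sup>2) \<partial>?M) \<le> ennreal (C\<^sup>2)" .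
  qed
  also have "\<dots> = ennreal (C\<^sup>2)" by (simp add: Liminf_const)
  finally have le: "(\<integral>\<^sup>+z. ennreal ((cmod (g z))\<^sup>2) \<partial>?M) \<le> ennreal (C\<^sup>2)" .
  have int: "integrable ?M (\<lambda>z. (cmod (g z))\<^sup>2)"
    by (rule integrableI_nonneg) (use le in \<open>auto simp: top.extremum_strict intro: le_less_trans\<close>)
  then show "g \<in> L2_space \<Omega>" by (intro L2_spaceI gm)
  have "ennreal ((L2_norm \<Omega> g)\<^sup>2) \<le> ennreal (C\<^sup>2)"
    using le unfolding L2_norm_power2 nn_integral_eq_integral[OF int, simplified] .
  then have "(L2_norm \<Omega> g)\<^sup>2 \<le> C\<^sup>2" by (simp add: ennreal_le_iff)
  then show "L2_norm \<Omega> g \<le> C" using C by (rule power2_le_imp_le)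
qed

locale bounded_open =
  fixes \<Omega> :: "(complex ^ 2) set"
  assumes open_domain: "open \<Omega>" and bounded_domain: "bounded \<Omega>"
begin

lemma domain_lebesgue: "\<Omega> \<in> sets lebesgue"
  using open_domain by simp

lemma space_domain [simp]: "space (lebesgue_on \<Omega>) = \<Omega>"
  by (simp add: space_restrict_space)

lemma finite_measure_domain: "finite_measure (lebesgue_on \<Omega>)"
  using emeasure_bounded_finite[OF bounded_domain] open_domain
  by (intro finite_measureI) (auto simp: emeasure_restrict_space)

lemma measurable_domainI:
  fixes f :: "complex ^ 2 \<Rightarrow> complex"
  shows "continuous_on \<Omega> f \<Longrightarrow> f \<in> borel_measurable (lebesgue_on \<Omega>)"
  by (rule continuous_imp_measurable_on_sets_lebesgue[OF _ domain_lebesgue])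

lemma bounded_on_domain:
  fixes h :: "complex ^ 2 \<Rightarrow> complex"
  assumes "continuous_on (closure \<Omega>) h"
  obtains B where "B \<ge> 0" "\<And>w. w \<in> closure \<Omega> \<Longrightarrow> cmod (h w) \<le> B"
proof -
  have "compact (closure \<Omega>)" using bounded_domain by (simp add: compact_closure)
  from continuous_on_compact_bound[OF assms this] show ?thesis using that by blast
qed

lemma bergman_space_holomorphic: "f \<in> bergman_space \<Omega> \<Longrightarrow> holomorphic_sev f \<Omega>"
  and bergman_space_zero: "f \<in> bergman_space \<Omega> \<Longrightarrow> z \<notin> \<Omega> \<Longrightarrow> f z = 0"
  by (simp_all add: bergman_space_def)

lemma bergman_space_L2: "f \<in> bergman_space \<Omega> \<Longrightarrow> f \<in> L2_space \<Omega>"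
  using measurable_domainI holomorphic_sev_imp_continuous_on
  by (auto simp: bergman_space_def L2_space_def)

lemma bergman_spaceI:
  "holomorphic_sev f \<Omega> \<Longrightarrow> f \<in> L2_space \<Omega> \<Longrightarrow> (\<And>z. z \<notin> \<Omega> \<Longrightarrow> f z = 0) \<Longrightarrow> f \<in> bergman_space \<Omega>"
  by (simp add: bergman_space_def L2_space_def)

lemma bergman_space_lincomb:
  assumes "f \<in> bergman_space \<Omega>" "g \<in> bergman_space \<Omega>"
  shows "(\<lambda>z. a * f z + b * g z) \<in> bergman_space \<Omega>"
proof (rule bergman_spaceI)
  show "holomorphic_sev (\<lambda>z. a * f z + b * g z) \<Omega>"
    by (intro holomorphic_sev_add holomorphic_sev_mult holomorphic_sev_const bergman_space_holomorphic assms)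
  show "(\<lambda>z. a * f z + b * g z) \<in> L2_space \<Omega>"
    by (intro L2_space_lincomb bergman_space_L2 assms)
qed (simp add: bergman_space_zero[OF assms(1)] bergman_space_zero[OF assms(2)])

lemma bergman_space_diff:
  "f \<in> bergman_space \<Omega> \<Longrightarrow> g \<in> bergman_space \<Omega> \<Longrightarrow> (\<lambda>z. f z - g z) \<in> bergman_space \<Omega>"
  using bergman_space_lincomb[where a = 1 and b = "-1"] by force

lemma bergman_space_mult:
  assumes "holomorphic_sev h \<Omega>" "\<And>z. z \<in> \<Omega> \<Longrightarrow> cmod (h z) \<le> B" "f \<in> bergman_space \<Omega>"
  shows "(\<lambda>z. h z * f z) \<in> bergman_space \<Omega>"
proof (rule bergman_spaceI)
  show "(\<lambda>z. h z * f z) \<in> L2_space \<Omega>"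
    by (rule L2_space_bounded_mult(1)[OF bergman_space_L2[OF assms(3)] _ assms(2) domain_lebesgue])
       (intro measurable_domainI holomorphic_sev_imp_continuous_on assms)
  show "holomorphic_sev (\<lambda>z. h z * f z) \<Omega>"
    by (intro holomorphic_sev_mult bergman_space_holomorphic assms)
qed (simp add: bergman_space_zero[OF assms(3)])

lemma bergman_space_bounded:
  assumes "holomorphic_sev h \<Omega>" "\<And>z. z \<in> \<Omega> \<Longrightarrow> cmod (h z) \<le> B"
  shows "(\<lambda>z. if z \<in> \<Omega> then h z else 0) \<in> bergman_space \<Omega>"
proof -
  have "(\<lambda>z. if z \<in> \<Omega> then 1 else 0) \<in> bergman_space \<Omega>"
  proof (rule bergman_spaceI)
    show "holomorphic_sev (\<lambda>z. if z \<in> \<Omega> then 1 else 0) \<Omega>"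
      by (rule holomorphic_sev_transform[OF holomorphic_sev_const[of 1] open_domain]) auto
    show "(\<lambda>z. if z \<in> \<Omega> then 1 else 0) \<in> L2_space \<Omega>"
    proof (rule L2_spaceI)
      show *: "(\<lambda>z. if z \<in> \<Omega> then 1 else 0 :: complex) \<in> borel_measurable (lebesgue_on \<Omega>)"
        by (rule measurable_domainI) (auto cong: continuous_on_cong)
      show "integrable (lebesgue_on \<Omega>) (\<lambda>z. (cmod (if z \<in> \<Omega> then 1 else 0))\<^sup>2)"
        by (rule finite_measure.integrable_const_bound[OF finite_measure_domain, where B = 1])
           (use * in auto)
    qed
  qed auto
  from bergman_space_mult[OF assms this] show ?thesis
    by (simp add: if_distrib[of "(*) (h _)"] cong: if_cong)
qed

lemma bergman_space_pointwise_bound: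
  assumes z: "z \<in> \<Omega>"
  obtains r C where "r > 0" "C \<ge> 0" "ball z (2 * r) \<subseteq> \<Omega>"
    "\<And>f w. f \<in> bergman_space \<Omega> \<Longrightarrow> w \<in> ball z (2 * r) \<Longrightarrow> cmod (f w) \<le> C * L2_norm \<Omega> f"
proof -
  obtain \<rho> where \<rho>: "\<rho> > 0" "ball z \<rho> \<subseteq> \<Omega>" using z open_domain open_contains_ball by blast
  define s where "s = \<rho> / 4"
  have s: "s > 0" using \<rho> by (simp add: s_def)
  have near: "u \<in> \<Omega>" if w: "w \<in> ball z (2 * s)" and u: "u $ 1 \<in> ball (w $ 1) s" "u $ 2 \<in> ball (w $ 2) s" for u w
  proof -
    have "norm (w - u) \<le> (\<Sum>k\<in>UNIV. cmod ((w - u) $ k))"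
      unfolding norm_vec_def by (rule L2_set_le_sum) auto
    also have "\<dots> < 2 * s" using u by (simp add: sum_2 dist_norm)
    finally have "dist z u < 2 * s + 2 * s"
      using w dist_triangle[of z u w] by (simp add: dist_norm)
    then show ?thesis using \<rho> by (auto simp: s_def)
  qed
  have "cmod (f w) \<le> disc_kernel_diag s 0 * L2_norm \<Omega> f"
    if f: "f \<in> bergman_space \<Omega>" and w: "w \<in> ball z (2 * s)" for f w
  proof (rule power2_le_imp_le)
    have "(cmod (f w))\<^sup>2 \<le> disc_kernel_diag s (w $ 1 - w $ 1) * disc_kernel_diag s (w $ 2 - w $ 2) * (L2_norm \<Omega> f)\<^sup>2"
      by (rule Bergman_inequality_bidisc[OF _ bergman_space_holomorphic[OF f] open_domain])
         (use near[OF w] s L2_space_integrable[OF bergman_space_L2[OF f]] in auto)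
    then show "(cmod (f w))\<^sup>2 \<le> (disc_kernel_diag s 0 * L2_norm \<Omega> f)\<^sup>2"
      by (simp add: power_mult_distrib power2_eq_square[of "disc_kernel_diag s 0"])
  qed (use s in \<open>auto intro!: mult_nonneg_nonneg L2_norm_nonneg less_imp_le[OF disc_kernel_diag_pos]\<close>)
  moreover have "ball z (2 * s) \<subseteq> \<Omega>" using \<rho> by (auto simp: s_def)
  ultimately show ?thesis
    using that[of s "disc_kernel_diag s 0"] s disc_kernel_diag_pos[of 0 s] by auto
qed

text \<open>
  By the pointwise bounds a Cauchy sequence converges locally uniformly, so the limit is
  holomorphic; Fatou's lemma, applied to the differences, gives convergence in norm.
\<close>

lemma bergman_space_complete:
  assumes f: "\<And>n. f n \<in> bergman_space \<Omega>"
    and Cauchy: "\<And>e. e > 0 \<Longrightarrow> \<exists>N. \<forall>m\<ge>N. \<forall>n\<ge>N. L2_norm \<Omega> (\<lambda>z. f m z - f n z) < e"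
  obtains g where "g \<in> bergman_space \<Omega>" "(\<lambda>n. L2_norm \<Omega> (\<lambda>z. f n z - g z)) \<longlonglongrightarrow> 0"
proof -
  have unif: "\<exists>r>0. ball z r \<subseteq> \<Omega> \<and> uniformly_Cauchy_on (ball z r) f" if z: "z \<in> \<Omega>" for z
  proof -
    obtain r C where r: "r > 0" "C \<ge> 0" "ball z (2 * r) \<subseteq> \<Omega>"
      and C: "\<And>f w. f \<in> bergman_space \<Omega> \<Longrightarrow> w \<in> ball z (2 * r) \<Longrightarrow> cmod (f w) \<le> C * L2_norm \<Omega> f"
      using bergman_space_pointwise_bound[OF z] by metis
    have "uniformly_Cauchy_on (ball z (2 * r)) f"
      unfolding uniformly_Cauchy_on_def
    proof (intro allI impI)
      fix e :: real assume e: "e > 0"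
      have "e / (C + 1) > 0" using e r by simp
      then obtain N where N: "\<And>m n. m \<ge> N \<Longrightarrow> n \<ge> N \<Longrightarrow> L2_norm \<Omega> (\<lambda>z. f m z - f n z) < e / (C + 1)"
        using Cauchy by blast
      show "\<exists>M. \<forall>w\<in>ball z (2 * r). \<forall>m\<ge>M. \<forall>n\<ge>M. dist (f m w) (f n w) < e"
      proof (intro exI[of _ N] ballI allI impI)
        fix w m n assume w: "w \<in> ball z (2 * r)" and mn: "m \<ge> N" "n \<ge> N"
        have "cmod (f m w - f n w) \<le> C * L2_norm \<Omega> (\<lambda>z. f m z - f n z)"
          using C[OF bergman_space_diff[OF f f] w] .
        also have "\<dots> \<le> C * (e / (C + 1))" using N[OF mn] r by (intro mult_left_mono) auto
        also have "\<dots> < e" using e r by (simp add: field_simps)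
        finally show "dist (f m w) (f n w) < e" by (simp add: dist_norm)
      qed
    qed
    then show ?thesis using r by (intro exI[of _ "2 * r"]) auto
  qed
  define g where "g z = lim (\<lambda>n. f n z)" for z
  have lim: "(\<lambda>n. f n z) \<longlonglongrightarrow> g z" if "z \<in> \<Omega>" for z
  proof -
    obtain r where r: "r > 0" "uniformly_Cauchy_on (ball z r) f" using unif[OF \<open>z \<in> \<Omega>\<close>] by blast
    have "Cauchy (\<lambda>n. f n z)"
      unfolding Cauchy_def
    proof (intro allI impI)
      fix e :: real assume "e > 0"
      then obtain M where "\<forall>x\<in>ball z r. \<forall>m\<ge>M. \<forall>n\<ge>M. dist (f m x) (f n x) < e"
        using r(2) unfolding uniformly_Cauchy_on_def by blast
      then show "\<exists>M. \<forall>m\<ge>M. \<forall>n\<ge>M. dist (f m z) (f n z) < e"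
        using r(1) by (intro exI[of _ M]) auto
    qed
    then have "convergent (\<lambda>n. f n z)" by (rule Cauchy_convergent)
    then show ?thesis by (simp add: g_def convergent_LIMSEQ_iff)
  qed
  have close: "\<exists>N. \<forall>n\<ge>N. (\<lambda>z. f n z - g z) \<in> L2_space \<Omega> \<and> L2_norm \<Omega> (\<lambda>z. f n z - g z) \<le> e" if e: "e > 0" for e
  proof -
    obtain N where N: "\<And>m n. m \<ge> N \<Longrightarrow> n \<ge> N \<Longrightarrow> L2_norm \<Omega> (\<lambda>z. f m z - f n z) < e"
      using Cauchy[OF e] by blast
    have "(\<lambda>z. f n z - g z) \<in> L2_space \<Omega> \<and> L2_norm \<Omega> (\<lambda>z. f n z - g z) \<le> e" if "n \<ge> N" for n
    proof -
      have "(\<lambda>m. f n z - f (m + N) z) \<longlonglongrightarrow> f n z - g z" if "z \<in> \<Omega>" for z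
        by (intro tendsto_diff tendsto_const LIMSEQ_ignore_initial_segment lim that)
      then show ?thesis
        using L2_space_limit[of "\<lambda>m z. f n z - f (m + N) z" \<Omega> "\<lambda>z. f n z - g z" e]
          L2_space_diff[OF bergman_space_L2[OF f] bergman_space_L2[OF f]] domain_lebesgue
          less_imp_le[OF N[OF that]] by auto
    qed
    then show ?thesis by blast
  qed
  obtain N where "(\<lambda>z. f N z - g z) \<in> L2_space \<Omega>" using close[of 1] by auto
  from L2_space_diff[OF bergman_space_L2[OF f[of N]] this] have gL2: "g \<in> L2_space \<Omega>" by simp
  have "g \<in> bergman_space \<Omega>"
  proof (rule bergman_spaceI[OF _ gL2])
    show "holomorphic_sev g \<Omega>"
      by (rule holomorphic_sev_uniform_limit[OF bergman_space_holomorphic[OF f] unif lim])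
    show "g z = 0" if "z \<notin> \<Omega>" for z using bergman_space_zero[OF f that] by (simp add: g_def)
  qed
  moreover have "(\<lambda>n. L2_norm \<Omega> (\<lambda>z. f n z - g z)) \<longlonglongrightarrow> 0"
  proof (rule LIMSEQ_I)
    fix e :: real assume "e > 0"
    then obtain N where "\<forall>n\<ge>N. L2_norm \<Omega> (\<lambda>z. f n z - g z) \<le> e / 2" using close[of "e / 2"] by auto
    then show "\<exists>N. \<forall>n\<ge>N. norm (L2_norm \<Omega> (\<lambda>z. f n z - g z) - 0) < e"
      using \<open>e > 0\<close> by (intro exI[of _ N]) (force simp: abs_of_nonneg[OF L2_norm_nonneg])
  qed
  ultimately show ?thesis using that by blast
qed

lemma L2_norm_triangle_reverse:
  assumes "f \<in> L2_space \<Omega>" "g \<in> L2_space \<Omega>"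
  shows "\<bar>L2_norm \<Omega> f - L2_norm \<Omega> g\<bar> \<le> L2_norm \<Omega> (\<lambda>z. f z - g z)"
  using L2_norm_triangle[OF L2_space_diff[OF assms] assms(2)]
    L2_norm_triangle[OF L2_space_diff[OF assms(2,1)] assms(1)] L2_norm_minus_commute[of \<Omega> f g] by simp

text \<open>
  The representing function minimizes \<open>(L2_norm h)\<^sup>2 - 2 * Re (l h)\<close>; a minimizing sequence is Cauchy
  by the parallelogram law. This yields the kernel (for evaluation at a point) and the orthogonal
  projection (for the inner product with a square integrable function) alike.
\<close>

lemma bergman_space_Riesz:
  assumes lin: "\<And>f g a b. f \<in> bergman_space \<Omega> \<Longrightarrow> g \<in> bergman_space \<Omega> \<Longrightarrow>
      l (\<lambda>z. a * f z + b * g z) = a * l f + b * l g"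
    and bd: "\<And>f. f \<in> bergman_space \<Omega> \<Longrightarrow> cmod (l f) \<le> C * L2_norm \<Omega> f"
  obtains g where "g \<in> bergman_space \<Omega>" "\<And>f. f \<in> bergman_space \<Omega> \<Longrightarrow> L2_inner \<Omega> f g = l f"
proof -
  let ?V = "bergman_space \<Omega>"
  define J where "J h = (L2_norm \<Omega> h)\<^sup>2 - 2 * Re (l h)" for h
  have J_lower: "J h \<ge> - C\<^sup>2" if "h \<in> ?V" for h
  proof -
    have "Re (l h) \<le> C * L2_norm \<Omega> h" using bd[OF that] complex_Re_le_cmod order_trans by blast
    moreover have "0 \<le> (L2_norm \<Omega> h - C)\<^sup>2" by simp
    ultimately show ?thesis by (simp add: J_def power2_diff algebra_simps)
  qed
  define m where "m = Inf (J ` ?V)"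
  have bdd: "bdd_below (J ` ?V)" using J_lower by (intro bdd_belowI[of _ "- C\<^sup>2"]) auto
  have zero: "(\<lambda>z. 0) \<in> ?V"
    using bergman_space_bounded[OF holomorphic_sev_const[of 0], of 0] by simp
  have m_le: "m \<le> J h" if "h \<in> ?V" for h
    unfolding m_def using bdd that by (intro cInf_lower) auto
  have "\<exists>h. h \<in> ?V \<and> J h < m + 1 / real (Suc n)" for n
    using cInf_lessD[of "J ` ?V" "m + 1 / real (Suc n)"] zero by (auto simp: m_def)
  then obtain h where h: "\<And>n. h n \<in> ?V" and Jh: "\<And>n. J (h n) < m + 1 / real (Suc n)" by metis
  have par: "(L2_norm \<Omega> (\<lambda>z. f z - g z))\<^sup>2 \<le> 2 * (J f - m) + 2 * (J g - m)" if fg: "f \<in> ?V" "g \<in> ?V" for f g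
  proof -
    note L = bergman_space_L2[OF fg(1)] bergman_space_L2[OF fg(2)]
    have "m \<le> J (\<lambda>z. 1 / 2 * f z + 1 / 2 * g z)" by (rule m_le[OF bergman_space_lincomb[OF fg]])
    also have "\<dots> = (L2_norm \<Omega> (\<lambda>z. 1 / 2 * (f z + 1 * g z)))\<^sup>2 - Re (l f) - Re (l g)"
      unfolding J_def lin[OF fg] by (simp add: distrib_left)
    also have "(L2_norm \<Omega> (\<lambda>z. 1 / 2 * (f z + 1 * g z)))\<^sup>2 = (L2_norm \<Omega> (\<lambda>z. f z + 1 * g z))\<^sup>2 / 4"
      unfolding L2_norm_cmult by (simp add: power_divide)
    finally have "4 * m \<le> (L2_norm \<Omega> (\<lambda>z. f z + 1 * g z))\<^sup>2 - 4 * Re (l f) - 4 * Re (l g)" by simp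
    then show ?thesis
      unfolding L2_norm_diff_power2[OF L] L2_norm_lincomb_power2[OF L] by (simp add: J_def)
  qed
  have Cauchy: "\<exists>N. \<forall>j\<ge>N. \<forall>k\<ge>N. L2_norm \<Omega> (\<lambda>z. h j z - h k z) < e" if e: "e > 0" for e
  proof -
    obtain N where N: "4 / e\<^sup>2 < real N" using reals_Archimedean2 by blast
    have "L2_norm \<Omega> (\<lambda>z. h j z - h k z) < e" if "j \<ge> N" "k \<ge> N" for j k
    proof -
      have N0: "real N > 0" using N e by (meson divide_pos_pos less_trans zero_less_numeral zero_less_power)
      have "1 / real (Suc i) \<le> 1 / real N" if "i \<ge> N" for i using that N0 by (intro divide_left_mono) auto
      then have J: "J (h i) - m \<le> 1 / real N" if "i \<ge> N" for i using Jh[of i] that by fastforce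
      have "(L2_norm \<Omega> (\<lambda>z. h j z - h k z))\<^sup>2 \<le> 2 * (J (h j) - m) + 2 * (J (h k) - m)" by (rule par[OF h h])
      also have "\<dots> \<le> 4 / real N" using J[OF that(1)] J[OF that(2)] by simp
      also have "\<dots> < e\<^sup>2" using N N0 e by (simp add: field_simps)
      finally show ?thesis using e by (simp add: power_less_imp_less_base)
    qed
    then show ?thesis by blast
  qed
  obtain g where g: "g \<in> ?V" and lim: "(\<lambda>n. L2_norm \<Omega> (\<lambda>z. h n z - g z)) \<longlonglongrightarrow> 0"
    using bergman_space_complete[OF h Cauchy] by blast
  have "(\<lambda>n. L2_norm \<Omega> (h n)) \<longlonglongrightarrow> L2_norm \<Omega> g"
    by (rule LIM_zero_cancel, rule Lim_null_comparison[OF _ lim])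
       (use L2_norm_triangle_reverse[OF bergman_space_L2[OF h] bergman_space_L2[OF g]] in auto)
  moreover have "(\<lambda>n. l (h n)) \<longlonglongrightarrow> l g"
  proof (rule LIM_zero_cancel, rule Lim_null_comparison)
    have "l (h n) - l g = l (\<lambda>z. h n z - g z)" for n using lin[OF h[of n] g, of 1 "-1"] by simp
    then show "\<forall>\<^sub>F n in sequentially. norm (l (h n) - l g) \<le> C * L2_norm \<Omega> (\<lambda>z. h n z - g z)"
      using bd[OF bergman_space_diff[OF h g]] by simp
    show "(\<lambda>n. C * L2_norm \<Omega> (\<lambda>z. h n z - g z)) \<longlonglongrightarrow> 0" using tendsto_mult_right_zero[OF lim] .
  qed
  ultimately have "(\<lambda>n. J (h n)) \<longlonglongrightarrow> J g" unfolding J_def by (intro tendsto_intros)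
  moreover have "(\<lambda>n. m + 1 / real (Suc n)) \<longlonglongrightarrow> m + 0" by (intro tendsto_add tendsto_const LIMSEQ_Suc lim_1_over_n)
  ultimately have Jg: "J g \<le> m" using Jh by (intro LIMSEQ_le[of "\<lambda>n. J (h n)" _ "\<lambda>n. m + 1 / real (Suc n)"]) (auto intro: less_imp_le)
  have "L2_inner \<Omega> f g = l f" if f: "f \<in> ?V" for f
  proof (rule ccontr)
    assume ne: "L2_inner \<Omega> f g \<noteq> l f"
    define d where "d = l f - L2_inner \<Omega> f g"
    have d: "(cmod d)\<^sup>2 > 0" using ne by (simp add: d_def)
    \<comment> \<open>A step in the direction \<open>cnj d\<close> so short that the linear term outweighs the quadratic one.\<close>
    define t where "t = 1 / ((L2_norm \<Omega> f)\<^sup>2 + 1)"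
    have t: "t > 0" "t * (L2_norm \<Omega> f)\<^sup>2 < 1" by (simp_all add: t_def add_nonneg_pos divide_less_eq)
    let ?b = "of_real t * cnj d"
    have gf: "(\<lambda>z. g z + ?b * f z) \<in> ?V" using bergman_space_lincomb[OF g f, of 1 ?b] by simp
    have "J g \<le> J (\<lambda>z. g z + ?b * f z)" using Jg m_le[OF gf] by simp
    also have "\<dots> = (L2_norm \<Omega> g)\<^sup>2 + (cmod ?b)\<^sup>2 * (L2_norm \<Omega> f)\<^sup>2 + 2 * Re (cnj ?b * L2_inner \<Omega> g f)
        - 2 * Re (l g + ?b * l f)"
      unfolding J_def L2_norm_lincomb_power2[OF bergman_space_L2[OF g] bergman_space_L2[OF f]]
      using lin[OF g f, of 1 ?b] by simp
    also have "Re (cnj ?b * L2_inner \<Omega> g f) = Re (?b * L2_inner \<Omega> f g)"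
      using complex_cnj_mult[of ?b "L2_inner \<Omega> f g"] L2_inner_cnj[of \<Omega> f g] by (metis cnj.sel(1))
    finally have "2 * Re (?b * d) \<le> (cmod ?b)\<^sup>2 * (L2_norm \<Omega> f)\<^sup>2"
      by (simp add: J_def d_def right_diff_distrib)
    moreover have "?b * d = of_real (t * (cmod d)\<^sup>2)"
      using complex_norm_square[of d] by (simp add: mult_ac)
    ultimately have "2 * (t * (cmod d)\<^sup>2) \<le> t\<^sup>2 * (cmod d)\<^sup>2 * (L2_norm \<Omega> f)\<^sup>2"
      using t by (simp add: norm_mult power_mult_distrib)
    then have "(t * (cmod d)\<^sup>2) * 2 \<le> (t * (cmod d)\<^sup>2) * (t * (L2_norm \<Omega> f)\<^sup>2)"
      by (simp add: power2_eq_square mult_ac)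
    then have "2 \<le> t * (L2_norm \<Omega> f)\<^sup>2" using t d by (subst (asm) mult_le_cancel_left_pos) auto
    then show False using t by simp
  qed
  then show ?thesis using that g by blast
qed

lemma bergman_space_norm_zero:
  assumes f: "f \<in> bergman_space \<Omega>" and "L2_norm \<Omega> f = 0"
  shows "f = (\<lambda>z. 0)"
proof
  fix z
  show "f z = 0"
  proof (cases "z \<in> \<Omega>")
    case True
    then obtain r C where "r > 0" "\<And>f w. f \<in> bergman_space \<Omega> \<Longrightarrow> w \<in> ball z (2 * r) \<Longrightarrow> cmod (f w) \<le> C * L2_norm \<Omega> f"
      using bergman_space_pointwise_bound by metis
    from this(2)[OF f, of z] this(1) assms(2) show ?thesis by simp
  qed (simp add: bergman_space_zero[OF f])
qed

lemma bergman_space_eqI: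
  assumes "f \<in> bergman_space \<Omega>" "g \<in> bergman_space \<Omega>"
    and "\<And>h. h \<in> bergman_space \<Omega> \<Longrightarrow> L2_inner \<Omega> h f = L2_inner \<Omega> h g"
  shows "f = g"
proof -
  let ?d = "\<lambda>z. f z - g z"
  have d: "?d \<in> bergman_space \<Omega>" by (rule bergman_space_diff[OF assms(1,2)])
  have "L2_inner \<Omega> ?d ?d = 0"
    using L2_inner_diff_right[OF assms(1,2)[THEN bergman_space_L2] bergman_space_L2[OF d]] assms(3)[OF d] by simp
  then have "L2_norm \<Omega> ?d = 0" by (simp add: L2_inner_self)
  from bergman_space_norm_zero[OF d this] show ?thesis by (metis eq_iff_diff_eq_0 ext)
qed

lemma bergman_kernel:
  assumes z: "z \<in> \<Omega>"
  shows "(\<lambda>w. bergman_kernel \<Omega> w z) \<in> bergman_space \<Omega>"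
    and "f \<in> bergman_space \<Omega> \<Longrightarrow> L2_inner \<Omega> f (\<lambda>w. bergman_kernel \<Omega> w z) = f z"
proof -
  obtain r C where r: "r > 0" and C: "\<And>f w. f \<in> bergman_space \<Omega> \<Longrightarrow> w \<in> ball z (2 * r) \<Longrightarrow> cmod (f w) \<le> C * L2_norm \<Omega> f"
    using bergman_space_pointwise_bound[OF z] by metis
  obtain k where k: "k \<in> bergman_space \<Omega>" "\<And>f. f \<in> bergman_space \<Omega> \<Longrightarrow> L2_inner \<Omega> f k = f z"
    using bergman_space_Riesz[of "\<lambda>f. f z" C] C r by auto
  have "(THE k. k \<in> bergman_space \<Omega> \<and> (\<forall>f\<in>bergman_space \<Omega>. L2_inner \<Omega> f k = f z)) = k"
    by (rule the_equality) (use k bergman_space_eqI in auto)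
  then have "(\<lambda>w. bergman_kernel \<Omega> w z) = k" by (simp add: bergman_kernel_def fun_eq_iff)
  then show "(\<lambda>w. bergman_kernel \<Omega> w z) \<in> bergman_space \<Omega>"
    "f \<in> bergman_space \<Omega> \<Longrightarrow> L2_inner \<Omega> f (\<lambda>w. bergman_kernel \<Omega> w z) = f z" using k by auto
qed

lemma bergman_proj:
  assumes f: "f \<in> L2_space \<Omega>"
  shows "bergman_proj \<Omega> f \<in> bergman_space \<Omega>"
    and "h \<in> bergman_space \<Omega> \<Longrightarrow> L2_inner \<Omega> (bergman_proj \<Omega> f) h = L2_inner \<Omega> f h"
proof -
  obtain g where g: "g \<in> bergman_space \<Omega>" "\<And>h. h \<in> bergman_space \<Omega> \<Longrightarrow> L2_inner \<Omega> h g = L2_inner \<Omega> h f"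
  proof (rule bergman_space_Riesz[of "\<lambda>h. L2_inner \<Omega> h f" "L2_norm \<Omega> f"])
    show "L2_inner \<Omega> (\<lambda>z. a * u z + b * v z) f = a * L2_inner \<Omega> u f + b * L2_inner \<Omega> v f"
      if "u \<in> bergman_space \<Omega>" "v \<in> bergman_space \<Omega>" for u v a b
      by (rule L2_inner_lincomb_left[OF that[THEN bergman_space_L2] f])
    show "cmod (L2_inner \<Omega> h f) \<le> L2_norm \<Omega> f * L2_norm \<Omega> h" if "h \<in> bergman_space \<Omega>" for h
      using L2_Cauchy_Schwarz[OF bergman_space_L2[OF that] f] by (simp add: mult.commute)
  qed (use that in blast)
  have orth: "L2_inner \<Omega> (\<lambda>z. f z - u z) h = 0 \<longleftrightarrow> L2_inner \<Omega> h u = L2_inner \<Omega> h f"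
    if "u \<in> bergman_space \<Omega>" "h \<in> bergman_space \<Omega>" for u h
    using L2_inner_diff_left[OF f that[THEN bergman_space_L2]] L2_inner_cnj[of \<Omega> h] complex_cnj_cancel_iff
    by (metis eq_iff_diff_eq_0)
  have "(THE g. g \<in> bergman_space \<Omega> \<and> (\<forall>h\<in>bergman_space \<Omega>. L2_inner \<Omega> (\<lambda>z. f z - g z) h = 0)) = g"
    by (rule the_equality) (use g orth bergman_space_eqI in auto)
  then have P: "bergman_proj \<Omega> f = g" by (simp add: bergman_proj_def)
  then show "bergman_proj \<Omega> f \<in> bergman_space \<Omega>" using g by simp
  show "L2_inner \<Omega> (bergman_proj \<Omega> f) h = L2_inner \<Omega> f h" if "h \<in> bergman_space \<Omega>"
    using arg_cong[OF g(2)[OF that], of cnj] by (simp add: P L2_inner_cnj)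
qed

lemma bergman_proj_norm_le:
  assumes "f \<in> L2_space \<Omega>"
  shows "L2_norm \<Omega> (bergman_proj \<Omega> f) \<le> L2_norm \<Omega> f"
proof (cases "L2_norm \<Omega> (bergman_proj \<Omega> f) = 0")
  case False
  let ?g = "bergman_proj \<Omega> f"
  have "of_real ((L2_norm \<Omega> ?g)\<^sup>2) = L2_inner \<Omega> f ?g"
    using bergman_proj[OF assms] by (simp add: L2_inner_self[symmetric] del: of_real_power)
  then have "(L2_norm \<Omega> ?g)\<^sup>2 = cmod (L2_inner \<Omega> f ?g)"
    by (metis abs_of_nonneg norm_of_real zero_le_power2)
  also have "\<dots> \<le> L2_norm \<Omega> f * L2_norm \<Omega> ?g"
    by (rule L2_Cauchy_Schwarz[OF assms bergman_space_L2[OF bergman_proj(1)[OF assms]]])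
  finally show ?thesis using False L2_norm_nonneg[of \<Omega> ?g] by (simp add: power2_eq_square)
qed (simp add: L2_norm_nonneg)

lemma bergman_proj_lincomb:
  assumes "f \<in> L2_space \<Omega>" "g \<in> L2_space \<Omega>"
  shows "bergman_proj \<Omega> (\<lambda>z. a * f z + b * g z) = (\<lambda>z. a * bergman_proj \<Omega> f z + b * bergman_proj \<Omega> g z)"
proof (rule bergman_space_eqI)
  note P = bergman_proj(1)[OF assms(1)] bergman_proj(1)[OF assms(2)]
  note L = L2_space_lincomb[OF assms, of a b]
  show "bergman_proj \<Omega> (\<lambda>z. a * f z + b * g z) \<in> bergman_space \<Omega>" by (rule bergman_proj(1)[OF L])
  show "(\<lambda>z. a * bergman_proj \<Omega> f z + b * bergman_proj \<Omega> g z) \<in> bergman_space \<Omega>" by (rule bergman_space_lincomb[OF P])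
  fix h assume h: "h \<in> bergman_space \<Omega>"
  have "L2_inner \<Omega> (bergman_proj \<Omega> (\<lambda>z. a * f z + b * g z)) h =
      L2_inner \<Omega> (\<lambda>z. a * bergman_proj \<Omega> f z + b * bergman_proj \<Omega> g z) h"
    unfolding bergman_proj(2)[OF L h] L2_inner_lincomb_left[OF assms bergman_space_L2[OF h]]
      L2_inner_lincomb_left[OF P[THEN bergman_space_L2] bergman_space_L2[OF h]]
    using bergman_proj(2)[OF assms(1) h] bergman_proj(2)[OF assms(2) h] by simp
  from arg_cong[OF this, of cnj]
  show "L2_inner \<Omega> h (bergman_proj \<Omega> (\<lambda>z. a * f z + b * g z)) =
      L2_inner \<Omega> h (\<lambda>z. a * bergman_proj \<Omega> f z + b * bergman_proj \<Omega> g z)"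
    by (simp add: L2_inner_cnj)
qed

subsection \<open>The normalized kernel\<close>

definition kernel_diag :: "complex ^ 2 \<Rightarrow> real" where
  "kernel_diag z = (L2_norm \<Omega> (\<lambda>w. bergman_kernel \<Omega> w z))\<^sup>2"

lemma bergman_kernel_self: "z \<in> \<Omega> \<Longrightarrow> bergman_kernel \<Omega> z z = of_real (kernel_diag z)"
  using bergman_kernel(2)[OF _ bergman_kernel(1), of z z]
  by (simp add: kernel_diag_def L2_inner_self[symmetric] del: of_real_power)

lemma kernel_diag_bound:
  assumes z: "z \<in> \<Omega>" and f: "f \<in> bergman_space \<Omega>"
  shows "(cmod (f z))\<^sup>2 \<le> kernel_diag z * (L2_norm \<Omega> f)\<^sup>2"
proof -
  have "cmod (f z) \<le> L2_norm \<Omega> f * L2_norm \<Omega> (\<lambda>w. bergman_kernel \<Omega> w z)"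
    using L2_Cauchy_Schwarz[OF f[THEN bergman_space_L2] bergman_kernel(1)[OF z, THEN bergman_space_L2]]
      bergman_kernel(2)[OF z f] by simp
  then have "(cmod (f z))\<^sup>2 \<le> (L2_norm \<Omega> f * L2_norm \<Omega> (\<lambda>w. bergman_kernel \<Omega> w z))\<^sup>2"
    by (rule power_mono) simp
  then show ?thesis by (simp add: kernel_diag_def power_mult_distrib mult.commute)
qed

lemma kernel_diag_pos:
  assumes z: "z \<in> \<Omega>" shows "kernel_diag z > 0"
proof (rule ccontr)
  assume "\<not> kernel_diag z > 0"
  then have "kernel_diag z = 0" by (simp add: kernel_diag_def)
  moreover have "(\<lambda>z. if z \<in> \<Omega> then 1 else 0) \<in> bergman_space \<Omega>"
    by (rule bergman_space_bounded[OF holomorphic_sev_const, of _ 1]) simp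
  ultimately show False using kernel_diag_bound[OF z] z by fastforce
qed

lemma normalized_kernel_eq:
  assumes z: "z \<in> \<Omega>"
  shows "normalized_kernel \<Omega> z = (\<lambda>w. of_real (1 / sqrt (kernel_diag z)) * bergman_kernel \<Omega> w z)"
  using kernel_diag_pos[OF z]
  by (simp add: fun_eq_iff normalized_kernel_def bergman_kernel_self[OF z] csqrt_of_real_nonneg less_imp_le)

lemma normalized_kernel:
  assumes z: "z \<in> \<Omega>"
  shows "normalized_kernel \<Omega> z \<in> bergman_space \<Omega>"
    and "f \<in> bergman_space \<Omega> \<Longrightarrow> L2_inner \<Omega> f (normalized_kernel \<Omega> z) = f z / of_real (sqrt (kernel_diag z))"
    and "L2_norm \<Omega> (normalized_kernel \<Omega> z) = 1"
    and "normalized_kernel \<Omega> z z = of_real (sqrt (kernel_diag z))"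
proof -
  note K = bergman_kernel(1)[OF z]
  show "normalized_kernel \<Omega> z \<in> bergman_space \<Omega>"
    unfolding normalized_kernel_eq[OF z] using bergman_space_lincomb[OF K K, of "of_real (1 / sqrt (kernel_diag z))" 0] by simp
  show "L2_inner \<Omega> f (normalized_kernel \<Omega> z) = f z / of_real (sqrt (kernel_diag z))" if f: "f \<in> bergman_space \<Omega>"
    unfolding normalized_kernel_eq[OF z]
    using L2_inner_lincomb_right[OF K[THEN bergman_space_L2] K[THEN bergman_space_L2] bergman_space_L2[OF f],
        of "of_real (1 / sqrt (kernel_diag z))" 0]
      bergman_kernel(2)[OF z f] by simp
  show "L2_norm \<Omega> (normalized_kernel \<Omega> z) = 1"
    unfolding normalized_kernel_eq[OF z] L2_norm_cmult
    using kernel_diag_pos[OF z] by (simp add: kernel_diag_def abs_of_nonneg[OF L2_norm_nonneg] norm_divide)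
  show "normalized_kernel \<Omega> z z = of_real (sqrt (kernel_diag z))"
    unfolding normalized_kernel_eq[OF z] using kernel_diag_pos[OF z]
    by (simp add: bergman_kernel_self[OF z] real_div_sqrt flip: of_real_divide of_real_mult)
qed

end

section \<open>Compactness forces the Berezin transform to vanish\<close>

definition linear_form :: "complex ^ 2 \<Rightarrow> complex ^ 2 \<Rightarrow> complex" where
  "linear_form a w = (\<Sum>k\<in>UNIV. cnj (a $ k) * w $ k)"

lemma Re_linear_form: "Re (linear_form a w) = a \<bullet> w"
  by (simp add: linear_form_def inner_vec_def inner_complex_def)

lemma holomorphic_sev_linear_form: "holomorphic_sev (linear_form a) \<Omega>"
  unfolding linear_form_def sum_2
  by (intro holomorphic_sev_add holomorphic_sev_mult holomorphic_sev_const holomorphic_sev_coord)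

lemma continuous_on_linear_form: "continuous_on S (linear_form a)"
  by (rule holomorphic_sev_imp_continuous_on[OF holomorphic_sev_linear_form])

lemma convex_open_supporting_functional:
  fixes \<Omega> :: "'a :: euclidean_space set"
  assumes conv: "convex \<Omega>" and op: "open \<Omega>" and p: "p \<in> frontier \<Omega>"
  obtains a where "a \<noteq> 0" "\<And>w. w \<in> closure \<Omega> \<Longrightarrow> a \<bullet> w \<le> a \<bullet> p" "\<And>w. w \<in> \<Omega> \<Longrightarrow> a \<bullet> w < a \<bullet> p"
proof -
  have pcl: "p \<in> closure \<Omega>" "p \<notin> \<Omega>" using p op by (auto simp: frontier_def interior_open)
  then have ne: "\<Omega> \<noteq> {}" by auto
  obtain a b where a: "a \<noteq> 0" "\<And>x. x \<in> \<Omega> \<Longrightarrow> a \<bullet> x \<le> b" "b \<le> a \<bullet> p"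
    using separating_hyperplane_sets[OF conv convex_singleton[of p] ne] pcl by auto
  have cl: "a \<bullet> w \<le> b" if "w \<in> closure \<Omega>" for w
  proof -
    have "closure \<Omega> \<subseteq> {x. a \<bullet> x \<le> b}"
      by (rule closure_minimal) (use a closed_halfspace_le in auto)
    then show ?thesis using that by auto
  qed
  have "a \<bullet> w < a \<bullet> p" if w: "w \<in> \<Omega>" for w
  proof -
    obtain e where e: "e > 0" "ball w e \<subseteq> \<Omega>" using op w open_contains_ball by blast
    let ?v = "w + (e / (2 * norm a)) *\<^sub>R a"
    have "?v \<in> \<Omega>" using e a(1) by (intro subsetD[OF e(2)]) (simp add: dist_norm)
    then have "a \<bullet> ?v \<le> b" by (rule a(2))
    moreover have "a \<bullet> ?v > a \<bullet> w" using e a(1) by (simp add: inner_add_right)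
    ultimately show ?thesis using a(3) by linarith
  qed
  moreover have "a \<bullet> w \<le> a \<bullet> p" if "w \<in> closure \<Omega>" for w using cl[OF that] a(3) by linarith
  ultimately show ?thesis using that a(1) by blast
qed

context bounded_open
begin

text \<open>
  This is weak convergence of the normalized kernels to 0. With a supporting affine function \<open>\<zeta>\<close> of
  positive real part and \<open>\<delta> = \<bar>\<zeta> (z n)\<bar>\<close>, the multiplier \<open>\<delta> / (\<zeta> + \<delta>)\<close> is bounded by 1, at least
  \<open>1 / 2\<close> in modulus at \<open>z n\<close>, and tends to 0 pointwise. So \<open>g (z n)\<close> is at most twice the value of a
  function whose norm tends to 0.
\<close>

lemma normalized_evaluation_tendsto_zero:
  assumes conv: "convex \<Omega>" and p: "p \<in> frontier \<Omega>"
    and z: "\<And>n. z n \<in> \<Omega>" and zlim: "z \<longlonglongrightarrow> p" and g: "g \<in> bergman_space \<Omega>"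
  shows "(\<lambda>n. g (z n) / of_real (sqrt (kernel_diag (z n)))) \<longlonglongrightarrow> 0"
proof -
  obtain a where a: "\<And>w. w \<in> \<Omega> \<Longrightarrow> a \<bullet> w < a \<bullet> p"
    using convex_open_supporting_functional[OF conv open_domain p] by metis
  define \<zeta> where "\<zeta> w = linear_form a p + (-1) * linear_form a w" for w
  have pos: "Re (\<zeta> w) > 0" if "w \<in> \<Omega>" for w
    using a[OF that] by (simp add: \<zeta>_def Re_linear_form)
  define \<delta> where "\<delta> n = cmod (\<zeta> (z n))" for n
  have \<delta>: "\<delta> n > 0" for n using pos[OF z[of n]] by (auto simp: \<delta>_def)
  have cont\<zeta>: "continuous_on UNIV \<zeta>"
    unfolding \<zeta>_def by (intro continuous_intros continuous_on_linear_form)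
  have "(\<lambda>n. \<zeta> (z n)) \<longlonglongrightarrow> \<zeta> p"
    using continuous_on_tendsto_compose[OF cont\<zeta> zlim] by simp
  then have \<delta>lim: "\<delta> \<longlonglongrightarrow> 0" unfolding \<delta>_def using tendsto_norm[of _ "\<zeta> p"] by (simp add: \<zeta>_def)
  \<comment> \<open>Bounded by 1 on \<open>\<Omega>\<close>, of modulus at least \<open>1 / 2\<close> at \<open>z n\<close>, and tending to 0 pointwise.\<close>
  define h where "h n w = of_real (\<delta> n) / (\<zeta> w + of_real (\<delta> n))" for n w
  have den: "\<delta> n \<le> cmod (\<zeta> w + of_real (\<delta> n))" if "w \<in> \<Omega>" for n w
    using complex_Re_le_cmod[of "\<zeta> w + of_real (\<delta> n)"] pos[OF that] by simp
  have h1: "cmod (h n w) \<le> 1" if "w \<in> \<Omega>" for n w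
    using den[OF that, of n] \<delta>[of n] by (simp add: h_def norm_divide divide_le_eq)
  have hol: "holomorphic_sev (h n) \<Omega>" for n
  proof -
    have "holomorphic_sev (\<lambda>w. of_real (\<delta> n) / (\<zeta> w + of_real (\<delta> n))) \<Omega>"
    proof (rule holomorphic_sev_compose[where f = \<zeta> and h = "\<lambda>x. of_real (\<delta> n) / (x + of_real (\<delta> n))"])
      show "holomorphic_sev \<zeta> \<Omega>"
        unfolding \<zeta>_def by (intro holomorphic_sev_add holomorphic_sev_mult holomorphic_sev_const holomorphic_sev_linear_form)
      fix w assume w: "w \<in> \<Omega>"
      have "\<zeta> w + of_real (\<delta> n) \<noteq> 0" using den[OF w, of n] \<delta>[of n] by auto
      then have "(\<lambda>x. of_real (\<delta> n) / (x + of_real (\<delta> n))) field_differentiable (at (\<zeta> w))"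
        by (intro derivative_intros) auto
      then show "\<exists>h'. ((\<lambda>x. of_real (\<delta> n) / (x + of_real (\<delta> n))) has_field_derivative h') (at (\<zeta> w))"
        by (simp add: field_differentiable_def)
    qed
    then show ?thesis by (simp add: h_def[abs_def])
  qed
  have hg: "(\<lambda>w. h n w * g w) \<in> bergman_space \<Omega>" for n
    by (rule bergman_space_mult[OF hol h1 g])
  have norm_lim: "(\<lambda>n. L2_norm \<Omega> (\<lambda>w. h n w * g w)) \<longlonglongrightarrow> 0"
  proof -
    have "(\<lambda>n. \<integral>w. (cmod (h n w * g w))\<^sup>2 \<partial>lebesgue_on \<Omega>) \<longlonglongrightarrow> (\<integral>w. 0 \<partial>lebesgue_on \<Omega>)"
    proof (rule integral_dominated_convergence)
      show "integrable (lebesgue_on \<Omega>) (\<lambda>w. (cmod (g w))\<^sup>2)"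
        by (rule L2_space_integrable[OF bergman_space_L2[OF g]])
      show "(\<lambda>w. (cmod (h n w * g w))\<^sup>2) \<in> borel_measurable (lebesgue_on \<Omega>)" for n
        using L2_space_measurable[OF bergman_space_L2[OF hg]] by measurable
      show "AE w in lebesgue_on \<Omega>. (\<lambda>n. (cmod (h n w * g w))\<^sup>2) \<longlonglongrightarrow> 0"
      proof (rule AE_I2)
        fix w assume "w \<in> space (lebesgue_on \<Omega>)"
        then have "\<zeta> w \<noteq> 0" using pos[of w] by auto
        then have "(\<lambda>n. h n w) \<longlonglongrightarrow> of_real 0 / (\<zeta> w + of_real 0)"
          unfolding h_def by (intro tendsto_intros \<delta>lim) auto
        then have "(\<lambda>n. (cmod (h n w * g w))\<^sup>2) \<longlonglongrightarrow> (cmod (0 * g w))\<^sup>2"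
          by (intro tendsto_intros) simp
        then show "(\<lambda>n. (cmod (h n w * g w))\<^sup>2) \<longlonglongrightarrow> 0" by simp
      qed
      show "AE w in lebesgue_on \<Omega>. norm ((cmod (h n w * g w))\<^sup>2) \<le> (cmod (g w))\<^sup>2" for n
        using h1 by (intro AE_I2) (auto simp: norm_mult mult_left_le_one_le intro!: power_mono)
    qed simp
    then show ?thesis unfolding L2_norm_def using tendsto_real_sqrt[of _ 0] by simp
  qed
  show ?thesis
  proof (rule Lim_null_comparison)
    show "(\<lambda>n. 2 * L2_norm \<Omega> (\<lambda>w. h n w * g w)) \<longlonglongrightarrow> 0"
      using tendsto_mult_right_zero[OF norm_lim] .
    show "\<forall>\<^sub>F n in sequentially. norm (g (z n) / of_real (sqrt (kernel_diag (z n)))) \<le> 2 * L2_norm \<Omega> (\<lambda>w. h n w * g w)"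
    proof (rule always_eventually, rule allI)
      fix n
      let ?K = "kernel_diag (z n)"
      have K: "?K > 0" by (rule kernel_diag_pos[OF z])
      have "cmod (\<zeta> (z n) + of_real (\<delta> n)) \<le> 2 * \<delta> n"
        using norm_triangle_ineq[of "\<zeta> (z n)" "of_real (\<delta> n)"] \<delta>[of n] by (simp add: \<delta>_def)
      moreover have "cmod (\<zeta> (z n) + of_real (\<delta> n)) > 0" by (rule less_le_trans[OF \<delta> den[OF z]])
      ultimately have half: "1 / 2 \<le> cmod (h n (z n))"
        using \<delta>[of n] by (simp add: h_def norm_divide field_simps)
      have "(cmod (h n (z n) * g (z n)))\<^sup>2 \<le> ?K * (L2_norm \<Omega> (\<lambda>w. h n w * g w))\<^sup>2"
        by (rule kernel_diag_bound[OF z hg])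
      also have "\<dots> = (sqrt ?K * L2_norm \<Omega> (\<lambda>w. h n w * g w))\<^sup>2"
        using K by (simp add: power_mult_distrib)
      finally have "cmod (h n (z n) * g (z n)) \<le> sqrt ?K * L2_norm \<Omega> (\<lambda>w. h n w * g w)"
        by (rule power2_le_imp_le) (intro mult_nonneg_nonneg real_sqrt_ge_zero L2_norm_nonneg less_imp_le[OF K])
      moreover have "1 / 2 * cmod (g (z n)) \<le> cmod (h n (z n)) * cmod (g (z n))"
        by (rule mult_right_mono[OF half]) simp
      ultimately have "cmod (g (z n)) \<le> sqrt ?K * (2 * L2_norm \<Omega> (\<lambda>w. h n w * g w))"
        by (simp add: norm_mult)
      then show "norm (g (z n) / of_real (sqrt ?K)) \<le> 2 * L2_norm \<Omega> (\<lambda>w. h n w * g w)"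
        using K by (simp add: norm_divide divide_le_eq mult.commute)
    qed
  qed
qed

lemma symbol_mult_L2:
  assumes "continuous_on (closure \<Omega>) \<phi>" "f \<in> L2_space \<Omega>"
  shows "(\<lambda>z. \<phi> z * f z) \<in> L2_space \<Omega>"
    and "(\<And>z. z \<in> \<Omega> \<Longrightarrow> cmod (\<phi> z) \<le> B) \<Longrightarrow> 0 \<le> B \<Longrightarrow> L2_norm \<Omega> (\<lambda>z. \<phi> z * f z) \<le> B * L2_norm \<Omega> f"
proof -
  have m: "\<phi> \<in> borel_measurable (lebesgue_on \<Omega>)"
    using continuous_on_subset[OF assms(1) closure_subset] by (rule measurable_domainI)
  obtain C where "\<And>z. z \<in> closure \<Omega> \<Longrightarrow> cmod (\<phi> z) \<le> C"
    using bounded_on_domain[OF assms(1)] by blast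
  then have "\<And>z. z \<in> \<Omega> \<Longrightarrow> cmod (\<phi> z) \<le> C" using closure_subset by blast
  from L2_space_bounded_mult(1)[OF assms(2) m this domain_lebesgue]
  show "(\<lambda>z. \<phi> z * f z) \<in> L2_space \<Omega>" .
  show "L2_norm \<Omega> (\<lambda>z. \<phi> z * f z) \<le> B * L2_norm \<Omega> f" if "\<And>z. z \<in> \<Omega> \<Longrightarrow> cmod (\<phi> z) \<le> B" "0 \<le> B"
    by (rule L2_space_bounded_mult(2)[OF assms(2) m that(1) domain_lebesgue that(2)])
qed

lemma toeplitz_in_bergman_space:
  assumes "continuous_on (closure \<Omega>) \<phi>" "f \<in> bergman_space \<Omega>"
  shows "toeplitz \<Omega> \<phi> f \<in> bergman_space \<Omega>"
    and "h \<in> bergman_space \<Omega> \<Longrightarrow> L2_inner \<Omega> (toeplitz \<Omega> \<phi> f) h = L2_inner \<Omega> (\<lambda>z. \<phi> z * f z) h"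
  using bergman_proj[OF symbol_mult_L2(1)[OF assms(1) bergman_space_L2[OF assms(2)]]]
  by (simp_all add: toeplitz_def)

lemma toeplitz_lincomb:
  assumes "continuous_on (closure \<Omega>) \<phi>" "f \<in> bergman_space \<Omega>" "g \<in> bergman_space \<Omega>"
  shows "toeplitz \<Omega> \<phi> (\<lambda>z. a * f z + b * g z) = (\<lambda>z. a * toeplitz \<Omega> \<phi> f z + b * toeplitz \<Omega> \<phi> g z)"
proof -
  have "(\<lambda>z. \<phi> z * (a * f z + b * g z)) = (\<lambda>z. a * (\<phi> z * f z) + b * (\<phi> z * g z))"
    by (auto simp: algebra_simps)
  then show ?thesis
    unfolding toeplitz_def
    using bergman_proj_lincomb[OF symbol_mult_L2(1)[OF assms(1) bergman_space_L2[OF assms(2)]]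
        symbol_mult_L2(1)[OF assms(1) bergman_space_L2[OF assms(3)]], of a b] by simp
qed

lemma berezin_toeplitz_eq:
  assumes "continuous_on (closure \<Omega>) \<phi>" "z \<in> \<Omega>"
  shows "berezin \<Omega> (toeplitz \<Omega> \<phi>) z =
    L2_inner \<Omega> (\<lambda>w. \<phi> w * normalized_kernel \<Omega> z w) (normalized_kernel \<Omega> z)"
  unfolding berezin_def
  by (rule toeplitz_in_bergman_space(2)[OF assms(1) normalized_kernel(1)[OF assms(2)] normalized_kernel(1)[OF assms(2)]])

text \<open>
  Along a subsequence the images of the normalized kernels converge in norm to some \<open>g\<close>, and the
  Berezin transform is asymptotically the inner product of \<open>g\<close> with the normalized kernels.
\<close>

theorem compact_toeplitz_imp_berezin_tendsto_zero:
  assumes conv: "convex \<Omega>" and \<phi>: "continuous_on (closure \<Omega>) \<phi>"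
    and comp: "compact_operator \<Omega> (toeplitz \<Omega> \<phi>)"
  shows "(berezin \<Omega> (toeplitz \<Omega> \<phi>) \<longlongrightarrow> 0) (to_boundary \<Omega>)"
proof (rule tendstoI, rule ccontr)
  let ?T = "toeplitz \<Omega> \<phi>"
  fix e :: real assume e: "e > 0"
  assume "\<not> (\<forall>\<^sub>F z in to_boundary \<Omega>. dist (berezin \<Omega> ?T z) 0 < e)"
  then have "\<forall>\<delta>>0. \<exists>z\<in>\<Omega>. infdist z (frontier \<Omega>) < \<delta> \<and> e \<le> cmod (berezin \<Omega> ?T z)"
    unfolding eventually_to_boundary by (force simp: not_less)
  then have "\<exists>z\<in>\<Omega>. infdist z (frontier \<Omega>) < 1 / real (Suc n) \<and> e \<le> cmod (berezin \<Omega> ?T z)" for n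
    by simp
  then obtain z where z: "\<And>n. z n \<in> \<Omega>" "\<And>n. infdist (z n) (frontier \<Omega>) < 1 / real (Suc n)"
    "\<And>n. e \<le> cmod (berezin \<Omega> ?T (z n))" by metis
  have "compact (closure \<Omega>)" using bounded_domain by (simp add: compact_closure)
  moreover have "\<forall>n. z n \<in> closure \<Omega>" using z(1) closure_subset by blast
  ultimately obtain p r where r: "strict_mono (r :: nat \<Rightarrow> nat)" "(z \<circ> r) \<longlonglongrightarrow> p"
    unfolding compact_def by blast
  have p: "p \<in> frontier \<Omega>"
  proof -
    have "\<Omega> \<noteq> {}" using z(1) by auto
    moreover have "\<Omega> \<noteq> UNIV" using bounded_domain not_bounded_UNIV by auto
    ultimately have ne: "frontier \<Omega> \<noteq> {}" by (simp add: frontier_eq_empty)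
    have "(\<lambda>n. infdist (z (r n)) (frontier \<Omega>)) \<longlonglongrightarrow> infdist p (frontier \<Omega>)"
      using r(2) by (intro tendsto_infdist) (simp add: o_def)
    moreover have "(\<lambda>n. infdist (z (r n)) (frontier \<Omega>)) \<longlonglongrightarrow> 0"
    proof (rule tendsto_sandwich[OF _ _ tendsto_const])
      show "(\<lambda>n. 1 / real (Suc (r n))) \<longlonglongrightarrow> 0"
        using LIMSEQ_subseq_LIMSEQ[OF LIMSEQ_Suc[OF lim_1_over_n] r(1)] by (simp add: o_def)
    qed (use z(2) in \<open>auto intro!: infdist_nonneg always_eventually less_imp_le\<close>)
    ultimately have "infdist p (frontier \<Omega>) = 0" by (rule LIMSEQ_unique)
    then show ?thesis using ne in_closed_iff_infdist_zero[OF frontier_closed] by blast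
  qed
  let ?k = "\<lambda>n. normalized_kernel \<Omega> (z (r n))"
  have k: "?k n \<in> bergman_space \<Omega>" "L2_norm \<Omega> (?k n) = 1" for n
    using normalized_kernel z(1) by auto
  have seq: "\<forall>f. (\<forall>n. f n \<in> bergman_space \<Omega>) \<longrightarrow> (\<exists>C. \<forall>n. L2_norm \<Omega> (f n) \<le> C) \<longrightarrow>
      (\<exists>r g. strict_mono r \<and> g \<in> bergman_space \<Omega> \<and>
        (\<lambda>n :: nat. L2_norm \<Omega> (\<lambda>z. ?T (f (r n :: nat)) z - g z)) \<longlonglongrightarrow> 0)"
    using comp unfolding compact_operator_def by (elim conjE) assumption
  have "\<exists>C. \<forall>n. L2_norm \<Omega> (?k n) \<le> C" using k(2) by (intro exI[of _ 1]) simp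
  then obtain s g where s: "strict_mono (s :: nat \<Rightarrow> nat)" and g: "g \<in> bergman_space \<Omega>"
    and lim: "(\<lambda>n. L2_norm \<Omega> (\<lambda>z. ?T (?k (s n)) z - g z)) \<longlonglongrightarrow> 0"
    using seq[rule_format, of ?k, OF k(1)] by blast
  have "(\<lambda>n. g (z (r (s n))) / of_real (sqrt (kernel_diag (z (r (s n)))))) \<longlonglongrightarrow> 0"
    by (rule normalized_evaluation_tendsto_zero[OF conv p _ _ g])
       (use z(1) LIMSEQ_subseq_LIMSEQ[OF r(2) s] in \<open>auto simp: o_def\<close>)
  from tendsto_add[OF lim tendsto_norm[OF this]]
  have L: "(\<lambda>n. L2_norm \<Omega> (\<lambda>z. ?T (?k (s n)) z - g z) +
      cmod (g (z (r (s n))) / of_real (sqrt (kernel_diag (z (r (s n))))))) \<longlonglongrightarrow> 0" by simp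
  have E: "e \<le> L2_norm \<Omega> (\<lambda>z. ?T (?k (s n)) z - g z) +
      cmod (g (z (r (s n))) / of_real (sqrt (kernel_diag (z (r (s n))))))" for n
  proof -
    let ?z = "z (r (s n))" let ?kk = "normalized_kernel \<Omega> ?z"
    note kk = k(1)[of "s n"]
    note Tk = toeplitz_in_bergman_space(1)[OF \<phi> kk]
    have "L2_inner \<Omega> (\<lambda>z. ?T ?kk z - g z) ?kk = berezin \<Omega> ?T ?z - g ?z / of_real (sqrt (kernel_diag ?z))"
      using L2_inner_diff_left[OF Tk[THEN bergman_space_L2] g[THEN bergman_space_L2] kk[THEN bergman_space_L2]]
        normalized_kernel(2)[OF z(1) g] by (simp add: berezin_def)
    moreover have "cmod (L2_inner \<Omega> (\<lambda>z. ?T ?kk z - g z) ?kk) \<le> L2_norm \<Omega> (\<lambda>z. ?T ?kk z - g z)"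
      using L2_Cauchy_Schwarz[OF bergman_space_L2[OF bergman_space_diff[OF Tk g]] bergman_space_L2[OF kk]] k(2)[of "s n"] by simp
    ultimately show ?thesis
      using z(3)[of "r (s n)"] norm_triangle_ineq2[of "berezin \<Omega> ?T ?z" "g ?z / of_real (sqrt (kernel_diag ?z))"] by simp
  qed
  have "e \<le> 0" by (rule LIMSEQ_le_const[OF L]) (use E in blast)
  with e show False by simp
qed

section \<open>Symbols vanishing on the boundary\<close>

lemma bergman_space_bounded_on_compact:
  assumes K: "compact K" "K \<subseteq> \<Omega>"
  obtains B where "\<And>f w. f \<in> bergman_space \<Omega> \<Longrightarrow> w \<in> K \<Longrightarrow> cmod (f w) \<le> B * L2_norm \<Omega> f"
proof -
  have "\<exists>r C. r > 0 \<and> (\<forall>f w. f \<in> bergman_space \<Omega> \<longrightarrow> w \<in> ball z r \<longrightarrow> cmod (f w) \<le> C * L2_norm \<Omega> f)"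
    if zK: "z \<in> K" for z
  proof -
    obtain r C where "r > 0" "\<And>f w. f \<in> bergman_space \<Omega> \<Longrightarrow> w \<in> ball z (2 * r) \<Longrightarrow> cmod (f w) \<le> C * L2_norm \<Omega> f"
      using bergman_space_pointwise_bound[OF subsetD[OF K(2) zK]] by metis
    then show ?thesis by (intro exI[of _ "2 * r"] exI[of _ C]) auto
  qed
  then obtain r C where r: "\<And>z. z \<in> K \<Longrightarrow> r z > 0"
    and C: "\<And>z f w. z \<in> K \<Longrightarrow> f \<in> bergman_space \<Omega> \<Longrightarrow> w \<in> ball z (r z) \<Longrightarrow> cmod (f w) \<le> C z * L2_norm \<Omega> f"
    by metis
  have "K \<subseteq> (\<Union>z\<in>K. ball z (r z))" using r by force
  then obtain D where D: "D \<subseteq> K" "finite D" "K \<subseteq> (\<Union>z\<in>D. ball z (r z))"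
    using compactE_image[OF K(1), of K "\<lambda>z. ball z (r z)"] by auto
  have "cmod (f w) \<le> (\<Sum>z\<in>D. \<bar>C z\<bar>) * L2_norm \<Omega> f" if f: "f \<in> bergman_space \<Omega>" and w: "w \<in> K" for f w
  proof -
    obtain z where z: "z \<in> D" "w \<in> ball z (r z)" using D w by blast
    have "cmod (f w) \<le> C z * L2_norm \<Omega> f" using C z D f by blast
    also have "\<dots> \<le> (\<Sum>z\<in>D. \<bar>C z\<bar>) * L2_norm \<Omega> f"
    proof (rule mult_right_mono[OF _ L2_norm_nonneg])
      have "C z \<le> \<bar>C z\<bar>" by simp
      also have "\<dots> \<le> (\<Sum>z\<in>D. \<bar>C z\<bar>)" using D z by (intro member_le_sum) auto
      finally show "C z \<le> (\<Sum>z\<in>D. \<bar>C z\<bar>)" .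
    qed
    finally show ?thesis .
  qed
  then show ?thesis using that by blast
qed

text \<open>
  A diagonal sequence converges on a countable dense set, and the sequence is equicontinuous by
  the Cauchy estimates.
\<close>

lemma bergman_space_bounded_subsequence:
  assumes f: "\<And>n. f n \<in> bergman_space \<Omega>" and bd: "\<And>n. L2_norm \<Omega> (f n) \<le> C"
  obtains r where "strict_mono (r :: nat \<Rightarrow> nat)" "\<And>z. z \<in> \<Omega> \<Longrightarrow> convergent (\<lambda>n. f (r n) z)"
proof -
  obtain D :: "(complex ^ 2) set" where D: "countable D" "\<And>X. open X \<Longrightarrow> X \<noteq> {} \<Longrightarrow> \<exists>d\<in>D. d \<in> X"
    by (rule countable_dense_setE) blast
  have "\<exists>M>0. \<forall>n. cmod (f n z) \<le> M" if z: "z \<in> \<Omega>" for z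
  proof -
    obtain r C' where rC: "r > 0" "C' \<ge> 0"
      "\<And>f w. f \<in> bergman_space \<Omega> \<Longrightarrow> w \<in> ball z (2 * r) \<Longrightarrow> cmod (f w) \<le> C' * L2_norm \<Omega> f"
      using bergman_space_pointwise_bound[OF z] by metis
    have "cmod (f n z) \<le> C' * \<bar>C\<bar> + 1" for n
    proof -
      have "cmod (f n z) \<le> C' * L2_norm \<Omega> (f n)" using rC(3)[OF f, of z n] rC(1) by simp
      also have "\<dots> \<le> C' * \<bar>C\<bar>" using bd[of n] rC(2) by (intro mult_left_mono) auto
      finally show ?thesis by simp
    qed
    then show ?thesis using rC(2) by (intro exI[of _ "C' * \<bar>C\<bar> + 1"]) (auto intro: add_nonneg_pos)
  qed
  then obtain M where M: "\<And>z. z \<in> \<Omega> \<Longrightarrow> M z > 0" "\<And>z n. z \<in> \<Omega> \<Longrightarrow> cmod (f n z) \<le> M z" by metis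
  have "countable (D \<inter> \<Omega>)" using D(1) by auto
  moreover have "norm (f n z / of_real (M z)) \<le> 1" if "z \<in> D \<inter> \<Omega>" for n z
    using M[of z] that by (simp add: norm_divide divide_le_eq)
  ultimately obtain r where r: "strict_mono (r :: nat \<Rightarrow> nat)"
    and conv: "\<And>z. z \<in> D \<inter> \<Omega> \<Longrightarrow> \<exists>l. (\<lambda>n. f (r n) z / of_real (M z)) \<longlonglongrightarrow> l"
    using function_convergent_subsequence[of "D \<inter> \<Omega>" "\<lambda>n z. f n z / of_real (M z)" 1] by metis
  have dense: "Cauchy (\<lambda>n. f (r n) d)" if d: "d \<in> D \<inter> \<Omega>" for d
  proof -
    obtain l where "(\<lambda>n. f (r n) d / of_real (M d)) \<longlonglongrightarrow> l" using conv[OF d] by blast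
    from tendsto_mult_right[OF this, of "of_real (M d)"]
    have "(\<lambda>n. f (r n) d) \<longlonglongrightarrow> l * of_real (M d)" using M(1)[of d] d by simp
    then show ?thesis by (rule LIMSEQ_imp_Cauchy)
  qed
  have "convergent (\<lambda>n. f (r n) z)" if z: "z \<in> \<Omega>" for z
  proof (rule Cauchy_convergent, rule CauchyI)
    fix e :: real assume e: "e > 0"
    obtain \<rho> C' where \<rho>: "\<rho> > 0" "C' \<ge> 0" "ball z (2 * \<rho>) \<subseteq> \<Omega>"
      "\<And>f w. f \<in> bergman_space \<Omega> \<Longrightarrow> w \<in> ball z (2 * \<rho>) \<Longrightarrow> cmod (f w) \<le> C' * L2_norm \<Omega> f"
      using bergman_space_pointwise_bound[OF z] by metis
    define L where "L = 2 * (C' * \<bar>C\<bar>) / \<rho>"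
    have L0: "L \<ge> 0" using \<rho> by (simp add: L_def)
    have Lip: "cmod (f n x - f n y) \<le> L * norm (x - y)" if "x \<in> ball z \<rho>" "y \<in> ball z \<rho>" for n x y
      unfolding L_def
    proof (rule holomorphic_sev_Lipschitz[OF bergman_space_holomorphic[OF f] \<rho>(3,1) _ that])
      fix w assume "w \<in> ball z (2 * \<rho>)"
      then have "cmod (f n w) \<le> C' * L2_norm \<Omega> (f n)" by (rule \<rho>(4)[OF f])
      also have "\<dots> \<le> C' * \<bar>C\<bar>" using bd[of n] \<rho>(2) by (intro mult_left_mono) auto
      finally show "cmod (f n w) \<le> C' * \<bar>C\<bar>" .
    qed
    define \<eta> where "\<eta> = min \<rho> (e / (3 * (L + 1)))"
    have \<eta>: "\<eta> > 0" using \<rho> e L0 by (simp add: \<eta>_def)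
    obtain d where d: "d \<in> D" "d \<in> ball z \<eta>" using D(2)[of "ball z \<eta>"] \<eta> by auto
    have dz: "d \<in> ball z \<rho>" "d \<in> \<Omega>" using d \<rho> by (auto simp: \<eta>_def)
    have small: "cmod (f n z - f n d) < e / 3" for n
    proof -
      have "cmod (f n z - f n d) \<le> L * norm (z - d)" by (rule Lip) (use \<rho> dz in auto)
      also have "\<dots> \<le> L * (e / (3 * (L + 1)))"
        using d L0 by (intro mult_left_mono) (auto simp: \<eta>_def dist_norm)
      also have "\<dots> < e / 3" using e L0 by (simp add: field_simps)
      finally show ?thesis .
    qed
    obtain N where N: "\<And>m n. m \<ge> N \<Longrightarrow> n \<ge> N \<Longrightarrow> cmod (f (r m) d - f (r n) d) < e / 3"
      using CauchyD[OF dense[of d], of "e / 3"] d dz e by auto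
    show "\<exists>M. \<forall>m\<ge>M. \<forall>n\<ge>M. norm (f (r m) z - f (r n) z) < e"
    proof (intro exI[of _ N] allI impI)
      fix m n assume mn: "m \<ge> N" "n \<ge> N"
      have "f (r m) z - f (r n) z = (f (r m) z - f (r m) d) + (f (r m) d - f (r n) d) - (f (r n) z - f (r n) d)"
        by simp
      then have "cmod (f (r m) z - f (r n) z) \<le> cmod (f (r m) z - f (r m) d) + cmod (f (r m) d - f (r n) d) + cmod (f (r n) z - f (r n) d)"
        using norm_triangle_ineq4[of "(f (r m) z - f (r m) d) + (f (r m) d - f (r n) d)" "f (r n) z - f (r n) d"]
          norm_triangle_ineq[of "f (r m) z - f (r m) d" "f (r m) d - f (r n) d"] by simp
      then show "norm (f (r m) z - f (r n) z) < e"
        using small[of "r m"] small[of "r n"] N[OF mn] by linarith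
    qed
  qed
  then show ?thesis using that r by blast
qed

text \<open>
  The symbol is small off a compact subset of the domain, and on this subset the functions are
  uniformly bounded, so that dominated convergence applies.
\<close>

lemma symbol_mult_tendsto_zero:
  assumes \<phi>: "continuous_on (closure \<Omega>) \<phi>" and zero: "\<And>p. p \<in> frontier \<Omega> \<Longrightarrow> \<phi> p = 0"
    and u: "\<And>n. u n \<in> bergman_space \<Omega>" and bd: "\<And>n. L2_norm \<Omega> (u n) \<le> C"
    and lim: "\<And>z. z \<in> \<Omega> \<Longrightarrow> (\<lambda>n. u n z) \<longlonglongrightarrow> F z"
  shows "F \<in> L2_space \<Omega>" "(\<lambda>n. L2_norm \<Omega> (\<lambda>z. \<phi> z * (u n z - F z))) \<longlonglongrightarrow> 0"
proof -
  let ?M = "lebesgue_on \<Omega>"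
  note uL2 = bergman_space_L2[OF u]
  have F: "F \<in> L2_space \<Omega>" and FC: "L2_norm \<Omega> F \<le> C"
    using L2_space_limit[of u \<Omega> F C, OF uL2 domain_lebesgue lim bd] by auto
  show "F \<in> L2_space \<Omega>" by (rule F)
  have C0: "C \<ge> 0" using bd[of 0] L2_norm_nonneg order_trans by blast
  have d: "(\<lambda>z. u n z - F z) \<in> L2_space \<Omega>" for n by (rule L2_space_diff[OF uL2 F])
  have dC: "L2_norm \<Omega> (\<lambda>z. u n z - F z) \<le> 2 * C" for n
    using L2_norm_triangle[OF uL2[of n] L2_space_cmult[OF F, of "-1"]] bd[of n] FC
      L2_norm_cmult[of \<Omega> "-1" F] by simp
  obtain B where B: "\<And>z. z \<in> closure \<Omega> \<Longrightarrow> cmod (\<phi> z) \<le> B"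
    using bounded_on_domain[OF \<phi>] by blast
  have \<phi>m: "\<phi> \<in> borel_measurable ?M"
    using continuous_on_subset[OF \<phi> closure_subset] by (rule measurable_domainI)
  have sq: "(\<lambda>n. (L2_norm \<Omega> (\<lambda>z. \<phi> z * (u n z - F z)))\<^sup>2) \<longlonglongrightarrow> 0"
  proof (rule LIMSEQ_I)
    fix e :: real assume e: "e > 0"
    define \<epsilon> where "\<epsilon> = e / (2 * (4 * C\<^sup>2 + 1))"
    have \<epsilon>: "\<epsilon> > 0" using e by (simp add: \<epsilon>_def add_nonneg_pos)
    define K where "K = {z \<in> closure \<Omega>. \<epsilon> \<le> (cmod (\<phi> z))\<^sup>2}"
    have K: "compact K" "K \<subseteq> \<Omega>"
    proof -
      have "closed K"
        unfolding K_def by (intro continuous_closed_preimage_constant closed_Collect_le continuous_on_closed_Collect_le)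
          (intro continuous_intros \<phi> closed_closure)+
      then show "compact K"
        using bounded_subset[OF bounded_closure[OF bounded_domain], of K] by (auto simp: K_def compact_eq_bounded_closed)
      show "K \<subseteq> \<Omega>"
      proof
        fix z assume z: "z \<in> K"
        then have "\<phi> z \<noteq> 0" using \<epsilon> by (auto simp: K_def)
        then have "z \<notin> frontier \<Omega>" using zero by blast
        then show "z \<in> \<Omega>" using z open_domain by (auto simp: K_def frontier_def interior_open)
      qed
    qed
    obtain A where A: "\<And>f w. f \<in> bergman_space \<Omega> \<Longrightarrow> w \<in> K \<Longrightarrow> cmod (f w) \<le> A * L2_norm \<Omega> f"
      using bergman_space_bounded_on_compact[OF K] by metis
    define A' where "A' = \<bar>A\<bar> * C"
    have uA: "cmod (u n w) \<le> A'" if "w \<in> K" for n w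
    proof -
      have "cmod (u n w) \<le> A * L2_norm \<Omega> (u n)" by (rule A[OF u that])
      also have "\<dots> \<le> \<bar>A\<bar> * C" using bd L2_norm_nonneg by (intro mult_mono) auto
      finally show ?thesis by (simp add: A'_def)
    qed
    have FA: "cmod (F w) \<le> A'" if "w \<in> K" for w
      by (rule tendsto_upperbound[OF tendsto_norm[OF lim]]) (use that K uA in auto)
    let ?g = "\<lambda>n z. indicator K z * (cmod (\<phi> z * (u n z - F z)))\<^sup>2"
    have gm: "?g n \<in> borel_measurable ?M" for n
    proof -
      have "indicator K \<in> borel_measurable ?M"
        using K(1) by (intro borel_measurable_indicator) (auto simp: sets_restrict_space_iff K compact_imp_closed borel_closed domain_lebesgue K(2) intro!: lebesgue_closedin)
      moreover have "(\<lambda>z. \<phi> z * (u n z - F z)) \<in> borel_measurable ?M"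
        using \<phi>m L2_space_measurable[OF d] by (rule borel_measurable_times)
      ultimately show ?thesis by measurable
    qed
    have gB: "norm (?g n z) \<le> (B * (2 * A'))\<^sup>2" if "z \<in> \<Omega>" for n z
    proof (cases "z \<in> K")
      case True
      have "cmod (\<phi> z * (u n z - F z)) \<le> B * (2 * A')"
        unfolding norm_mult
        using B[of z] True uA[OF True, of n] FA[OF True] norm_triangle_ineq4[of "u n z" "F z"] order_trans[OF norm_ge_zero B]
        by (intro mult_mono) (auto simp: K_def)
      then have "(cmod (\<phi> z * (u n z - F z)))\<^sup>2 \<le> (B * (2 * A'))\<^sup>2" by (intro power_mono) auto
      then show ?thesis using True by simp
    qed simp
    have "(\<lambda>n. \<integral>z. ?g n z \<partial>?M) \<longlonglongrightarrow> (\<integral>z. 0 \<partial>?M)"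
    proof (rule integral_dominated_convergence)
      show "integrable ?M (\<lambda>z. (B * (2 * A'))\<^sup>2)"
        using finite_measure.integrable_const[OF finite_measure_domain] .
      show "AE z in ?M. (\<lambda>n. ?g n z) \<longlonglongrightarrow> 0"
      proof (rule AE_I2)
        fix z assume "z \<in> space ?M"
        then have "(\<lambda>n. ?g n z) \<longlonglongrightarrow> indicator K z * (cmod (\<phi> z * (F z - F z)))\<^sup>2"
          by (intro tendsto_intros lim) simp
        then show "(\<lambda>n. ?g n z) \<longlonglongrightarrow> 0" by simp
      qed
    qed (use gm gB in auto)
    then have "\<exists>N. \<forall>n\<ge>N. norm (\<integral>z. ?g n z \<partial>?M) < e / 2"
      using LIMSEQ_D[of "\<lambda>n. \<integral>z. ?g n z \<partial>?M" 0 "e / 2"] e by simp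
    then obtain N where N: "\<And>n. n \<ge> N \<Longrightarrow> norm (\<integral>z. ?g n z \<partial>?M) < e / 2" by blast
    have "(L2_norm \<Omega> (\<lambda>z. \<phi> z * (u n z - F z)))\<^sup>2 < e" if n: "n \<ge> N" for n
    proof -
      have gi: "integrable ?M (?g n)"
        by (rule finite_measure.integrable_const_bound[OF finite_measure_domain, where B = "(B * (2 * A'))\<^sup>2"])
           (use gm gB in auto)
      have di: "integrable ?M (\<lambda>z. \<epsilon> * (cmod (u n z - F z))\<^sup>2)"
        using L2_space_integrable[OF d] by simp
      have "(L2_norm \<Omega> (\<lambda>z. \<phi> z * (u n z - F z)))\<^sup>2 \<le> (\<integral>z. ?g n z + \<epsilon> * (cmod (u n z - F z))\<^sup>2 \<partial>?M)"
        unfolding L2_norm_power2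
      proof (rule integral_mono)
        show "integrable ?M (\<lambda>z. (cmod (\<phi> z * (u n z - F z)))\<^sup>2)"
          by (rule L2_space_integrable[OF symbol_mult_L2(1)[OF \<phi> d]])
        fix z assume "z \<in> space ?M"
        then have z: "z \<in> closure \<Omega>" using closure_subset by auto
        show "(cmod (\<phi> z * (u n z - F z)))\<^sup>2 \<le> ?g n z + \<epsilon> * (cmod (u n z - F z))\<^sup>2"
        proof (cases "z \<in> K")
          case False
          then have "(cmod (\<phi> z))\<^sup>2 \<le> \<epsilon>" using z by (auto simp: K_def)
          then have "(cmod (\<phi> z))\<^sup>2 * (cmod (u n z - F z))\<^sup>2 \<le> \<epsilon> * (cmod (u n z - F z))\<^sup>2" by (rule mult_right_mono) simp
          then show ?thesis using False by (simp add: norm_mult power_mult_distrib)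
        qed (use \<epsilon> in simp)
      qed (intro Bochner_Integration.integrable_add gi di)
      also have "\<dots> = (\<integral>z. ?g n z \<partial>?M) + \<epsilon> * (L2_norm \<Omega> (\<lambda>z. u n z - F z))\<^sup>2"
        using gi di L2_space_integrable[OF d] by (simp add: L2_norm_power2)
      also have "\<dots> \<le> (\<integral>z. ?g n z \<partial>?M) + \<epsilon> * (2 * C)\<^sup>2"
        using \<epsilon> dC[of n] L2_norm_nonneg by (intro add_left_mono mult_left_mono power_mono) auto
      also have "\<epsilon> * (2 * C)\<^sup>2 \<le> e / 2"
      proof -
        have "\<epsilon> * (2 * C)\<^sup>2 \<le> \<epsilon> * (4 * C\<^sup>2 + 1)" using \<epsilon> by (intro mult_left_mono) (auto simp: power_mult_distrib)
        also have "\<dots> = e / 2"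
        proof -
          have "e / (2 * D) * D = e / 2" if "D > 0" for D :: real using that by simp
          from this[of "4 * C\<^sup>2 + 1"] show ?thesis by (simp add: \<epsilon>_def add_nonneg_pos)
        qed
        finally show ?thesis .
      qed
      finally show ?thesis using N[OF n] by simp
    qed
    then show "\<exists>N. \<forall>n\<ge>N. norm ((L2_norm \<Omega> (\<lambda>z. \<phi> z * (u n z - F z)))\<^sup>2 - 0) < e" by auto
  qed
  have "sqrt ((L2_norm \<Omega> f)\<^sup>2) = L2_norm \<Omega> f" for f :: "complex ^ 2 \<Rightarrow> complex"
    by (simp add: abs_of_nonneg[OF L2_norm_nonneg])
  then show "(\<lambda>n. L2_norm \<Omega> (\<lambda>z. \<phi> z * (u n z - F z))) \<longlonglongrightarrow> 0"
    using tendsto_real_sqrt[OF sq] by (simp del: real_sqrt_abs)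
qed

theorem compact_toeplitz_if_vanishing_on_frontier:
  assumes \<phi>: "continuous_on (closure \<Omega>) \<phi>" and zero: "\<And>p. p \<in> frontier \<Omega> \<Longrightarrow> \<phi> p = 0"
  shows "compact_operator \<Omega> (toeplitz \<Omega> \<phi>)"
  unfolding compact_operator_def
proof (intro conjI ballI allI impI)
  let ?T = "toeplitz \<Omega> \<phi>"
  fix f :: "nat \<Rightarrow> complex ^ 2 \<Rightarrow> complex"
  assume f: "\<forall>n. f n \<in> bergman_space \<Omega>" and "\<exists>C. \<forall>n. L2_norm \<Omega> (f n) \<le> C"
  then obtain C where C: "\<And>n. L2_norm \<Omega> (f n) \<le> C" by blast
  obtain r where r: "strict_mono (r :: nat \<Rightarrow> nat)" "\<And>z. z \<in> \<Omega> \<Longrightarrow> convergent (\<lambda>n. f (r n) z)"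
    using bergman_space_bounded_subsequence[of f C] f C by metis
  define F where "F z = lim (\<lambda>n. f (r n) z)" for z
  let ?u = "\<lambda>n. f (r n)"
  have u: "?u n \<in> bergman_space \<Omega>" for n using f by blast
  have lim: "(\<lambda>n. ?u n z) \<longlonglongrightarrow> F z" if "z \<in> \<Omega>" for z
    using r(2)[OF that] by (simp add: F_def convergent_LIMSEQ_iff)
  note F = symbol_mult_tendsto_zero[of \<phi> ?u C F, OF \<phi> zero u C lim]
  have Tu: "?T (?u n) \<in> bergman_space \<Omega>" for n by (rule toeplitz_in_bergman_space(1)[OF \<phi> u])
  have bound: "L2_norm \<Omega> (\<lambda>z. ?T (?u m) z - ?T (?u n) z) \<le>
      L2_norm \<Omega> (\<lambda>z. \<phi> z * (?u m z - F z)) + L2_norm \<Omega> (\<lambda>z. \<phi> z * (?u n z - F z))" for m n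
  proof -
    have d: "(\<lambda>z. ?u n z - F z) \<in> L2_space \<Omega>" for n by (rule L2_space_diff[OF bergman_space_L2[OF u] F(1)])
    have "(\<lambda>z. ?T (?u m) z - ?T (?u n) z) = bergman_proj \<Omega> (\<lambda>z. \<phi> z * (?u m z - ?u n z))"
      using toeplitz_lincomb[OF \<phi> u[of m] u[of n], of 1 "-1"] by (simp add: toeplitz_def)
    then have "L2_norm \<Omega> (\<lambda>z. ?T (?u m) z - ?T (?u n) z) \<le> L2_norm \<Omega> (\<lambda>z. \<phi> z * (?u m z - ?u n z))"
      using bergman_proj_norm_le[OF symbol_mult_L2(1)[OF \<phi> bergman_space_L2[OF bergman_space_diff[OF u[of m] u[of n]]]]]
      by simp
    also have "L2_norm \<Omega> (\<lambda>z. \<phi> z * (?u m z - ?u n z)) =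
        L2_norm \<Omega> (\<lambda>z. \<phi> z * (?u m z - F z) + - 1 * (\<phi> z * (?u n z - F z)))"
      by (simp add: algebra_simps)
    also have "\<dots> \<le> L2_norm \<Omega> (\<lambda>z. \<phi> z * (?u m z - F z)) + L2_norm \<Omega> (\<lambda>z. - 1 * (\<phi> z * (?u n z - F z)))"
      by (rule L2_norm_triangle[OF symbol_mult_L2(1)[OF \<phi> d[of m]] L2_space_cmult[OF symbol_mult_L2(1)[OF \<phi> d[of n]], of "-1"]])
    also have "L2_norm \<Omega> (\<lambda>z. - 1 * (\<phi> z * (?u n z - F z))) = L2_norm \<Omega> (\<lambda>z. \<phi> z * (?u n z - F z))"
      by (simp only: L2_norm_cmult) simp
    finally show ?thesis .
  qed
  have "\<exists>N. \<forall>m\<ge>N. \<forall>n\<ge>N. L2_norm \<Omega> (\<lambda>z. ?T (?u m) z - ?T (?u n) z) < e" if e: "e > 0" for e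
  proof -
    obtain N where N: "\<And>n. n \<ge> N \<Longrightarrow> L2_norm \<Omega> (\<lambda>z. \<phi> z * (?u n z - F z)) < e / 2"
      using LIMSEQ_D[OF F(2), of "e / 2"] e by force
    have "L2_norm \<Omega> (\<lambda>z. ?T (?u m) z - ?T (?u n) z) < e" if "m \<ge> N" "n \<ge> N" for m n
      using bound[of m n] N[OF that(1)] N[OF that(2)] by linarith
    then show ?thesis by blast
  qed
  then obtain g where "g \<in> bergman_space \<Omega>" "(\<lambda>n. L2_norm \<Omega> (\<lambda>z. ?T (?u n) z - g z)) \<longlonglongrightarrow> 0"
    using bergman_space_complete[of "\<lambda>n. ?T (?u n)", OF Tu] by blast
  then show "\<exists>r g. strict_mono r \<and> g \<in> bergman_space \<Omega> \<and> (\<lambda>n. L2_norm \<Omega> (\<lambda>z. ?T (f (r n)) z - g z)) \<longlonglongrightarrow> 0"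
    using r(1) by blast
qed (use toeplitz_in_bergman_space(1)[OF \<phi>] toeplitz_lincomb[OF \<phi>] in blast)+

end

section \<open>Convex Reinhardt domains\<close>

lemma sum_norm_le_sum_Re_imp_eq:
  fixes x :: "'a \<Rightarrow> complex"
  assumes "finite A" "(\<Sum>k\<in>A. cmod (x k)) \<le> (\<Sum>k\<in>A. Re (x k))" "k \<in> A"
  shows "x k = of_real (cmod (x k))"
proof -
  have nn: "cmod (x k) - Re (x k) \<ge> 0" for k using complex_Re_le_cmod[of "x k"] by simp
  have "(\<Sum>k\<in>A. cmod (x k) - Re (x k)) \<le> 0" using assms(2) by (simp add: sum_subtractf)
  then have "(\<Sum>k\<in>A. cmod (x k) - Re (x k)) = 0"
    by (rule order.antisym) (rule sum_nonneg, rule nn)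
  then have e: "cmod (x k) = Re (x k)"
    using sum_nonneg_eq_0_iff[OF assms(1), of "\<lambda>k. cmod (x k) - Re (x k)"] nn assms(3) by simp
  then have "(Im (x k))\<^sup>2 = 0" using cmod_power2[of "x k"] by simp
  then show ?thesis using e by (simp add: complex_eq_iff)
qed

locale convex_reinhardt = bounded_open +
  assumes convex_domain: "convex \<Omega>"
    and nonempty_domain: "\<Omega> \<noteq> {}"
    and rotation_domain: "\<And>z \<xi>. z \<in> \<Omega> \<Longrightarrow> (\<And>k. cmod (\<xi> $ k) = 1) \<Longrightarrow> (\<chi> k. \<xi> $ k * z $ k) \<in> \<Omega>"
begin

text \<open>
  Rotations provide the factors of modulus 1, and convexity fills in the disc between them.
\<close>

lemma domain_complete:
  assumes z: "z \<in> \<Omega>" and c: "\<And>k. cmod (c k) \<le> 1"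
  shows "(\<chi> k. c k * z $ k) \<in> \<Omega>"
proof -
  have one: "(\<chi> k. (if k = m then b else 1) * y $ k) \<in> \<Omega>" if y: "y \<in> \<Omega>" and b: "cmod b \<le> 1" for y m b
  proof -
    \<comment> \<open>A point of the closed unit disc is a convex combination of two opposite points of the circle.\<close>
    obtain v where v: "cmod v = 1" "b = of_real (cmod b) * v"
    proof (cases "b = 0")
      case True then show ?thesis using that[of 1] by simp
    next
      case False then show ?thesis using that[of "b / of_real (cmod b)"] by (simp add: norm_divide)
    qed
    define rot where "rot u = (\<chi> k. (if k = m then u else 1) * y $ k)" for u
    have rot: "rot u \<in> \<Omega>" if "cmod u = 1" for u
      using rotation_domain[OF y, of "\<chi> k. if k = m then u else 1"] that by (simp add: rot_def)
    define s where "s = (1 + cmod b) / 2"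
    have s: "0 \<le> s" "s \<le> 1" using b by (auto simp: s_def)
    have "(1 - s) *\<^sub>R rot (- v) + s *\<^sub>R rot v \<in> \<Omega>"
      using convex_domain rot[of v] rot[of "- v"] v(1) s unfolding convex_alt by simp
    moreover have "(1 - s) *\<^sub>R rot (- v) + s *\<^sub>R rot v = rot b"
    proof -
      have "2 * s - 1 = cmod b" by (simp add: s_def field_simps)
      then have bv: "of_real (2 * s - 1) * v = b" by (simp only: v(2)[symmetric])
      then have e: "b * x = (1 - s) *\<^sub>R (- v * x) + s *\<^sub>R (v * x)" for x
        unfolding bv[symmetric] by (simp add: scaleR_conv_of_real algebra_simps)
      have "x = (1 - s) *\<^sub>R x + s *\<^sub>R x" for x :: complex by (simp add: scaleR_conv_of_real algebra_simps)
      then show ?thesis using e by (auto simp: rot_def vec_eq_iff)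
    qed
    ultimately show ?thesis by (simp add: rot_def)
  qed
  have "(\<chi> k. (if k = 2 then c 2 else 1) * (\<chi> k. (if k = 1 then c 1 else 1) * z $ k) $ k) \<in> \<Omega>"
    by (intro one z c)
  also have "(\<chi> k. (if k = 2 then c 2 else 1) * (\<chi> k. (if k = 1 then c 1 else 1) * z $ k) $ k) = (\<chi> k. c k * z $ k)"
    by (auto simp: vec_eq_iff forall_2)
  finally show ?thesis .
qed

lemma closure_complete:
  assumes z: "z \<in> closure \<Omega>" and c: "\<And>k. cmod (c k) \<le> 1"
  shows "(\<chi> k. c k * z $ k) \<in> closure \<Omega>"
proof -
  have "(\<lambda>z. \<chi> k. c k * z $ k) ` closure \<Omega> \<subseteq> closure \<Omega>"
    by (rule image_closure_subset)
       (use domain_complete[of _ c] c closure_subset in \<open>auto intro!: continuous_intros\<close>)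
  then show ?thesis using z by blast
qed

lemma zero_in_domain: "0 \<in> \<Omega>"
proof -
  obtain z where "z \<in> \<Omega>" using nonempty_domain by blast
  from domain_complete[OF this, of "\<lambda>_. 0"] show ?thesis by (simp add: vec_eq_iff[symmetric] zero_vec_def)
qed

text \<open>
  Rotating the coordinates of \<open>w\<close> makes all summands of the supporting functional nonnegative, so
  the half space bounds the sum of their moduli. The point \<open>p\<close> attains this bound, hence its
  summands are nonnegative already.
\<close>

lemma supporting_weights:
  assumes p: "p \<in> frontier \<Omega>"
  obtains a where "a \<noteq> 0" "a \<bullet> p > 0"
    "\<And>w. w \<in> closure \<Omega> \<Longrightarrow> (\<Sum>k\<in>UNIV. cmod (a $ k) * cmod (w $ k)) \<le> a \<bullet> p"
    "\<And>k. cnj (a $ k) * p $ k = of_real (cmod (a $ k) * cmod (p $ k))"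
proof -
  obtain a where a: "a \<noteq> 0" "\<And>w. w \<in> closure \<Omega> \<Longrightarrow> a \<bullet> w \<le> a \<bullet> p" "\<And>w. w \<in> \<Omega> \<Longrightarrow> a \<bullet> w < a \<bullet> p"
    using convex_open_supporting_functional[OF convex_domain open_domain p] by metis
  have inner: "a \<bullet> w = (\<Sum>k\<in>UNIV. Re (cnj (a $ k) * w $ k))" for w
    by (simp add: Re_linear_form[symmetric] linear_form_def)
  have sum_le: "(\<Sum>k\<in>UNIV. cmod (a $ k) * cmod (w $ k)) \<le> a \<bullet> p" if w: "w \<in> closure \<Omega>" for w
  proof -
    define x where "x k = cnj (a $ k) * w $ k" for k
    define c where "c k = (if x k = 0 then 1 else cnj (x k) / of_real (cmod (x k)))" for k
    have cx: "c k * x k = of_real (cmod (x k))" for k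
      using complex_norm_square[of "x k"] by (simp add: c_def power2_eq_square mult.commute divide_eq_eq)
    have "(\<chi> k. c k * w $ k) \<in> closure \<Omega>"
      by (rule closure_complete[OF w]) (simp add: c_def norm_divide)
    then have "a \<bullet> (\<chi> k. c k * w $ k) \<le> a \<bullet> p" by (rule a(2))
    moreover have "cnj (a $ k) * (c k * w $ k) = c k * x k" for k by (simp add: x_def)
    ultimately have "(\<Sum>k\<in>UNIV. cmod (x k)) \<le> a \<bullet> p"
      unfolding inner by (simp add: cx)
    then show ?thesis by (simp add: x_def norm_mult)
  qed
  have real: "cnj (a $ k) * p $ k = of_real (cmod (a $ k) * cmod (p $ k))" for k
  proof -
    have "p \<in> closure \<Omega>" using p by (simp add: frontier_def)
    then have "(\<Sum>k\<in>UNIV. cmod (cnj (a $ k) * p $ k)) \<le> (\<Sum>k\<in>UNIV. Re (cnj (a $ k) * p $ k))"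
      using sum_le[of p] unfolding norm_mult complex_mod_cnj by (simp only: inner)
    from sum_norm_le_sum_Re_imp_eq[OF _ this, of k] show ?thesis
      by (simp add: norm_mult)
  qed
  have "a \<bullet> p > 0" using a(3)[OF zero_in_domain] by simp
  then show ?thesis using that a(1) sum_le real by blast
qed

end

section \<open>Boundary points without discs\<close>

text \<open>
  This turns a condition on the zero set of \<open>G\<close> into a pointwise inequality, which can be integrated.
\<close>

lemma compact_penalty:
  fixes F G :: "'a :: metric_space \<Rightarrow> real"
  assumes K: "compact K" and F: "continuous_on K F" and G: "continuous_on K G"
    and pos: "\<And>w. w \<in> K \<Longrightarrow> G w \<ge> 0" and small: "\<And>w. w \<in> K \<Longrightarrow> G w = 0 \<Longrightarrow> F w < \<epsilon>" and \<epsilon>: "\<epsilon> > 0"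
  obtains C where "C \<ge> 0" "\<And>w. w \<in> K \<Longrightarrow> F w \<le> \<epsilon> + C * G w"
proof -
  define E where "E = {w \<in> K. \<epsilon> \<le> F w}"
  have "closed E"
    unfolding E_def using continuous_on_closed_Collect_le[OF continuous_on_const F compact_imp_closed[OF K]] .
  then have E: "compact E" using compact_Int_closed[OF K, of E] by (auto simp: E_def Int_def conj_commute intro: back_subst[of compact])
  show ?thesis
  proof (cases "E = {}")
    case True
    then have "F w \<le> \<epsilon> + 0 * G w" if "w \<in> K" for w using that by (force simp: E_def)
    then show ?thesis using that[of 0] by simp
  next
    case False
    have EK: "E \<subseteq> K" by (auto simp: E_def)
    obtain m where m: "m \<in> E" "\<And>w. w \<in> E \<Longrightarrow> G m \<le> G w"
      using continuous_attains_inf[OF E False continuous_on_subset[OF G EK]] by blast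
    obtain M where M: "M \<in> E" "\<And>w. w \<in> E \<Longrightarrow> F w \<le> F M"
      using continuous_attains_sup[OF E False continuous_on_subset[OF F EK]] by blast
    have Gm: "G m > 0" using m(1) pos[of m] small[of m] by (force simp: E_def)
    have FM: "F M > 0" using M(1) \<epsilon> by (auto simp: E_def)
    have "F w \<le> \<epsilon> + F M / G m * G w" if w: "w \<in> K" for w
    proof (cases "w \<in> E")
      case True
      have "F w \<le> F M / G m * G m" using M(2)[OF True] Gm by simp
      also have "\<dots> \<le> F M / G m * G w" using m(2)[OF True] FM Gm by (intro mult_left_mono) auto
      finally show ?thesis using \<epsilon> by simp
    next
      case False
      then have "F w \<le> \<epsilon>" using w by (simp add: E_def)
      moreover have "F M / G m * G w \<ge> 0" using pos[OF w] FM Gm by simp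
      ultimately show ?thesis by simp
    qed
    then show ?thesis using that[of "F M / G m"] FM Gm by simp
  qed
qed

context bounded_open
begin

lemma berezin_holomorphic_symbol:
  assumes h: "holomorphic_sev h UNIV" and z: "z \<in> \<Omega>"
  shows "L2_inner \<Omega> (\<lambda>w. h w * normalized_kernel \<Omega> z w) (normalized_kernel \<Omega> z) = h z"
proof -
  have cont: "continuous_on S h" for S
    by (rule continuous_on_subset[OF holomorphic_sev_imp_continuous_on[OF h]]) simp
  obtain B where B: "\<And>w. w \<in> closure \<Omega> \<Longrightarrow> cmod (h w) \<le> B" using bounded_on_domain[OF cont] by metis
  have "(\<lambda>w. h w * normalized_kernel \<Omega> z w) \<in> bergman_space \<Omega>"
    by (rule bergman_space_mult[OF holomorphic_sev_subset[OF h] _ normalized_kernel(1)[OF z]])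
       (use B closure_subset in auto)
  from normalized_kernel(2)[OF z this] show ?thesis
    using normalized_kernel(4)[OF z] kernel_diag_pos[OF z] by simp
qed

lemma integral_square_normalized_kernel:
  assumes z: "z \<in> \<Omega>" and h: "continuous_on (closure \<Omega>) h"
  shows "integrable (lebesgue_on \<Omega>) (\<lambda>w. h w * of_real ((cmod (normalized_kernel \<Omega> z w))\<^sup>2))"
    and "L2_inner \<Omega> (\<lambda>w. h w * normalized_kernel \<Omega> z w) (normalized_kernel \<Omega> z) =
      (\<integral>w. h w * of_real ((cmod (normalized_kernel \<Omega> z w))\<^sup>2) \<partial>lebesgue_on \<Omega>)"
proof -
  note k = bergman_space_L2[OF normalized_kernel(1)[OF z]]
  have e: "h w * normalized_kernel \<Omega> z w * cnj (normalized_kernel \<Omega> z w) =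
      h w * of_real ((cmod (normalized_kernel \<Omega> z w))\<^sup>2)" for w
    by (simp only: complex_norm_square mult.assoc)
  show "integrable (lebesgue_on \<Omega>) (\<lambda>w. h w * of_real ((cmod (normalized_kernel \<Omega> z w))\<^sup>2))"
    using L2_inner_integrable[OF symbol_mult_L2(1)[OF h k] k] by (simp only: e)
  show "L2_inner \<Omega> (\<lambda>w. h w * normalized_kernel \<Omega> z w) (normalized_kernel \<Omega> z) =
      (\<integral>w. h w * of_real ((cmod (normalized_kernel \<Omega> z w))\<^sup>2) \<partial>lebesgue_on \<Omega>)"
    by (simp only: L2_inner_def e)
qed

text \<open>
  Integration against the squared modulus of the normalized kernel reproduces holomorphic
  functions. If \<open>p\<close> is the only point at which \<open>H\<close> and then \<open>Q\<close> have minimal real part, these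
  measures therefore concentrate at \<open>p\<close>.
\<close>

lemma berezin_tendsto_at_peak_point:
  assumes \<phi>: "continuous_on (closure \<Omega>) \<phi>"
    and z: "\<And>n. z n \<in> \<Omega>" and zlim: "z \<longlonglongrightarrow> p"
    and H: "holomorphic_sev H UNIV" "H p = 0" and Q: "holomorphic_sev Q UNIV" "Q p = 0"
    and Hpos: "\<And>w. w \<in> closure \<Omega> \<Longrightarrow> Re (H w) \<ge> 0"
    and Qpos: "\<And>w. w \<in> closure \<Omega> \<Longrightarrow> Re (H w) = 0 \<Longrightarrow> Re (Q w) \<ge> 0"
    and Qzero: "\<And>w. w \<in> closure \<Omega> \<Longrightarrow> Re (H w) = 0 \<Longrightarrow> Re (Q w) = 0 \<Longrightarrow> w = p"
  shows "(\<lambda>n. berezin \<Omega> (toeplitz \<Omega> \<phi>) (z n)) \<longlonglongrightarrow> \<phi> p"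
proof (rule LIMSEQ_I)
  let ?K = "closure \<Omega>"
  have K: "compact ?K" using bounded_domain by (simp add: compact_closure)
  have contH: "continuous_on S (\<lambda>w. Re (H w))" and contQ: "continuous_on S (\<lambda>w. Re (Q w))" for S
    by (intro continuous_intros continuous_on_subset[OF holomorphic_sev_imp_continuous_on[OF H(1)]]
          continuous_on_subset[OF holomorphic_sev_imp_continuous_on[OF Q(1)]] subset_UNIV)+
  fix e :: real assume e: "e > 0"
  define \<epsilon> where "\<epsilon> = e / 4"
  have \<epsilon>: "\<epsilon> > 0" using e by (simp add: \<epsilon>_def)
  let ?F = "\<lambda>w. cmod (\<phi> w - \<phi> p)"
  have contF: "continuous_on ?K ?F" by (intro continuous_intros \<phi>)
  define S where "S = {w \<in> ?K. Re (H w) = 0}"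
  have SK: "S \<subseteq> ?K" by (auto simp: S_def)
  have "closed S" unfolding S_def
    using continuous_closed_preimage_constant[OF contH[of ?K] closed_closure, of 0] .
  then have S: "compact S" using K SK by (meson compact_Int_closed compact_closure compact_eq_bounded_closed bounded_subset)
  obtain C1 where C1: "C1 \<ge> 0" "\<And>w. w \<in> S \<Longrightarrow> ?F w \<le> \<epsilon> + C1 * Re (Q w)"
    by (rule compact_penalty[OF S continuous_on_subset[OF contF SK] contQ _ _ \<epsilon>])
       (use Qpos Qzero \<epsilon> in \<open>auto simp: S_def\<close>)
  obtain C2 where C2: "C2 \<ge> 0" "\<And>w. w \<in> ?K \<Longrightarrow> ?F w - C1 * Re (Q w) \<le> 2 * \<epsilon> + C2 * Re (H w)"
  proof (rule compact_penalty[OF K, of "\<lambda>w. ?F w - C1 * Re (Q w)" "\<lambda>w. Re (H w)" "2 * \<epsilon>"])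
    show "continuous_on ?K (\<lambda>w. ?F w - C1 * Re (Q w))"
      by (intro continuous_on_diff continuous_on_mult continuous_on_const contF contQ)
    show "?F w - C1 * Re (Q w) < 2 * \<epsilon>" if "w \<in> ?K" "Re (H w) = 0" for w
      using C1(2)[of w] that \<epsilon> by (simp add: S_def)
  qed (use contH Hpos \<epsilon> in auto)
  define R where "R w = of_real C1 * Q w + of_real C2 * H w" for w
  have holR: "holomorphic_sev R UNIV"
    unfolding R_def by (intro holomorphic_sev_add holomorphic_sev_mult holomorphic_sev_const H Q)
  have contR: "continuous_on S R" for S
    by (rule continuous_on_subset[OF holomorphic_sev_imp_continuous_on[OF holR]]) simp
  have FR: "?F w \<le> 2 * \<epsilon> + Re (R w)" if "w \<in> ?K" for w
    using C2(2)[OF that] by (simp add: R_def)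
  have bound: "cmod (berezin \<Omega> (toeplitz \<Omega> \<phi>) (z n) - \<phi> p) \<le> 2 * \<epsilon> + Re (R (z n))" for n
  proof -
    let ?M = "lebesgue_on \<Omega>" and ?d = "\<lambda>w. (cmod (normalized_kernel \<Omega> (z n) w))\<^sup>2"
    note ik = integral_square_normalized_kernel[OF z[of n]]
    have one: "(\<integral>w. of_real (?d w) \<partial>?M) = (1 :: complex)" and onei: "integrable ?M (\<lambda>w. complex_of_real (?d w))"
      using berezin_holomorphic_symbol[OF holomorphic_sev_const[of 1] z[of n]] ik[of "\<lambda>_. 1"] by simp_all
    have di: "integrable ?M ?d" using L2_space_integrable[OF bergman_space_L2[OF normalized_kernel(1)[OF z]]] .
    have d1: "(\<integral>w. ?d w \<partial>?M) = 1" using one unfolding integral_complex_of_real by (simp only: of_real_eq_1_iff)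
    have "berezin \<Omega> (toeplitz \<Omega> \<phi>) (z n) - \<phi> p = (\<integral>w. \<phi> w * of_real (?d w) - \<phi> p * of_real (?d w) \<partial>?M)"
      unfolding berezin_toeplitz_eq[OF \<phi> z] ik(2)[OF \<phi>]
      using ik(1)[OF \<phi>] onei one by (subst Bochner_Integration.integral_diff) simp_all
    also have "cmod \<dots> \<le> (\<integral>w. cmod (\<phi> w * of_real (?d w) - \<phi> p * of_real (?d w)) \<partial>?M)"
      by (rule integral_norm_bound)
    also have "\<dots> \<le> (\<integral>w. 2 * \<epsilon> * ?d w + Re (R w * of_real (?d w)) \<partial>?M)"
    proof (rule integral_mono)
      show "integrable ?M (\<lambda>w. cmod (\<phi> w * of_real (?d w) - \<phi> p * of_real (?d w)))"
        using ik(1)[OF \<phi>] onei by (intro integrable_norm Bochner_Integration.integrable_diff) simp_all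
      show "integrable ?M (\<lambda>w. 2 * \<epsilon> * ?d w + Re (R w * of_real (?d w)))"
        using di integrable_Re[OF ik(1)[OF contR]] by (intro Bochner_Integration.integrable_add) simp_all
      fix w assume "w \<in> space ?M"
      then have "?F w * ?d w \<le> (2 * \<epsilon> + Re (R w)) * ?d w"
        using FR[of w] closure_subset by (intro mult_right_mono) auto
      moreover have "cmod (\<phi> w * of_real (?d w) - \<phi> p * of_real (?d w)) = ?F w * ?d w"
        unfolding left_diff_distrib[symmetric] norm_mult norm_of_real by simp
      moreover have "Re (R w * of_real (?d w)) = Re (R w) * ?d w" by simp
      ultimately show "cmod (\<phi> w * of_real (?d w) - \<phi> p * of_real (?d w)) \<le> 2 * \<epsilon> * ?d w + Re (R w * of_real (?d w))"
        by (simp only: distrib_right)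
    qed
    also have "\<dots> = 2 * \<epsilon> + Re (\<integral>w. R w * of_real (?d w) \<partial>?M)"
      using di d1 integrable_Re[OF ik(1)[OF contR]] integral_Re[OF ik(1)[OF contR]]
      by (subst Bochner_Integration.integral_add) simp_all
    also have "(\<integral>w. R w * of_real (?d w) \<partial>?M) = R (z n)"
      using berezin_holomorphic_symbol[OF holR z[of n]] ik(2)[OF contR] by simp
    finally show ?thesis .
  qed
  have "(\<lambda>n. 2 * \<epsilon> + Re (R (z n))) \<longlonglongrightarrow> 2 * \<epsilon> + Re (R p)"
    by (intro tendsto_intros continuous_on_tendsto_compose[OF contR[of UNIV] zlim]) auto
  moreover have "2 * \<epsilon> + Re (R p) < e" using H(2) Q(2) e by (simp add: R_def \<epsilon>_def)
  ultimately have "\<forall>\<^sub>F n in sequentially. 2 * \<epsilon> + Re (R (z n)) < e" by (rule order_tendstoD(2))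
  then obtain N where "\<And>n. n \<ge> N \<Longrightarrow> 2 * \<epsilon> + Re (R (z n)) < e" by (auto simp: eventually_sequentially)
  then show "\<exists>N. \<forall>n\<ge>N. norm (berezin \<Omega> (toeplitz \<Omega> \<phi>) (z n) - \<phi> p) < e"
    using bound le_less_trans by (intro exI[of _ N]) blast
qed

end

section \<open>Discs in the boundary\<close>

text \<open>
  The squared modulus of the normalized Bergman kernel of the disc: a probability density.
\<close>

definition disc_density :: "real \<Rightarrow> complex \<Rightarrow> complex \<Rightarrow> real" where
  "disc_density r z w = (cmod (disc_kernel r w z))\<^sup>2 / disc_kernel_diag r z"

lemma disc_density_nonneg: "disc_density r z w \<ge> 0"
  by (simp add: disc_density_def disc_kernel_diag_def)

lemma continuous_on_disc_density:
  assumes "\<And>w. w \<in> S \<Longrightarrow> cmod w * cmod z < r\<^sup>2" "cmod z < r"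
  shows "continuous_on S (disc_density r z)"
  unfolding disc_density_def using disc_kernel_diag_pos[OF assms(2)]
  by (intro continuous_intros continuous_on_disc_kernel assms(1)) auto

lemma disc_kernel_small:
  assumes "cmod w \<le> r" "cmod z < r" shows "cmod w * cmod z < r\<^sup>2"
proof -
  have r: "r > 0" using assms(2) le_less_trans norm_ge_zero by blast
  have "cmod w * cmod z \<le> r * cmod z" using assms(1) by (rule mult_right_mono) simp
  also have "\<dots> < r * r" using assms(2) r by simp
  finally show ?thesis by (simp add: power2_eq_square)
qed

lemma integrable_disc_density: "cmod z < r \<Longrightarrow> integrable (disc_measure r) (disc_density r z)"
proof -
  assume z: "cmod z < r"
  have c: "continuous_on (cball 0 r) (disc_density r z)"
    by (rule continuous_on_disc_density[OF _ z]) (use disc_kernel_small[OF _ z] in auto)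
  obtain B where B: "\<And>w. w \<in> cball 0 r \<Longrightarrow> norm (disc_density r z w) \<le> B"
    using continuous_on_compact_bound[OF c compact_cball] by metis
  have "continuous_on (ball 0 r) (disc_density r z)" by (rule continuous_on_subset[OF c]) auto
  then show ?thesis
    by (intro integrable_disc_measure[where B = B] measurable_disc_measureI) (use B in auto)
qed

lemma integral_disc_density:
  assumes "cmod z < r" shows "(\<integral>w. disc_density r z w \<partial>disc_measure r) = 1"
  unfolding disc_density_def using integral_disc_kernel[OF assms] disc_kernel_diag_pos[OF assms] by simp

lemma disc_density_eq:
  assumes "r > 0"
  shows "disc_density r z w = r\<^sup>2 * (r\<^sup>2 - (cmod z)\<^sup>2)\<^sup>2 / (pi * cmod (of_real (r\<^sup>2) - w * cnj z) ^ 4)"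
proof -
  define q where "q = cmod (of_real (r\<^sup>2) - w * cnj z)"
  have "cmod (disc_kernel r w z) = r\<^sup>2 / (pi * q\<^sup>2)"
    unfolding disc_kernel_def norm_divide norm_mult norm_power q_def norm_of_real by simp
  then have "disc_density r z w = (r\<^sup>2 / (pi * q\<^sup>2))\<^sup>2 / (r\<^sup>2 / (pi * (r\<^sup>2 - (cmod z)\<^sup>2)\<^sup>2))"
    by (simp add: disc_density_def disc_kernel_diag_def)
  also have "\<dots> = r\<^sup>2 * (r\<^sup>2 - (cmod z)\<^sup>2)\<^sup>2 / (pi * q ^ 4)"
    using assms by (cases "q = 0") (simp_all add: power_divide power_mult_distrib power2_eq_square power4_eq_xxxx mult_ac)
  finally show ?thesis by (simp add: q_def)
qed

text \<open>
  Off a neighbourhood of \<open>p\<close> the density is eventually at most a constant times \<open>(R\<^sup>2 - (s n * R)\<^sup>2)\<^sup>2\<close>.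
\<close>

lemma disc_density_approximate_identity:
  fixes F :: "complex \<Rightarrow> complex"
  assumes R: "R > 0" and p: "cmod p = R"
    and Fm: "F \<in> borel_measurable (disc_measure R)" and B: "\<And>w. w \<in> ball 0 R \<Longrightarrow> cmod (F w) \<le> B"
    and lim: "(F \<longlongrightarrow> l) (at p within ball 0 R)"
    and s: "\<And>n. 0 < s n" "\<And>n. s n < 1" "s \<longlonglongrightarrow> (1 :: real)"
  shows "(\<lambda>n. \<integral>w. F w * of_real (disc_density R (of_real (s n) * p) w) \<partial>disc_measure R) \<longlonglongrightarrow> l"
proof (rule LIMSEQ_I)
  fix e :: real assume e: "e > 0"
  let ?M = "disc_measure R" and ?\<mu> = "\<lambda>n. disc_density R (of_real (s n) * p)"
  have sp: "cmod (of_real (s n) * p) < R" for n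
    using s(1,2)[of n] R p by (simp add: norm_mult)
  have ball0: "p \<notin> ball 0 R" using p by simp
  obtain \<eta> where \<eta>: "\<eta> > 0" "\<And>w. w \<in> ball 0 R \<Longrightarrow> dist w p < \<eta> \<Longrightarrow> dist (F w) l < e / 2"
    using lim e ball0 unfolding tendsto_iff eventually_at by (metis half_gt_zero)
  \<comment> \<open>A lower bound for the denominator of the kernel at distance at least \<open>\<eta>\<close> from \<open>p\<close>.\<close>
  define q where "q = \<eta> * R / 4"
  have q: "q > 0" using R \<eta> by (simp add: q_def)
  define D where "D n = R\<^sup>2 * (R\<^sup>2 - (s n * R)\<^sup>2)\<^sup>2 / (pi * q ^ 4)" for n
  have D0: "D n \<ge> 0" for n using q by (simp add: D_def)
  define A where "A = measure ?M (space ?M)"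
  have BL: "B + cmod l \<ge> 0" using B[of 0] R norm_ge_zero order_trans by (metis add_nonneg_nonneg centre_in_ball)
  have far: "?\<mu> n w \<le> D n" if w: "w \<in> ball 0 R" "dist w p \<ge> \<eta>" and n: "s n \<ge> 1 / 2" "R\<^sup>2 * (1 - s n) \<le> q" for n w
  proof -
    have pp: "p * cnj p = of_real (R\<^sup>2)" using complex_norm_square[of p] p by simp
    have "of_real (R\<^sup>2) - w * cnj (of_real (s n) * p) = of_real (R\<^sup>2 * (1 - s n)) - of_real (s n) * ((w - p) * cnj p)"
      by (simp add: algebra_simps pp del: of_real_power)
    then have "cmod (of_real (R\<^sup>2) - w * cnj (of_real (s n) * p)) \<ge>
        cmod (of_real (s n) * ((w - p) * cnj p)) - cmod (of_real (R\<^sup>2 * (1 - s n)) :: complex)"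
      using norm_triangle_ineq2[of "of_real (s n) * ((w - p) * cnj p)" "of_real (R\<^sup>2 * (1 - s n))"]
      by (simp only: norm_minus_commute)
    moreover have "cmod (of_real (s n) * ((w - p) * cnj p)) \<ge> 1 / 2 * (\<eta> * R)"
    proof -
      have "1 / 2 * (\<eta> * R) \<le> s n * (dist w p * R)"
        using n(1) w(2) \<eta> R by (intro mult_mono) auto
      then show ?thesis using s(1)[of n] p by (simp add: norm_mult dist_norm)
    qed
    moreover have "cmod (of_real (R\<^sup>2 * (1 - s n)) :: complex) \<le> q"
      using n(2) s(2)[of n] R by (simp only: norm_of_real) simp
    ultimately have "cmod (of_real (R\<^sup>2) - w * cnj (of_real (s n) * p)) \<ge> q" by (simp add: q_def)
    then have "q ^ 4 \<le> cmod (of_real (R\<^sup>2) - w * cnj (of_real (s n) * p)) ^ 4" using q by (intro power_mono) auto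
    moreover have "cmod (of_real (s n) * p) = s n * R" using s(1)[of n] p by (simp add: norm_mult)
    ultimately show ?thesis
      unfolding disc_density_eq[OF R] D_def using q by (simp only:) (intro divide_left_mono mult_left_mono mult_pos_pos, auto)
  qed
  have "D \<longlonglongrightarrow> R\<^sup>2 * (R\<^sup>2 - (1 * R)\<^sup>2)\<^sup>2 / (pi * q ^ 4)"
    unfolding D_def by (intro tendsto_intros s) (use q in auto)
  then have "(\<lambda>n. e / 2 + (B + cmod l) * D n * A) \<longlonglongrightarrow> e / 2 + (B + cmod l) * 0 * A"
    by (intro tendsto_intros) simp
  then have ev1: "\<forall>\<^sub>F n in sequentially. e / 2 + (B + cmod l) * D n * A < e"
    by (rule order_tendstoD(2)) (use e in simp)
  have "(\<lambda>n. R\<^sup>2 * (1 - s n)) \<longlonglongrightarrow> R\<^sup>2 * (1 - 1)" by (intro tendsto_intros s)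
  then have ev2: "\<forall>\<^sub>F n in sequentially. R\<^sup>2 * (1 - s n) < q" by (rule order_tendstoD(2)) (use q in simp)
  have ev3: "\<forall>\<^sub>F n in sequentially. 1 / 2 < s n" by (rule order_tendstoD(1)[OF s(3)]) simp
  have "\<forall>\<^sub>F n in sequentially. norm ((\<integral>w. F w * of_real (?\<mu> n w) \<partial>?M) - l) < e"
    using ev1 ev2 ev3
  proof eventually_elim
    case (elim n)
    have \<mu>i: "integrable ?M (?\<mu> n)" by (rule integrable_disc_density[OF sp])
    have Fi: "integrable ?M (\<lambda>w. F w * of_real (?\<mu> n w))"
    proof (rule Bochner_Integration.integrable_bound[of _ "\<lambda>w. B * ?\<mu> n w"])
      show "integrable ?M (\<lambda>w. B * ?\<mu> n w)" using \<mu>i by simp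
      show "(\<lambda>w. F w * of_real (?\<mu> n w)) \<in> borel_measurable ?M"
        using Fm borel_measurable_integrable[OF \<mu>i] by measurable
      show "AE w in ?M. norm (F w * of_real (?\<mu> n w)) \<le> norm (B * ?\<mu> n w)"
      proof (rule AE_I2)
        fix w assume "w \<in> space ?M"
        then have "cmod (F w) \<le> B" using B by (simp add: space_restrict_space)
        then show "norm (F w * of_real (?\<mu> n w)) \<le> norm (B * ?\<mu> n w)"
          using disc_density_nonneg[of R _ w] by (simp add: norm_mult abs_mult mult_right_mono)
      qed
    qed
    have li: "integrable ?M (\<lambda>w. l * of_real (?\<mu> n w))" using \<mu>i by simp
    have "(\<integral>w. l * of_real (?\<mu> n w) \<partial>?M) = l"
      using integral_disc_density[OF sp[of n]] by (simp add: integral_complex_of_real)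
    then have "(\<integral>w. F w * of_real (?\<mu> n w) \<partial>?M) - l = (\<integral>w. F w * of_real (?\<mu> n w) - l * of_real (?\<mu> n w) \<partial>?M)"
      using Bochner_Integration.integral_diff[OF Fi li] by simp
    also have "cmod \<dots> \<le> (\<integral>w. cmod (F w * of_real (?\<mu> n w) - l * of_real (?\<mu> n w)) \<partial>?M)"
      by (rule integral_norm_bound)
    also have "\<dots> \<le> (\<integral>w. e / 2 * ?\<mu> n w + (B + cmod l) * D n \<partial>?M)"
    proof (rule integral_mono)
      show "integrable ?M (\<lambda>w. cmod (F w * of_real (?\<mu> n w) - l * of_real (?\<mu> n w)))"
        by (intro integrable_norm Bochner_Integration.integrable_diff Fi li)
      show "integrable ?M (\<lambda>w. e / 2 * ?\<mu> n w + (B + cmod l) * D n)"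
        using \<mu>i finite_measure.integrable_const[OF finite_disc_measure] by (intro Bochner_Integration.integrable_add) auto
      fix w assume "w \<in> space ?M"
      then have w: "w \<in> ball 0 R" by (simp add: space_restrict_space)
      have eq: "cmod (F w * of_real (?\<mu> n w) - l * of_real (?\<mu> n w)) = cmod (F w - l) * ?\<mu> n w"
        unfolding left_diff_distrib[symmetric] norm_mult norm_of_real using disc_density_nonneg by simp
      show "cmod (F w * of_real (?\<mu> n w) - l * of_real (?\<mu> n w)) \<le> e / 2 * ?\<mu> n w + (B + cmod l) * D n"
      proof (cases "dist w p < \<eta>")
        case True
        have "cmod (F w - l) * ?\<mu> n w \<le> e / 2 * ?\<mu> n w"
          using \<eta>(2)[OF w True] disc_density_nonneg by (intro mult_right_mono) (auto simp: dist_norm)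
        moreover have "(B + cmod l) * D n \<ge> 0" using BL D0 by simp
        ultimately show ?thesis unfolding eq by linarith
      next
        case False
        have "cmod (F w - l) * ?\<mu> n w \<le> (B + cmod l) * D n"
          using B[OF w] norm_triangle_ineq4[of "F w" l] far[OF w] False elim disc_density_nonneg BL
          by (intro mult_mono) auto
        moreover have "e / 2 * ?\<mu> n w \<ge> 0" using e disc_density_nonneg by simp
        ultimately show ?thesis unfolding eq by linarith
      qed
    qed
    also have "\<dots> = e / 2 + (B + cmod l) * D n * A"
      using \<mu>i integral_disc_density[OF sp[of n]] finite_measure.integrable_const[OF finite_disc_measure]
      by (subst Bochner_Integration.integral_add) (auto simp: A_def)
    finally show ?case using elim(1) by linarith
  qed
  then show "\<exists>N. \<forall>n\<ge>N. norm ((\<integral>w. F w * of_real (?\<mu> n w) \<partial>?M) - l) < e"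
    by (simp add: eventually_sequentially)
qed

lemma holomorphic_sev_disc_kernel:
  assumes "\<And>w. w \<in> \<Omega> \<Longrightarrow> cmod (w $ i) * cmod z < r\<^sup>2"
  shows "holomorphic_sev (\<lambda>w. disc_kernel r (w $ i) z) \<Omega>"
proof (rule holomorphic_sev_compose[OF holomorphic_sev_coord[of i]])
  fix w assume w: "w \<in> \<Omega>"
  have "of_real (r\<^sup>2) - (w $ i) * cnj z \<noteq> 0" by (rule disc_kernel_denominator_nonzero[OF assms[OF w]])
  then have "(\<lambda>x. of_real (r\<^sup>2) / (of_real pi * (of_real (r\<^sup>2) - x * cnj z)\<^sup>2)) field_differentiable at (w $ i)"
    by (intro derivative_intros) auto
  then show "\<exists>h'. ((\<lambda>x. disc_kernel r x z) has_field_derivative h') (at (w $ i))"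
    by (simp add: disc_kernel_def[abs_def] field_differentiable_def)
qed

lemma radii_tendsto_one: "(\<lambda>n. 1 - 1 / (real n + 2)) \<longlonglongrightarrow> 1"
proof -
  have "(\<lambda>n. 1 - 1 / real (n + 2)) \<longlonglongrightarrow> 1 - 0"
    by (intro tendsto_intros LIMSEQ_ignore_initial_segment lim_1_over_n)
  then show ?thesis by (simp add: add.commute)
qed

lemma AE_lborel_not_on_circle: "AE b in lborel. cmod b \<noteq> t"
proof (rule AE_I')
  show "sphere 0 t \<in> null_sets (lborel :: complex measure)"
  proof -
    have "sphere (0::complex) t \<in> null_sets lebesgue"
      using negligible_sphere[of "0::complex" t] by (simp add: negligible_iff_null_sets)
    then show ?thesis by (simp add: null_sets_completion_iff)
  qed
qed auto

context convex_reinhardt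
begin

lemma to_boundary_sequence:
  assumes "(g \<longlongrightarrow> 0) (to_boundary \<Omega>)" "\<And>n. z n \<in> \<Omega>" "z \<longlonglongrightarrow> q" "q \<in> frontier \<Omega>"
  shows "(\<lambda>n. g (z n)) \<longlonglongrightarrow> 0"
proof (rule filterlim_compose[OF assms(1)])
  show "filterlim z (to_boundary \<Omega>) sequentially"
    unfolding filterlim_iff eventually_to_boundary
  proof (intro allI impI)
    fix P assume "\<exists>\<delta>>0. \<forall>z\<in>\<Omega>. infdist z (frontier \<Omega>) < \<delta> \<longrightarrow> P z"
    then obtain \<delta> where \<delta>: "\<delta> > 0" "\<And>z. z \<in> \<Omega> \<Longrightarrow> infdist z (frontier \<Omega>) < \<delta> \<Longrightarrow> P z" by blast
    have "\<forall>\<^sub>F n in sequentially. dist (z n) q < \<delta>" using assms(3) \<delta>(1) by (simp add: tendsto_iff)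
    then show "\<forall>\<^sub>F n in sequentially. P (z n)"
      by eventually_elim (rule \<delta>(2)[OF assms(2) le_less_trans[OF infdist_le[OF assms(4)]]])
  qed
qed

text \<open>
  Let \<open>g n\<close> be the kernel function of the bidisc of radii \<open>R\<close> and \<open>t\<close> at \<open>z n = (\<alpha> n, \<beta>)\<close>, divided by
  its norm over the bidisc. Its square modulus is a product of two disc densities. As \<open>\<alpha> n\<close> tends to
  the circle, the first one concentrates at \<open>P\<close>, and the slices of the domain over points with
  \<open>cmod b > t\<close> stay away from \<open>P\<close>; so over the domain these measures tend to the second density on the
  boundary disc, and the norm of \<open>g n\<close> over the domain tends to 1. On the other hand its inner
  product with the normalized kernel of the domain is at least 1, because the kernel of the bidisc
  dominates on the diagonal. Hence \<open>g n\<close> may replace the normalized kernel, and the Berezin transform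
  of \<open>\<phi>\<close> on the boundary disc vanishes at \<open>\<beta>\<close>.
\<close>

lemma berezin_zero_on_face:
  assumes ij: "i \<noteq> j" and \<phi>: "continuous_on (closure \<Omega>) \<phi>"
    and ber: "(berezin \<Omega> (toeplitz \<Omega> \<phi>) \<longlongrightarrow> 0) (to_boundary \<Omega>)"
    and R: "R > 0" and P: "cmod P = R" and t: "t > 0"
    and coord: "\<And>w. w \<in> closure \<Omega> \<Longrightarrow> cmod (w $ i) \<le> R"
    and face: "\<And>b. pair_vec i P b \<in> closure \<Omega> \<longleftrightarrow> cmod b \<le> t"
    and b: "cmod b < t"
  shows "\<phi> (pair_vec i P b) = 0"
proof -
  have strict: "cmod (w $ i) < R" if w: "w \<in> \<Omega>" for w
  proof -
    obtain e where e: "e > 0" "ball w e \<subseteq> \<Omega>" using w open_domain open_contains_ball by blast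
    define c where "c = e / (2 * (norm w + 1))"
    have c: "c > 0" using e by (simp add: c_def add_nonneg_pos)
    have "c * norm w < e" unfolding c_def using e by (simp add: field_simps add_nonneg_pos add_pos_nonneg)
    then have "w + c *\<^sub>R w \<in> \<Omega>" using c by (intro subsetD[OF e(2)]) (simp add: dist_norm)
    then have "cmod ((w + c *\<^sub>R w) $ i) \<le> R" using coord closure_subset by blast
    moreover have "(w + c *\<^sub>R w) $ i = of_real (1 + c) * w $ i"
      by (simp add: scaleR_conv_of_real[of c "w $ i"] distrib_right)
    ultimately have le: "(1 + c) * cmod (w $ i) \<le> R" using c by (simp add: norm_mult del: of_real_add)
    show ?thesis
    proof (cases "w $ i = 0")
      case False
      then have "cmod (w $ i) < (1 + c) * cmod (w $ i)" using c by simp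
      then show ?thesis using le by linarith
    qed (use R in simp)
  qed
  have inside: "pair_vec i a c \<in> \<Omega>" if "cmod a < R" "cmod c < t" for a c
  proof -
    let ?U = "{w :: complex ^ 2. cmod (w $ i) < R \<and> cmod (w $ j) < t}"
    have "open ?U"
      by (intro open_Collect_conj open_Collect_less continuous_intros)
    moreover have "?U \<subseteq> closure \<Omega>"
    proof
      fix w assume w: "w \<in> ?U"
      have "pair_vec i P (of_real t) \<in> closure \<Omega>" using face t by simp
      from closure_complete[OF this, of "\<lambda>k. if k = i then w $ i / P else w $ j / of_real t"]
      have "(\<chi> k. (if k = i then w $ i / P else w $ j / of_real t) * pair_vec i P (of_real t) $ k) \<in> closure \<Omega>"
        using w P R t by (auto simp: norm_divide divide_le_eq)
      also have "(\<chi> k. (if k = i then w $ i / P else w $ j / of_real t) * pair_vec i P (of_real t) $ k) = w"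
        using P R t ij by (auto simp: vec_eq_iff pair_vec_def dest: eq_2_cases)
      finally show "w \<in> closure \<Omega>" .
    qed
    ultimately have "?U \<subseteq> interior (closure \<Omega>)" by (simp add: interior_maximal)
    also have "\<dots> = \<Omega>"
      using convex_interior_closure[OF convex_domain] open_domain by (simp add: interior_open)
    finally show ?thesis using that ij by auto
  qed
  have contj: "continuous_on (closure \<Omega>) (\<lambda>w. w $ j)" by (intro continuous_intros)
  obtain B2 where B2: "B2 \<ge> 0" "\<And>w. w \<in> closure \<Omega> \<Longrightarrow> cmod (w $ j) \<le> B2"
    using bounded_on_domain[OF contj] by blast
  \<comment> \<open>For \<open>cmod \<beta> < \<rho>\<close> the kernel of the disc of radius \<open>t\<close> at \<open>\<beta>\<close> has no pole over the closure of \<open>\<Omega>\<close>.\<close>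
  define \<rho> where "\<rho> = min t (t\<^sup>2 / (B2 + 1))"
  have \<rho>: "\<rho> > 0" using t B2 by (simp add: \<rho>_def)
  have contP: "continuous_on (cball 0 t) (\<lambda>b. \<phi> (pair_vec i P b))"
    by (rule continuous_on_compose2[OF \<phi>]) (auto intro!: continuous_intros simp: face)
  have "(\<integral>b. \<phi> (pair_vec i P b) * of_real ((cmod (disc_kernel t b \<beta>))\<^sup>2) \<partial>disc_measure t) = 0"
    if \<beta>: "cmod \<beta> < \<rho>" for \<beta>
  proof -
    have \<beta>t: "cmod \<beta> < t" using \<beta> by (simp add: \<rho>_def)
    have small\<beta>: "cmod (w $ j) * cmod \<beta> < t\<^sup>2" if "w \<in> closure \<Omega>" for w
    proof -
      have "cmod (w $ j) * cmod \<beta> \<le> B2 * cmod \<beta>" using B2(2)[OF that] by (rule mult_right_mono) simp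
      also have "\<dots> \<le> (B2 + 1) * cmod \<beta>" by (simp add: distrib_right)
      also have "\<dots> < (B2 + 1) * (t\<^sup>2 / (B2 + 1))" using \<beta> B2(1) by (intro mult_strict_left_mono) (auto simp: \<rho>_def)
      also have "\<dots> = t\<^sup>2" using B2(1) by simp
      finally show ?thesis .
    qed
    define s where "s n = 1 - 1 / (real n + 2)" for n
    have s: "0 < s n" "s n < 1" for n by (auto simp: s_def field_simps)
    have slim: "s \<longlonglongrightarrow> 1"
      unfolding s_def by (rule radii_tendsto_one)
    define \<alpha> where "\<alpha> n = of_real (s n) * P" for n
    have \<alpha>R: "cmod (\<alpha> n) < R" for n using s[of n] P R by (simp add: \<alpha>_def norm_mult)
    have small\<alpha>: "cmod (w $ i) * cmod (\<alpha> n) < R\<^sup>2" if "w \<in> closure \<Omega>" for w n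
      by (rule disc_kernel_small[OF coord[OF that] \<alpha>R])
    define z where "z n = pair_vec i (\<alpha> n) \<beta>" for n
    have z\<Omega>: "z n \<in> \<Omega>" for n unfolding z_def by (rule inside[OF \<alpha>R \<beta>t])
    define m where "m n = disc_kernel_diag R (\<alpha> n) * disc_kernel_diag t \<beta>" for n
    have m: "m n > 0" for n unfolding m_def by (intro mult_pos_pos disc_kernel_diag_pos \<alpha>R \<beta>t)
    define h where "h n w = of_real (1 / sqrt (m n)) * (disc_kernel R (w $ i) (\<alpha> n) * disc_kernel t (w $ j) \<beta>)" for n w
    define g where "g n w = (if w \<in> \<Omega> then h n w else 0)" for n w
    have holh: "holomorphic_sev (h n) \<Omega>" for n
      unfolding h_def using small\<alpha> small\<beta> closure_subset
      by (intro holomorphic_sev_mult holomorphic_sev_const holomorphic_sev_disc_kernel) blast+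
    have conth: "continuous_on (closure \<Omega>) (h n)" for n
      unfolding h_def
      by (intro continuous_intros continuous_on_compose2[OF continuous_on_disc_kernel[of "(\<lambda>w. w $ i) ` closure \<Omega>"]]
          continuous_on_compose2[OF continuous_on_disc_kernel[of "(\<lambda>w. w $ j) ` closure \<Omega>"]])
         (use small\<alpha> small\<beta> in auto)
    have g: "g n \<in> bergman_space \<Omega>" for n
    proof -
      obtain B where "\<And>w. w \<in> closure \<Omega> \<Longrightarrow> cmod (h n w) \<le> B" using bounded_on_domain[OF conth] by metis
      then show ?thesis
        unfolding g_def[abs_def] using closure_subset by (intro bergman_space_bounded[OF holh]) blast
    qed
    have gsq: "g n w * cnj (g n w) = of_real (disc_density R (\<alpha> n) (w $ i) * disc_density t \<beta> (w $ j))" if "w \<in> \<Omega>" for n w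
    proof -
      have "g n w * cnj (g n w) = of_real ((cmod (h n w))\<^sup>2)" using that by (simp only: complex_norm_square g_def if_True)
      also have "(cmod (h n w))\<^sup>2 = disc_density R (\<alpha> n) (w $ i) * disc_density t \<beta> (w $ j)"
        unfolding h_def norm_mult norm_of_real power_mult_distrib disc_density_def using m[of n]
        by (simp add: m_def power_divide)
      finally show ?thesis .
    qed
    have limit: "(\<lambda>n. L2_inner \<Omega> (\<lambda>w. \<Phi> w * g n w) (g n)) \<longlonglongrightarrow>
        (\<integral>b. \<Phi> (pair_vec i P b) * of_real (disc_density t \<beta> b) \<partial>disc_measure t)"
      if \<Phi>: "continuous_on (closure \<Omega>) \<Phi>" for \<Phi>
    proof -
      define f0 where "f0 w = indicator \<Omega> w *\<^sub>R (\<Phi> w * of_real (disc_density t \<beta> (w $ j)))" for w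
      have cont0: "continuous_on (closure \<Omega>) (\<lambda>w. \<Phi> w * of_real (disc_density t \<beta> (w $ j)))"
        by (intro continuous_intros \<Phi> continuous_on_compose2[OF continuous_on_disc_density[of "(\<lambda>w. w $ j) ` closure \<Omega>"]])
           (use small\<beta> \<beta>t in auto)
      obtain B where B: "B \<ge> 0" "\<And>w. w \<in> closure \<Omega> \<Longrightarrow> cmod (\<Phi> w * of_real (disc_density t \<beta> (w $ j))) \<le> B"
        using bounded_on_domain[OF cont0] by metis
      have f0B: "cmod (f0 w) \<le> B" for w
        using B closure_subset by (cases "w \<in> \<Omega>") (auto simp: f0_def)
      have f0m: "f0 \<in> borel_measurable borel"
        unfolding f0_def using open_domain continuous_on_subset[OF cont0 closure_subset]
        by (intro borel_measurable_continuous_on_indicator) auto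
      define f where "f n w = f0 w * of_real (disc_density R (\<alpha> n) (w $ i))" for n w
      have feq: "f n w = indicator \<Omega> w *\<^sub>R (\<Phi> w * g n w * cnj (g n w))" for n w
        by (cases "w \<in> \<Omega>") (simp_all add: f_def f0_def gsq mult.assoc mult.commute[of "complex_of_real (disc_density t \<beta> (w $ j))"])
      have int\<Omega>: "integrable (lebesgue_on \<Omega>) (\<lambda>w. \<Phi> w * g n w * cnj (g n w))" for n
        by (rule L2_inner_integrable[OF symbol_mult_L2(1)[OF \<Phi> bergman_space_L2[OF g]] bergman_space_L2[OF g]])
      have fm: "f n \<in> borel_measurable borel" for n
      proof -
        have c: "continuous_on (closure \<Omega>) (\<lambda>w. \<Phi> w * of_real (disc_density t \<beta> (w $ j)) * of_real (disc_density R (\<alpha> n) (w $ i)))"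
          by (intro continuous_intros cont0 continuous_on_compose2[OF continuous_on_disc_density[of "(\<lambda>w. w $ i) ` closure \<Omega>"]])
             (use small\<alpha> \<alpha>R in auto)
        have "(\<lambda>w. indicator \<Omega> w *\<^sub>R (\<Phi> w * of_real (disc_density t \<beta> (w $ j)) * of_real (disc_density R (\<alpha> n) (w $ i)))) \<in> borel_measurable borel"
          using open_domain borel_measurable_continuous_on_indicator[OF _ continuous_on_subset[OF c closure_subset]] by simp
        then show ?thesis by (simp add: f_def[abs_def] f0_def)
      qed
      have fi: "integrable lborel (f n)" for n
      proof -
        have "integrable lebesgue (f n)"
          unfolding feq[abs_def] using int\<Omega>[of n] open_domain by (subst (asm) integrable_restrict_space) auto
        then show ?thesis using fm[of n] by (simp add: integrable_completion)
      qed
      have inner: "L2_inner \<Omega> (\<lambda>w. \<Phi> w * g n w) (g n) = (\<integral>b. \<integral>a. f n (pair_vec i a b) \<partial>lborel \<partial>lborel)" for n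
      proof -
        have "L2_inner \<Omega> (\<lambda>w. \<Phi> w * g n w) (g n) = (\<integral>w. f n w \<partial>lebesgue)"
          unfolding L2_inner_def feq using open_domain by (subst integral_restrict_space) auto
        also have "\<dots> = (\<integral>w. f n w \<partial>lborel)" using fm[of n] by (simp add: integral_completion)
        also have "\<dots> = (\<integral>b. \<integral>a. f n (pair_vec j b a) \<partial>lborel \<partial>lborel)" by (rule integral_pair_vec(1)[OF fi])
        finally show ?thesis by (simp add: pair_vec_swap[OF ij])
      qed
      define X where "X n b = (\<integral>a. f n (pair_vec i a b) \<partial>lborel)" for n b
      have Xm: "X n \<in> borel_measurable lborel" for n
        using integral_pair_vec(2)[OF fi[of n], of j] by (simp add: X_def[abs_def] pair_vec_swap[OF ij])
      have Xdisc: "X n b = (\<integral>a. f0 (pair_vec i a b) * of_real (disc_density R (\<alpha> n) a) \<partial>disc_measure R)" for n b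
      proof -
        have "f n (pair_vec i a b) = indicator (ball 0 R) a *\<^sub>R (f0 (pair_vec i a b) * of_real (disc_density R (\<alpha> n) a))" for a
          using strict[of "pair_vec i a b"] by (auto simp: f_def f0_def indicator_def)
        then show ?thesis unfolding X_def by (subst integral_restrict_space) auto
      qed
      have slice_m: "(\<lambda>a. f0 (pair_vec i a b)) \<in> borel_measurable (disc_measure R)" for b
      proof -
        have "(\<lambda>a. pair_vec i a b) \<in> borel_measurable borel"
          by (intro borel_measurable_continuous_onI continuous_intros)
        from measurable_compose[OF this f0m] show ?thesis by (intro measurable_restrict_space1) simp
      qed
      define Y where "Y b = indicator (ball 0 t) b *\<^sub>R (\<Phi> (pair_vec i P b) * of_real (disc_density t \<beta> b))" for b
      have pw: "(\<lambda>n. X n b) \<longlonglongrightarrow> Y b" if bt: "cmod b \<noteq> t" for b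
      proof -
        have "((\<lambda>a. f0 (pair_vec i a b)) \<longlongrightarrow> Y b) (at P within ball 0 R)"
        proof (cases "cmod b < t")
          case True
          have c: "continuous_on (cball 0 R) (\<lambda>a. \<Phi> (pair_vec i a b) * of_real (disc_density t \<beta> (pair_vec i a b $ j)))"
          proof (rule continuous_on_compose2[OF cont0])
            show "(\<lambda>a. pair_vec i a b) ` cball 0 R \<subseteq> closure \<Omega>"
            proof (rule image_subsetI)
              fix a :: complex assume a: "a \<in> cball 0 R"
              have "pair_vec i P b \<in> closure \<Omega>" using face True by simp
              from closure_complete[OF this, of "\<lambda>k. if k = i then a / P else 1"]
              have "(\<chi> k. (if k = i then a / P else 1) * pair_vec i P b $ k) \<in> closure \<Omega>"
                using a P R by (auto simp: norm_divide)
              also have "(\<chi> k. (if k = i then a / P else 1) * pair_vec i P b $ k) = pair_vec i a b"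
                using P R by (auto simp: vec_eq_iff pair_vec_def)
              finally show "pair_vec i a b \<in> closure \<Omega>" .
            qed
          qed (intro continuous_intros)
          have "((\<lambda>a. \<Phi> (pair_vec i a b) * of_real (disc_density t \<beta> (pair_vec i a b $ j))) \<longlongrightarrow>
              \<Phi> (pair_vec i P b) * of_real (disc_density t \<beta> (pair_vec i P b $ j))) (at P within cball 0 R)"
            by (rule continuous_on_def[THEN iffD1, OF c, rule_format]) (use P in simp)
          then have lim: "((\<lambda>a. \<Phi> (pair_vec i a b) * of_real (disc_density t \<beta> (pair_vec i a b $ j))) \<longlongrightarrow> Y b) (at P within ball 0 R)"
            using True ij tendsto_within_subset[OF _ ball_subset_cball] by (force simp: Y_def)
          have "\<forall>\<^sub>F a in at P within ball 0 R. \<Phi> (pair_vec i a b) * of_real (disc_density t \<beta> (pair_vec i a b $ j)) = f0 (pair_vec i a b)"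
            using inside[OF _ True] by (auto simp: eventually_at_filter f0_def)
          then show ?thesis by (rule Lim_transform_eventually[OF lim])
        next
          case False
          then have "P \<in> (\<lambda>a. pair_vec i a b) -` (- closure \<Omega>)" using face bt by auto
          moreover have "open ((\<lambda>a. pair_vec i a b) -` (- closure \<Omega>))"
            by (rule open_vimage) (auto intro!: continuous_intros)
          ultimately have "\<forall>\<^sub>F a in nhds P. a \<in> (\<lambda>a. pair_vec i a b) -` (- closure \<Omega>)"
            by (intro eventually_nhds_in_open)
          then have "\<forall>\<^sub>F a in at P within ball 0 R. pair_vec i a b \<in> - closure \<Omega>"
            unfolding eventually_at_filter by eventually_elim auto
          then have "\<forall>\<^sub>F a in at P within ball 0 R. f0 (pair_vec i a b) = 0"
            by eventually_elim (use closure_subset in \<open>auto simp: f0_def indicator_def\<close>)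
          then show ?thesis using False by (simp add: Y_def tendsto_eventually)
        qed
        then show ?thesis
          unfolding Xdisc \<alpha>_def
          by (intro disc_density_approximate_identity[OF R P slice_m, of _ B] s slim f0B)
      qed
      have "(\<lambda>n. \<integral>b. X n b \<partial>lborel) \<longlonglongrightarrow> (\<integral>b. Y b \<partial>lborel)"
      proof (rule integral_dominated_convergence[where w = "\<lambda>b. B * indicator (cball 0 B2) b"])
        show "integrable lborel (\<lambda>b :: complex. B * indicator (cball 0 B2) b)"
          using emeasure_bounded_finite[of "cball (0::complex) B2"] by (intro integrable_mult_right integrable_real_indicator) auto
        show "Y \<in> borel_measurable lborel"
        proof -
          have "continuous_on (ball 0 t) (\<lambda>b. \<Phi> (pair_vec i P b) * of_real (disc_density t \<beta> b))"
            by (intro continuous_intros continuous_on_compose2[OF \<Phi>, of _ "\<lambda>b. pair_vec i P b"] continuous_on_disc_density[OF _ \<beta>t])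
               (auto simp: face intro!: disc_kernel_small \<beta>t)
          then show ?thesis unfolding Y_def by (simp add: borel_measurable_continuous_on_indicator)
        qed
        show "AE b in lborel. (\<lambda>n. X n b) \<longlonglongrightarrow> Y b"
          using AE_lborel_not_on_circle[of t] by eventually_elim (rule pw)
        show "AE b in lborel. norm (X n b) \<le> B * indicator (cball 0 B2) b" for n
        proof (rule AE_I2)
          fix b :: complex
          show "norm (X n b) \<le> B * indicator (cball 0 B2) b"
          proof (cases "b \<in> cball 0 B2")
            case True
            have "norm (X n b) \<le> (\<integral>a. cmod (f0 (pair_vec i a b) * of_real (disc_density R (\<alpha> n) a)) \<partial>disc_measure R)"
              unfolding Xdisc by (rule integral_norm_bound)
            also have "\<dots> \<le> (\<integral>a. B * disc_density R (\<alpha> n) a \<partial>disc_measure R)"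
            proof (rule integral_mono_AE')
              show "integrable (disc_measure R) (\<lambda>a. B * disc_density R (\<alpha> n) a)"
                using integrable_disc_density[OF \<alpha>R] by simp
              show "AE a in disc_measure R. cmod (f0 (pair_vec i a b) * of_real (disc_density R (\<alpha> n) a)) \<le> B * disc_density R (\<alpha> n) a"
                using f0B disc_density_nonneg by (intro AE_I2) (simp add: norm_mult mult_right_mono)
            qed (use B disc_density_nonneg in auto)
            also have "\<dots> = B" using integral_disc_density[OF \<alpha>R] by simp
            finally show ?thesis using True by simp
          next
            case False
            then have "pair_vec i a b \<notin> \<Omega>" for a
              using B2(2)[of "pair_vec i a b"] closure_subset ij by auto
            then have "X n b = 0" unfolding X_def f_def f0_def by simp
            then show ?thesis using False by simp
          qed
        qed
      qed (rule Xm)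
      moreover have "(\<integral>b. Y b \<partial>lborel) = (\<integral>b. \<Phi> (pair_vec i P b) * of_real (disc_density t \<beta> b) \<partial>disc_measure t)"
        unfolding Y_def by (subst integral_restrict_space) auto
      ultimately show ?thesis by (simp add: inner X_def)
    qed
    let ?k = "\<lambda>n. normalized_kernel \<Omega> (z n)"
    have kg: "?k n \<in> bergman_space \<Omega>" "L2_norm \<Omega> (?k n) = 1" for n using normalized_kernel z\<Omega> by auto
    have gnorm: "(\<lambda>n. (L2_norm \<Omega> (g n))\<^sup>2) \<longlonglongrightarrow> 1"
    proof -
      have "(\<lambda>n. L2_inner \<Omega> (\<lambda>w. 1 * g n w) (g n)) \<longlonglongrightarrow> (\<integral>b. 1 * of_real (disc_density t \<beta> b) \<partial>disc_measure t)"
        by (rule limit) (rule continuous_on_const)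
      then have "(\<lambda>n. complex_of_real ((L2_norm \<Omega> (g n))\<^sup>2)) \<longlonglongrightarrow> of_real 1"
        using integral_disc_density[OF \<beta>t] by (simp add: L2_inner_self integral_complex_of_real del: of_real_power)
      then show ?thesis by (simp only: tendsto_of_real_iff)
    qed
    \<comment> \<open>Comparison of the kernels on the diagonal shows that the inner product is at least 1.\<close>
    have close: "(L2_norm \<Omega> (\<lambda>w. g n w - ?k n w))\<^sup>2 \<le> (L2_norm \<Omega> (g n))\<^sup>2 - 1" for n
    proof -
      have K: "kernel_diag (z n) > 0" by (rule kernel_diag_pos[OF z\<Omega>])
      have "kernel_diag (z n) \<le> m n"
      proof -
        note k = bergman_kernel(1)[OF z\<Omega>[of n]]
        have le: "(cmod (bergman_kernel \<Omega> (z n) (z n)))\<^sup>2 \<le>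
            disc_kernel_diag R (z n $ i - 0 $ i) * disc_kernel_diag t (z n $ j - 0 $ j) * (L2_norm \<Omega> (\<lambda>w. bergman_kernel \<Omega> w (z n)))\<^sup>2"
        proof (rule Bergman_inequality_bidisc[OF ij bergman_space_holomorphic[OF k] open_domain])
          show "w \<in> \<Omega>" if "w $ i \<in> ball (0 $ i) R" "w $ j \<in> ball (0 $ j) t" for w
            using inside[of "w $ i" "w $ j"] that by (simp add: pair_vec_eta[OF ij])
        qed (use \<alpha>R \<beta>t ij L2_space_integrable[OF bergman_space_L2[OF k]] in \<open>auto simp: z_def\<close>)
        have "kernel_diag (z n) * kernel_diag (z n) \<le> m n * kernel_diag (z n)"
        proof -
          have "z n $ i = \<alpha> n" "z n $ j = \<beta>" using ij by (simp_all add: z_def)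
          moreover have "cmod (bergman_kernel \<Omega> (z n) (z n)) = kernel_diag (z n)"
            unfolding bergman_kernel_self[OF z\<Omega>] using K by simp
          ultimately show ?thesis
            using le by (simp add: kernel_diag_def[symmetric] m_def power2_eq_square[of "kernel_diag _"])
        qed
        then show ?thesis using K by simp
      qed
      then have "sqrt (kernel_diag (z n)) \<le> sqrt (m n)" by simp
      then have ge1: "1 \<le> sqrt (m n) / sqrt (kernel_diag (z n))" using K by simp
      have "g n (z n) = of_real (sqrt (m n))"
      proof -
        have "g n (z n) = of_real (1 / sqrt (m n)) * of_real (m n)"
          using z\<Omega>[of n] ij by (simp add: g_def h_def z_def disc_kernel_self m_def)
        also have "\<dots> = of_real (sqrt (m n))"
          using m[of n] by (simp only: of_real_mult[symmetric]) (simp add: real_div_sqrt)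
        finally show ?thesis .
      qed
      then have "L2_inner \<Omega> (g n) (?k n) = of_real (sqrt (m n) / sqrt (kernel_diag (z n)))"
        using normalized_kernel(2)[OF z\<Omega> g] by simp
      then have "Re (L2_inner \<Omega> (g n) (?k n)) \<ge> 1" using ge1 by simp
      then show ?thesis
        using L2_norm_diff_power2[OF bergman_space_L2[OF g] bergman_space_L2[OF kg(1)], of n n] kg(2)[of n] by simp
    qed
    have diff0: "(\<lambda>n. L2_norm \<Omega> (\<lambda>w. g n w - ?k n w)) \<longlonglongrightarrow> 0"
    proof -
      have "(\<lambda>n. (L2_norm \<Omega> (\<lambda>w. g n w - ?k n w))\<^sup>2) \<longlonglongrightarrow> 0"
      proof (rule tendsto_sandwich[OF _ _ tendsto_const])
        show "(\<lambda>n. (L2_norm \<Omega> (g n))\<^sup>2 - 1) \<longlonglongrightarrow> 0" using tendsto_diff[OF gnorm tendsto_const[of 1]] by simp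
      qed (use close in auto)
      from tendsto_real_sqrt[OF this] show ?thesis by (simp add: abs_of_nonneg[OF L2_norm_nonneg])
    qed
    obtain B where B: "B \<ge> 0" "\<And>w. w \<in> closure \<Omega> \<Longrightarrow> cmod (\<phi> w) \<le> B" using bounded_on_domain[OF \<phi>] by metis
    have \<phi>B: "L2_norm \<Omega> (\<lambda>w. \<phi> w * u w) \<le> B * L2_norm \<Omega> u" if "u \<in> L2_space \<Omega>" for u
      by (rule symbol_mult_L2(2)[OF \<phi> that]) (use B closure_subset in auto)
    have diffber: "cmod (L2_inner \<Omega> (\<lambda>w. \<phi> w * g n w) (g n) - berezin \<Omega> (toeplitz \<Omega> \<phi>) (z n)) \<le>
        B * L2_norm \<Omega> (\<lambda>w. g n w - ?k n w) * (L2_norm \<Omega> (g n) + 1)" for n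
    proof -
      note gL = bergman_space_L2[OF g[of n]] and kL = bergman_space_L2[OF kg(1)[of n]]
      note dL = L2_space_diff[OF gL kL]
      note \<phi>g = symbol_mult_L2(1)[OF \<phi> gL] and \<phi>k = symbol_mult_L2(1)[OF \<phi> kL] and \<phi>d = symbol_mult_L2(1)[OF \<phi> dL]
      have "(\<lambda>w. \<phi> w * (g n w - ?k n w)) = (\<lambda>w. \<phi> w * g n w - \<phi> w * ?k n w)" by (simp add: right_diff_distrib)
      then have "L2_inner \<Omega> (\<lambda>w. \<phi> w * (g n w - ?k n w)) (g n) =
          L2_inner \<Omega> (\<lambda>w. \<phi> w * g n w) (g n) - L2_inner \<Omega> (\<lambda>w. \<phi> w * ?k n w) (g n)"
        using L2_inner_diff_left[OF \<phi>g \<phi>k gL] by simp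
      moreover have "L2_inner \<Omega> (\<lambda>w. \<phi> w * ?k n w) (\<lambda>w. g n w - ?k n w) =
          L2_inner \<Omega> (\<lambda>w. \<phi> w * ?k n w) (g n) - L2_inner \<Omega> (\<lambda>w. \<phi> w * ?k n w) (?k n)"
        by (rule L2_inner_diff_right[OF gL kL \<phi>k])
      ultimately have "L2_inner \<Omega> (\<lambda>w. \<phi> w * g n w) (g n) - berezin \<Omega> (toeplitz \<Omega> \<phi>) (z n) =
          L2_inner \<Omega> (\<lambda>w. \<phi> w * (g n w - ?k n w)) (g n) + L2_inner \<Omega> (\<lambda>w. \<phi> w * ?k n w) (\<lambda>w. g n w - ?k n w)"
        by (simp add: berezin_toeplitz_eq[OF \<phi> z\<Omega>])
      also have "cmod \<dots> \<le> cmod (L2_inner \<Omega> (\<lambda>w. \<phi> w * (g n w - ?k n w)) (g n)) + cmod (L2_inner \<Omega> (\<lambda>w. \<phi> w * ?k n w) (\<lambda>w. g n w - ?k n w))"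
        by (rule norm_triangle_ineq)
      also have "\<dots> \<le> (B * L2_norm \<Omega> (\<lambda>w. g n w - ?k n w)) * L2_norm \<Omega> (g n) + (B * 1) * L2_norm \<Omega> (\<lambda>w. g n w - ?k n w)"
      proof (rule add_mono)
        show "cmod (L2_inner \<Omega> (\<lambda>w. \<phi> w * (g n w - ?k n w)) (g n)) \<le> (B * L2_norm \<Omega> (\<lambda>w. g n w - ?k n w)) * L2_norm \<Omega> (g n)"
          by (rule order_trans[OF L2_Cauchy_Schwarz[OF \<phi>d gL] mult_right_mono[OF \<phi>B[OF dL] L2_norm_nonneg]])
        show "cmod (L2_inner \<Omega> (\<lambda>w. \<phi> w * ?k n w) (\<lambda>w. g n w - ?k n w)) \<le> (B * 1) * L2_norm \<Omega> (\<lambda>w. g n w - ?k n w)"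
          using order_trans[OF L2_Cauchy_Schwarz[OF \<phi>k dL] mult_right_mono[OF \<phi>B[OF kL] L2_norm_nonneg]] kg(2)[of n] by simp
      qed
      finally show ?thesis by (simp add: algebra_simps)
    qed
    have zlim: "z \<longlonglongrightarrow> pair_vec i P \<beta>"
    proof -
      have "\<alpha> \<longlonglongrightarrow> of_real 1 * P" unfolding \<alpha>_def by (intro tendsto_intros slim)
      moreover have "continuous_on UNIV (\<lambda>a. pair_vec i a \<beta>)" by (intro continuous_intros)
      ultimately show ?thesis unfolding z_def using continuous_on_tendsto_compose[of UNIV "\<lambda>a. pair_vec i a \<beta>" \<alpha> P sequentially] by simp
    qed
    have front: "pair_vec i P \<beta> \<in> frontier \<Omega>"
      using face[of \<beta>] \<beta>t strict[of "pair_vec i P \<beta>"] P open_domain by (auto simp: frontier_def interior_open)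
    have ber0: "(\<lambda>n. berezin \<Omega> (toeplitz \<Omega> \<phi>) (z n)) \<longlonglongrightarrow> 0"
      by (rule to_boundary_sequence[OF ber z\<Omega> zlim front])
    have "(\<lambda>n. L2_inner \<Omega> (\<lambda>w. \<phi> w * g n w) (g n) - berezin \<Omega> (toeplitz \<Omega> \<phi>) (z n)) \<longlonglongrightarrow> 0"
    proof (rule Lim_null_comparison)
      have "(\<lambda>n. L2_norm \<Omega> (g n)) \<longlonglongrightarrow> 1"
        using tendsto_real_sqrt[OF gnorm] by (simp add: abs_of_nonneg[OF L2_norm_nonneg])
      then have "(\<lambda>n. B * L2_norm \<Omega> (\<lambda>w. g n w - ?k n w) * (L2_norm \<Omega> (g n) + 1)) \<longlonglongrightarrow> B * 0 * (1 + 1)"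
        by (intro tendsto_intros diff0)
      then show "(\<lambda>n. B * L2_norm \<Omega> (\<lambda>w. g n w - ?k n w) * (L2_norm \<Omega> (g n) + 1)) \<longlonglongrightarrow> 0" by simp
    qed (use diffber in auto)
    from tendsto_add[OF this ber0] have "(\<lambda>n. L2_inner \<Omega> (\<lambda>w. \<phi> w * g n w) (g n)) \<longlonglongrightarrow> 0" by simp
    then have "(\<integral>b. \<phi> (pair_vec i P b) * of_real (disc_density t \<beta> b) \<partial>disc_measure t) = 0"
      using limit[OF \<phi>] LIMSEQ_unique by blast
    moreover have "(\<integral>b. \<phi> (pair_vec i P b) * of_real (disc_density t \<beta> b) \<partial>disc_measure t) =
        (\<integral>b. \<phi> (pair_vec i P b) * of_real ((cmod (disc_kernel t b \<beta>))\<^sup>2) \<partial>disc_measure t) / of_real (disc_kernel_diag t \<beta>)"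
      by (simp add: disc_density_def)
    ultimately show ?thesis using disc_kernel_diag_pos[OF \<beta>t] by simp
  qed
  then show ?thesis
    using disc_berezin_injective[OF t contP \<rho>] b by simp
qed

text \<open>
  If both coefficients of the supporting functional are nonzero, its real part determines the
  points of contact up to a real parameter, whose square is the real part of a quadratic
  polynomial and vanishes only at \<open>p\<close>. If one coefficient vanishes, the contact set in the direction of \<open>p\<close>
  is a point or a disc.
\<close>

theorem symbol_vanishes_if_berezin_tendsto_zero:
  assumes \<phi>: "continuous_on (closure \<Omega>) \<phi>"
    and ber: "(berezin \<Omega> (toeplitz \<Omega> \<phi>) \<longlongrightarrow> 0) (to_boundary \<Omega>)" and p: "p \<in> frontier \<Omega>"
  shows "\<phi> p = 0"
proof -
  obtain a where a: "a \<noteq> 0" "a \<bullet> p > 0"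
    "\<And>w. w \<in> closure \<Omega> \<Longrightarrow> (\<Sum>k\<in>UNIV. cmod (a $ k) * cmod (w $ k)) \<le> a \<bullet> p"
    "\<And>k. cnj (a $ k) * p $ k = of_real (cmod (a $ k) * cmod (p $ k))"
    by (rule supporting_weights[OF p]) (rule that)
  have pcl: "p \<in> closure \<Omega>" using p by (simp add: frontier_def)
  obtain z where z: "\<And>n. z n \<in> \<Omega>" "z \<longlonglongrightarrow> p" using pcl unfolding closure_sequential by blast
  note ber0 = to_boundary_sequence[OF ber z p]
  have ap: "a \<bullet> p = (\<Sum>k\<in>UNIV. cmod (a $ k) * cmod (p $ k))"
    using Re_linear_form[of a p, symmetric] a(4) by (simp add: linear_form_def)
  define H where "H w = linear_form a p + (-1) * linear_form a w" for w
  have holH: "holomorphic_sev H UNIV"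
    unfolding H_def by (intro holomorphic_sev_add holomorphic_sev_mult holomorphic_sev_const holomorphic_sev_linear_form)
  have term_le: "Re (cnj (a $ k) * w $ k) \<le> cmod (a $ k) * cmod (w $ k)" for k w
    using complex_Re_le_cmod[of "cnj (a $ k) * w $ k"] by (simp only: norm_mult complex_mod_cnj)
  have ReH: "Re (H w) = a \<bullet> p - (\<Sum>k\<in>UNIV. Re (cnj (a $ k) * w $ k))" for w
    by (simp add: H_def Re_linear_form[symmetric] linear_form_def)
  have Hpos: "Re (H w) \<ge> 0" if "w \<in> closure \<Omega>" for w
    using a(3)[OF that] sum_mono[of UNIV "\<lambda>k. Re (cnj (a $ k) * w $ k)" "\<lambda>k. cmod (a $ k) * cmod (w $ k)"] term_le
    by (fastforce simp: ReH)
  \<comment> \<open>On the contact set of the supporting hyperplane all the summands of the form are real.\<close>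
  have contact: "Im (cnj (a $ k) * w $ k) = 0" if w: "w \<in> closure \<Omega>" "Re (H w) = 0" for w k
  proof -
    have "(\<Sum>k\<in>UNIV. cmod (cnj (a $ k) * w $ k)) \<le> (\<Sum>k\<in>UNIV. Re (cnj (a $ k) * w $ k))"
      using a(3)[OF w(1)] w(2) unfolding ReH norm_mult complex_mod_cnj by simp
    from arg_cong[OF sum_norm_le_sum_Re_imp_eq[OF _ this, of k], of Im] show ?thesis by simp
  qed
  define x where "x k w = cnj (a $ k) * (w $ k - p $ k)" for k w
  have Imx: "Im (x k w) = 0" if "w \<in> closure \<Omega>" "Re (H w) = 0" for k w
  proof -
    have "Im (cnj (a $ k) * p $ k) = 0" unfolding a(4) by simp
    then show ?thesis using contact[OF that, of k] by (simp add: x_def right_diff_distrib)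
  qed
  have sumx: "(\<Sum>k\<in>UNIV. Re (x k w)) = 0" if "Re (H w) = 0" for w
  proof -
    have "(\<Sum>k\<in>UNIV. Re (x k w)) = (\<Sum>k\<in>UNIV. Re (cnj (a $ k) * w $ k)) - (\<Sum>k\<in>UNIV. Re (cnj (a $ k) * p $ k))"
      by (simp add: x_def right_diff_distrib sum_subtractf)
    also have "(\<Sum>k\<in>UNIV. Re (cnj (a $ k) * p $ k)) = a \<bullet> p" unfolding a(4) ap by simp
    finally show ?thesis using that by (simp add: ReH)
  qed
  show ?thesis
  proof (cases "a $ 1 \<noteq> 0 \<and> a $ 2 \<noteq> 0")
    case True
    define Q where "Q w = x 1 w * x 1 w" for w
    have "holomorphic_sev (\<lambda>w. cnj (a $ 1) * (w $ 1 + (- (p $ 1)))) UNIV"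
      by (intro holomorphic_sev_add holomorphic_sev_mult holomorphic_sev_const holomorphic_sev_coord)
    then have "holomorphic_sev (x 1) UNIV" by (simp add: x_def[abs_def])
    from holomorphic_sev_mult[OF this this] have holQ: "holomorphic_sev Q UNIV"
      by (simp add: Q_def[abs_def])
    have "(\<lambda>n. berezin \<Omega> (toeplitz \<Omega> \<phi>) (z n)) \<longlonglongrightarrow> \<phi> p"
    proof (rule berezin_tendsto_at_peak_point[OF \<phi> z holH _ holQ _ Hpos])
      show "H p = 0" "Q p = 0" by (simp_all add: H_def Q_def x_def)
      fix w assume w: "w \<in> closure \<Omega>" "Re (H w) = 0"
      have ReQ: "Re (Q w) = (Re (x 1 w))\<^sup>2" using Imx[OF w] by (simp add: Q_def power2_eq_square)
      then show "Re (Q w) \<ge> 0" by simp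
      assume "Re (Q w) = 0"
      then have "Re (x 1 w) = 0" using ReQ by simp
      moreover from this have "Re (x 2 w) = 0" using sumx[OF w(2)] by (simp add: sum_2)
      ultimately have "x 1 w = 0" "x 2 w = 0" using Imx[OF w] by (simp_all add: complex_eq_iff)
      then show "w = p" using True by (simp add: x_def vec_eq_iff forall_2)
    qed
    then show ?thesis using ber0 LIMSEQ_unique by blast
  next
    case False
    then obtain i j :: 2 where ij: "i \<noteq> j" and aj: "a $ j = 0"
      using that[of 2 1] that[of 1 2] by auto
    have ai: "a $ i \<noteq> 0"
    proof
      assume "a $ i = 0"
      then have "a $ k = 0" for k using aj eq_2_cases[OF ij, of k] by auto
      then have "a = 0" by (simp add: vec_eq_iff)
      then show False using a(1) by simp
    qed
    have sum_ij: "(\<Sum>k\<in>UNIV. f k) = f i + f j" for f :: "2 \<Rightarrow> real"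
    proof -
      have UNIV_ij: "(UNIV :: 2 set) = {i, j}" using eq_2_cases[OF ij] by auto
      show ?thesis unfolding UNIV_ij using ij by simp
    qed
    define R where "R = cmod (p $ i)"
    have coord: "cmod (w $ i) \<le> R" if "w \<in> closure \<Omega>" for w
      using a(3)[OF that] ai aj by (simp add: ap sum_ij R_def)
    have R: "R > 0" using a(2) ai aj by (simp add: ap sum_ij R_def zero_less_mult_iff)
    let ?S = "(\<lambda>b. pair_vec i (p $ i) b) -` closure \<Omega>"
    have pS: "p $ j \<in> ?S" using pcl by (simp add: pair_vec_eta[OF ij])
    have "closed ?S" by (rule closed_vimage) (auto intro!: continuous_intros)
    moreover have "continuous_on (closure \<Omega>) (\<lambda>w. w $ j)" by (intro continuous_intros)
    then obtain B where B: "\<And>w. w \<in> closure \<Omega> \<Longrightarrow> cmod (w $ j) \<le> B"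
      using bounded_on_domain by blast
    have "cmod b \<le> B" if "b \<in> ?S" for b using B[of "pair_vec i (p $ i) b"] that ij by simp
    then have "bounded ?S" by (auto simp: bounded_iff)
    ultimately have compS: "compact ?S" by (simp add: compact_eq_bounded_closed)
    have neS: "?S \<noteq> {}" using pS by blast
    obtain b0 where b0: "b0 \<in> ?S" "\<And>b. b \<in> ?S \<Longrightarrow> cmod b \<le> cmod b0"
      using continuous_attains_sup[OF compS neS continuous_on_norm[OF continuous_on_id]] by blast
    define t where "t = cmod b0"
    have face: "pair_vec i (p $ i) b \<in> closure \<Omega> \<longleftrightarrow> cmod b \<le> t" for b
    proof
      show "cmod b \<le> t" if "pair_vec i (p $ i) b \<in> closure \<Omega>" using b0(2)[of b] that by (simp add: t_def)
      assume b: "cmod b \<le> t"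
      have "pair_vec i (p $ i) b0 \<in> closure \<Omega>" using b0(1) by simp
      from closure_complete[OF this, of "\<lambda>k. if k = i then 1 else b / b0"]
      have "(\<chi> k. (if k = i then 1 else b / b0) * pair_vec i (p $ i) b0 $ k) \<in> closure \<Omega>"
        using b by (cases "b0 = 0") (auto simp: norm_divide t_def)
      also have "(\<chi> k. (if k = i then 1 else b / b0) * pair_vec i (p $ i) b0 $ k) = pair_vec i (p $ i) b"
        using b by (auto simp: vec_eq_iff pair_vec_def t_def)
      finally show "pair_vec i (p $ i) b \<in> closure \<Omega>" .
    qed
    have pj: "cmod (p $ j) \<le> t" using face pcl by (metis pair_vec_eta[OF ij])
    show ?thesis
    proof (cases "t = 0")
      case True
      have "(\<lambda>n. berezin \<Omega> (toeplitz \<Omega> \<phi>) (z n)) \<longlonglongrightarrow> \<phi> p"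
      proof (rule berezin_tendsto_at_peak_point[OF \<phi> z holH _ holomorphic_sev_const[of 0] _ Hpos])
        show "H p = 0" by (simp add: H_def)
        fix w assume w: "w \<in> closure \<Omega>" "Re (H w) = 0"
        have "Re (x i w) = 0" using sumx[OF w(2)] aj by (simp add: sum_ij x_def)
        then have "x i w = 0" using Imx[OF w, of i] by (simp add: complex_eq_iff)
        then have wi: "w $ i = p $ i" using ai by (simp add: x_def)
        then have "cmod (w $ j) \<le> t" using face[of "w $ j"] w(1) pair_vec_eta[OF ij, of w] by simp
        then have "w $ j = p $ j" using pj True by simp
        then have "w $ k = p $ k" for k using wi eq_2_cases[OF ij, of k] by auto
        then show "w = p" by (simp add: vec_eq_iff)
      qed simp_all
      then show ?thesis using ber0 LIMSEQ_unique by blast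
    next
      case False
      then have t: "t > 0" by (simp add: t_def)
      have zero: "\<phi> (pair_vec i (p $ i) b) = 0" if "cmod b < t" for b
        by (rule berezin_zero_on_face[OF ij \<phi> ber R _ t coord face that]) (simp_all add: R_def)
      \<comment> \<open>The point \<open>p\<close> may lie on the rim of the boundary disc, so it is approached from inside.\<close>
      define y where "y n = of_real (1 - 1 / (real n + 2)) * p $ j" for n :: nat
      have "cmod (y n) < t" for n
      proof (cases "p $ j = 0")
        case False
        have "(1 - 1 / (real n + 2)) * cmod (p $ j) < 1 * cmod (p $ j)"
          using False by (intro mult_strict_right_mono) auto
        moreover have "cmod (y n) = (1 - 1 / (real n + 2)) * cmod (p $ j)"
          unfolding y_def norm_mult norm_of_real by simp
        ultimately show ?thesis using pj by simp
      qed (use t in \<open>simp add: y_def\<close>)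
      then have y: "\<phi> (pair_vec i (p $ i) (y n)) = 0" "pair_vec i (p $ i) (y n) \<in> closure \<Omega>" for n
        using zero face by (simp_all add: less_imp_le)
      have "y \<longlonglongrightarrow> of_real 1 * p $ j"
        unfolding y_def by (rule tendsto_mult_right[OF tendsto_of_real[OF radii_tendsto_one]])
      then have ylim: "y \<longlonglongrightarrow> p $ j" by simp
      have c: "continuous_on UNIV (\<lambda>b. pair_vec i (p $ i) b)" by (intro continuous_intros)
      have "(\<lambda>n. pair_vec i (p $ i) (y n)) \<longlonglongrightarrow> p"
        using continuous_on_tendsto_compose[OF c ylim] by (simp add: pair_vec_eta[OF ij])
      from continuous_on_tendsto_compose[OF \<phi> this pcl]
      have "(\<lambda>n. \<phi> (pair_vec i (p $ i) (y n))) \<longlonglongrightarrow> \<phi> p"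
        using y(2) by simp
      then show ?thesis using y(1) LIMSEQ_unique[OF _ tendsto_const] by simp
    qed
  qed
qed

end

theorem theorem1p1:
  fixes \<Omega> :: "(complex ^ 2) set" and \<phi> :: "complex ^ 2 \<Rightarrow> complex"
  assumes "reinhardt_domain \<Omega>" and "bounded \<Omega>" and "convex \<Omega>"
    and "continuous_on (closure \<Omega>) \<phi>"
  shows "compact_operator \<Omega> (toeplitz \<Omega> \<phi>) \<longleftrightarrow>
    (berezin \<Omega> (toeplitz \<Omega> \<phi>) \<longlongrightarrow> 0) (to_boundary \<Omega>)"
proof -
  interpret convex_reinhardt \<Omega>
    by unfold_locales (use assms in \<open>auto simp: reinhardt_domain_def\<close>)
  show ?thesis
    using compact_toeplitz_imp_berezin_tendsto_zero[OF assms(3,4)]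
      compact_toeplitz_if_vanishing_on_frontier[OF assms(4)]
      symbol_vanishes_if_berezin_tendsto_zero[OF assms(4)] by blast
qed

end
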